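(* Let $x_0$ be an $n$-body central configuration of general type, of rank $d$, satisfying condition (H) (defined in the context), and let $B_0$ be its intrinsic inertia endomorphism. Then the intrinsic inertia endomorphisms $B$ of the balanced configurations $x$ close enough to $x_0$ and of the same rank $d$ form a $d$-dimensional submanifold, which can be parametrized either by their non-zero eigenvalues $(b_1,\dots,b_d)$ or by the eigenvalues (up to the factor $-\tfrac12$) $(\lambda_1,\dots,\lambda_d)$ of the restriction $A|_{\mathrm{Im} B}$ to their image of their Wintner–Conley endomorphism. In particular, among these balanced configurations, the degeneracy of $A|_{\mathrm{Im}B}$ (existence of a multiple eigenvalue) is a codimension $1$ property.
   Context: Setting: $n$ bodies with positive masses $m_1,\dots,m_n$. Let $\mathcal D^*=\{\xi\in\mathbb R^n:\sum_i\xi_i=0\}$ with the Euclidean inner product $\langle\xi,\eta\rangle=\sum_i \xi_i\eta_i/m_i$ ("symmetric", "orthonormal", "isometry" in $\mathcal D^*$ refer to it); $(e_i)$ is the standard basis of $\mathbb R^n$. A configuration $x=(\vec r_1,\dots,\vec r_n)$ in a Euclidean space $E$, up to translation, is identified with the linear map $x:\mathcal D^*\to E$, $\xi\mapsto\sum\xi_i\vec r_i$; its rank (dimension) is the rank of this map. Only non-collision configurations ($r_{ij}=|\vec r_i-\vec r_j|>0$ for $i\ne j$) are considered; $s_{ij}=r_{ij}^2$. Intrinsic inertia endomorphism: the symmetric endomorphism $B$ of $\mathcal D^*$ with $\langle B\xi,\eta\rangle=\langle x(\xi),x(\eta)\rangle_E$. It determines $x$ up to isometry, has the same rank as $x$,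 and $s_{ij}=\langle B(e_i-e_j),e_i-e_j\rangle$. "Close" configurations means close $B$'s. Potential: $U=\sum_{i<j}m_im_j\Phi(s_{ij})$, $\Phi(s)=\mathcal G s^{-1/2}$, $\mathcal G>0$, viewed as a function $\tilde U(B)$ of $B$; $\varphi=\Phi'$. Wintner–Conley endomorphism: $A\xi=\sum_{i<j}\varphi(s_{ij})(m_j\xi_i-m_i\xi_j)(e_i-e_j)$, a symmetric endomorphism of $\mathcal D^*$; Newton's equations read $\ddot x=2x\circ A$. $x$ is balanced if $AB=BA$ (then $A$ preserves $\mathrm{Im}B$), equivalently if $B$ is a critical point of $\tilde U$ restricted to the isospectral submanifold of $B$ (all symmetric endomorphisms of $\mathcal D^*$ with the same spectrum as $B$). $x$ is central if moreover $A|_{\mathrm{Im}B}$ is a multiple of the identity. A balanced configuration $x_0$ with inertia $B_0$ is of general type if (1) the non-zero eigenvalues of $B_0$ are all distinct and (2) $B_0$ is a non-degenerate critical point of the restriction of $\tilde U$ to its isospectral submanifold. Eigenvalues: for $B$ near $B_0$ of rank $d$, there is an orthonormal basis of $\mathrm{Im}B$, close to a fixed eigenbasis of $B_0|_{\mathrm{Im}B_0}$, in which $B|_{\mathrm{Im}B}=\mathrm{diag}(b_1,\dots,b_d)$ and $A|_{\mathrm{Im}B}=-\frac12\mathrm{diag}(\lambda_1,\dots,\lambda_d)$; this fixes the indexing of the $b_i$ and $\lambda_i$. Condition (H) for $x_0$ (of rank $d$): the mapping $B\mapsto A|_{\mathrm{Im}B}$, which associates to the intrinsic inertia $B$ of a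 balanced configuration of the same rank $d$ (near $x_0$) the restriction to its image of its Wintner–Conley endomorphism, is a local diffeomorphism (onto its image) at $B_0$. Here endomorphisms of the varying subspaces $\mathrm{Im}B$ are compared with endomorphisms of $\mathrm{Im}B_0$ through isometries $\mathrm{Im}B\to\mathrm{Im}B_0$ depending smoothly on $B$ and equal to the identity at $B_0$ (for a central $x_0$ the choice does not affect the derivative at $B_0$). *)

theory Defs
  imports "HOL-Analysis.Analysis"
begin

section \<open>Smooth maps, submanifolds, non-degenerate critical points\<close>

primrec Ck_on :: "nat \<Rightarrow> 'a::real_normed_vector set \<Rightarrow> ('a \<Rightarrow> 'b::real_normed_vector) \<Rightarrow> bool" where
  "Ck_on 0 U f \<longleftrightarrow> continuous_on U f"
| "Ck_on (Suc k) U f \<longleftrightarrow>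
     (\<forall>p\<in>U. f differentiable (at p)) \<and> (\<forall>v. Ck_on k U (\<lambda>p. frechet_derivative f (at p) v))"

text \<open>For an arbitrary subset \<open>S\<close> of a Euclidean space, smooth means: locally the restriction of
  a \<open>C\<^sup>\<infinity>\<close> map defined on an open subset of the ambient space. For open \<open>S\<close>, and for submanifolds \<open>S\<close>,
  this is the usual notion. A diffeomorphism of \<open>S\<close> onto \<open>T\<close> is a bijection that is smooth with
  smooth inverse in this sense.\<close>

definition smooth_on :: "'a::euclidean_space set \<Rightarrow> ('a \<Rightarrow> 'b::euclidean_space) \<Rightarrow> bool" where
  "smooth_on S f \<longleftrightarrow>
     (\<forall>p\<in>S. \<exists>U g. open U \<and> p \<in> U \<and> (\<forall>k. Ck_on k U g) \<and> (\<forall>q\<in>U \<inter> S. g q = f q))"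

definition diffeomorphism ::
  "'a::euclidean_space set \<Rightarrow> 'b::euclidean_space set \<Rightarrow> ('a \<Rightarrow> 'b) \<Rightarrow> ('b \<Rightarrow> 'a) \<Rightarrow> bool" where
  "diffeomorphism S T f g \<longleftrightarrow>
     smooth_on S f \<and> f ` S = T \<and> smooth_on T g \<and> g ` T = S \<and>
     (\<forall>p\<in>S. g (f p) = p) \<and> (\<forall>q\<in>T. f (g q) = q)"

definition slice_chart ::
  "'a::euclidean_space set \<Rightarrow> 'a \<Rightarrow> 'a set \<Rightarrow> 'a set \<Rightarrow> 'a set \<Rightarrow> ('a \<Rightarrow> 'a) \<Rightarrow> ('a \<Rightarrow> 'a) \<Rightarrow> bool" where
  "slice_chart S p L U V f g \<longleftrightarrow>
     subspace L \<and> open U \<and> p \<in> U \<and> open V \<and> diffeomorphism U V f g \<and> f ` (U \<inter> S) = V \<inter> L"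

definition submanifold :: "nat \<Rightarrow> 'a::euclidean_space set \<Rightarrow> bool" where
  "submanifold k S \<longleftrightarrow> (\<forall>p\<in>S. \<exists>L U V f g. slice_chart S p L U V f g \<and> dim L = k)"

definition hessian :: "('a::euclidean_space \<Rightarrow> real) \<Rightarrow> 'a \<Rightarrow> 'a \<Rightarrow> 'a \<Rightarrow> real" where
  "hessian h p v w = frechet_derivative (\<lambda>q. frechet_derivative h (at q) w) (at p) v"

text \<open>Non-degenerate critical point \<open>p\<close> of the restriction to \<open>S\<close> of a function \<open>F\<close> that is smooth
  on a neighbourhood of \<open>p\<close> in the ambient space. The function is read in a chart that flattens \<open>S\<close>;
  at a critical point the choice of the chart is irrelevant.\<close>

definition nondegenerate_critical_point_on ::
  "('a::euclidean_space \<Rightarrow> real) \<Rightarrow> 'a set \<Rightarrow> 'a \<Rightarrow> bool" where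
  "nondegenerate_critical_point_on F S p \<longleftrightarrow> p \<in> S \<and>
     (\<exists>L U V f g. slice_chart S p L U V f g \<and>
        (\<forall>v\<in>L. frechet_derivative (F \<circ> g) (at (f p)) v = 0) \<and>
        (\<forall>v\<in>L. (\<forall>w\<in>L. hessian (F \<circ> g) (f p) v w = 0) \<longrightarrow> v = 0))"


section \<open>The dispositions and their endomorphisms\<close>

type_synonym 'n disp = "(real, 'n) vec"
type_synonym 'n endo = "((real, 'n) vec, 'n) vec"

definition Dstar :: "'n::finite disp set" where
  "Dstar = {\<xi>. (\<Sum>i\<in>UNIV. \<xi> $ i) = 0}"

definition mdot :: "'n::finite disp \<Rightarrow> 'n disp \<Rightarrow> 'n disp \<Rightarrow> real" where
  "mdot m \<xi> \<eta> = (\<Sum>i\<in>UNIV. \<xi> $ i * \<eta> $ i / m $ i)"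

text \<open>An endomorphism of \<open>Dstar\<close> is encoded by the matrix of its extension by \<open>0\<close> to the orthogonal
  complement of \<open>Dstar\<close> for \<open>mdot m\<close>, which is the line spanned by \<open>m\<close>. This identifies the
  endomorphisms of \<open>Dstar\<close> with a linear subspace of the space of matrices.\<close>

definition sym_endo :: "'n::finite disp \<Rightarrow> ('n endo) set" where
  "sym_endo m = {B. (\<forall>\<xi>. B *v \<xi> \<in> Dstar) \<and> B *v m = 0 \<and>
     (\<forall>\<xi>\<in>Dstar. \<forall>\<eta>\<in>Dstar. mdot m (B *v \<xi>) \<eta> = mdot m \<xi> (B *v \<eta>))}"

definition endo_image :: "'n::finite endo \<Rightarrow> 'n disp set" where
  "endo_image B = (\<lambda>\<xi>. B *v \<xi>) ` Dstar"

definition eigenspace_on :: "'n::finite disp set \<Rightarrow> 'n endo \<Rightarrow> real \<Rightarrow> 'n disp set" where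
  "eigenspace_on W B c = {\<xi>\<in>W. B *v \<xi> = c *\<^sub>R \<xi>}"

text \<open>For symmetric endomorphisms, same spectrum means same eigenvalues with the same
  multiplicities.\<close>

definition isospectral :: "'n::finite disp \<Rightarrow> 'n endo \<Rightarrow> ('n endo) set" where
  "isospectral m B = {C \<in> sym_endo m. \<forall>c. dim (eigenspace_on Dstar C c) = dim (eigenspace_on Dstar B c)}"

definition orthonormal_basis_of :: "'n::finite disp \<Rightarrow> 'n disp set \<Rightarrow> ('d \<Rightarrow> 'n disp) \<Rightarrow> bool" where
  "orthonormal_basis_of m W u \<longleftrightarrow>
     (\<forall>i j. mdot m (u i) (u j) = (if i = j then 1 else 0)) \<and> span (range u) = W"

definition multiple_eigenvalue_on :: "'n::finite disp set \<Rightarrow> 'n endo \<Rightarrow> bool" where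
  "multiple_eigenvalue_on W A \<longleftrightarrow> (\<exists>c. 2 \<le> dim (eigenspace_on W A c))"


section \<open>Configurations\<close>

definition noncollision :: "('n \<Rightarrow> 'e::euclidean_space) \<Rightarrow> bool" where
  "noncollision x \<longleftrightarrow> (\<forall>i j. i \<noteq> j \<longrightarrow> 0 < dist (x i) (x j))"

definition config_map :: "('n::finite \<Rightarrow> 'e::euclidean_space) \<Rightarrow> 'n disp \<Rightarrow> 'e" where
  "config_map x \<xi> = (\<Sum>i\<in>UNIV. \<xi> $ i *\<^sub>R x i)"

definition config_rank :: "('n::finite \<Rightarrow> 'e::euclidean_space) \<Rightarrow> nat" where
  "config_rank x = dim (config_map x ` Dstar)"

definition inertia :: "'n::finite disp \<Rightarrow> ('n \<Rightarrow> 'e::euclidean_space) \<Rightarrow> 'n endo" where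
  "inertia m x = (THE B. B \<in> sym_endo m \<and>
     (\<forall>\<xi>\<in>Dstar. \<forall>\<eta>\<in>Dstar. mdot m (B *v \<xi>) \<eta> = config_map x \<xi> \<bullet> config_map x \<eta>))"

definition sqdist :: "'n::finite disp \<Rightarrow> 'n endo \<Rightarrow> 'n \<Rightarrow> 'n \<Rightarrow> real" where
  "sqdist m B i j = mdot m (B *v (axis i 1 - axis j 1)) (axis i 1 - axis j 1)"

lemma inertia_unique_existence:
  fixes m :: "'n::finite disp" and x :: "'n \<Rightarrow> 'e::euclidean_space"
  assumes m: "\<And>i. 0 < m $ i"
  shows "\<exists>!B. B \<in> sym_endo m \<and>
     (\<forall>\<xi>\<in>Dstar. \<forall>\<eta>\<in>Dstar. mdot m (B *v \<xi>) \<eta> = config_map x \<xi> \<bullet> config_map x \<eta>)"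
proof (rule ex_ex1I)
  define M where "M = (\<Sum>i\<in>UNIV. m $ i)"
  have M: "M > 0" unfolding M_def using m by (intro sum_pos) auto
  define c where "c = (1 / M) *\<^sub>R (\<Sum>i\<in>UNIV. m $ i *\<^sub>R x i)"
  define y where "y i = x i - c" for i
  define Y where "Y \<xi> = (\<Sum>i\<in>UNIV. \<xi> $ i *\<^sub>R y i)" for \<xi> :: "'n disp"
  have Ym: "Y m = 0"
  proof -
    have "Y m = (\<Sum>i\<in>UNIV. m $ i *\<^sub>R x i) - M *\<^sub>R c"
      unfolding Y_def y_def M_def by (simp add: scaleR_diff_right sum_subtractf scaleR_left.sum)
    also have "\<dots> = 0" unfolding c_def using M by simp
    finally show ?thesis .
  qed
  have Yx: "Y \<xi> = config_map x \<xi>" if "\<xi> \<in> Dstar" for \<xi>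
  proof -
    have "Y \<xi> = config_map x \<xi> - (\<Sum>i\<in>UNIV. \<xi> $ i) *\<^sub>R c"
      unfolding Y_def y_def config_map_def
      by (simp add: scaleR_diff_right sum_subtractf scaleR_left.sum)
    then show ?thesis using that by (simp add: Dstar_def)
  qed
  define B :: "'n endo" where "B = (\<chi> i j. m $ i * (y i \<bullet> y j))"
  have B: "(B *v \<xi>) $ i = m $ i * (y i \<bullet> Y \<xi>)" for \<xi> i
    unfolding B_def Y_def matrix_vector_mult_def
    by (simp add: inner_sum_right sum_distrib_left mult_ac)
  have mB: "mdot m (B *v \<xi>) \<eta> = Y \<xi> \<bullet> Y \<eta>" for \<xi> \<eta>
  proof -
    have "mdot m (B *v \<xi>) \<eta> = (\<Sum>i\<in>UNIV. \<eta> $ i * (y i \<bullet> Y \<xi>))"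
      unfolding mdot_def B using m by (intro sum.cong) (auto simp: less_imp_neq[symmetric])
    also have "\<dots> = Y \<eta> \<bullet> Y \<xi>"
      by (simp add: Y_def inner_sum_left)
    finally show ?thesis by (simp add: inner_commute)
  qed
  have sym: "mdot m \<xi> \<eta> = mdot m \<eta> \<xi>" for \<xi> \<eta>
    by (simp add: mdot_def mult.commute)
  have "B *v \<xi> \<in> Dstar" for \<xi>
  proof -
    have "(\<Sum>i\<in>UNIV. (B *v \<xi>) $ i) = Y m \<bullet> Y \<xi>"
      unfolding B by (simp add: Y_def inner_sum_left)
    then show ?thesis by (simp add: Dstar_def Ym)
  qed
  moreover have "B *v m = 0" by (simp add: vec_eq_iff B Ym)
  ultimately have "B \<in> sym_endo m"
    unfolding sym_endo_def by (simp add: mB sym[of _ "B *v _"] inner_commute)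
  then show "\<exists>B. B \<in> sym_endo m \<and>
     (\<forall>\<xi>\<in>Dstar. \<forall>\<eta>\<in>Dstar. mdot m (B *v \<xi>) \<eta> = config_map x \<xi> \<bullet> config_map x \<eta>)"
    using mB Yx by auto
next
  fix B C :: "'n endo"
  assume B: "B \<in> sym_endo m \<and>
     (\<forall>\<xi>\<in>Dstar. \<forall>\<eta>\<in>Dstar. mdot m (B *v \<xi>) \<eta> = config_map x \<xi> \<bullet> config_map x \<eta>)"
    and C: "C \<in> sym_endo m \<and>
     (\<forall>\<xi>\<in>Dstar. \<forall>\<eta>\<in>Dstar. mdot m (C *v \<xi>) \<eta> = config_map x \<xi> \<bullet> config_map x \<eta>)"
  have M: "(\<Sum>i\<in>UNIV. m $ i) > 0" using m by (intro sum_pos) auto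
  have diff: "mdot m (\<xi> - \<zeta>) \<eta> = mdot m \<xi> \<eta> - mdot m \<zeta> \<eta>" for \<xi> \<zeta> \<eta>
    by (simp add: mdot_def algebra_simps diff_divide_distrib sum_subtractf)
  have zero: "\<xi> = 0" if "mdot m \<xi> \<xi> = 0" for \<xi>
  proof -
    have "\<forall>i\<in>UNIV. \<xi> $ i * \<xi> $ i / m $ i = 0"
      using that unfolding mdot_def
      by (subst (asm) sum_nonneg_eq_0_iff) (auto simp: m less_imp_le)
    then show ?thesis by (auto simp: vec_eq_iff less_imp_neq[OF m, symmetric])
  qed
  have eq: "B *v \<xi> = C *v \<xi>" if "\<xi> \<in> Dstar" for \<xi>
  proof -
    have "B *v \<xi> - C *v \<xi> \<in> Dstar"
      using B C by (auto simp: sym_endo_def Dstar_def sum_subtractf)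
    then have "mdot m (B *v \<xi> - C *v \<xi>) (B *v \<xi> - C *v \<xi>) = 0"
      using B C that by (auto simp: diff)
    then show ?thesis using zero by force
  qed
  show "B = C"
    unfolding matrix_eq
  proof
    fix v :: "'n disp"
    define t where "t = (\<Sum>i\<in>UNIV. v $ i) / (\<Sum>i\<in>UNIV. m $ i)"
    have "v - t *\<^sub>R m \<in> Dstar"
      using M by (simp add: Dstar_def sum_subtractf t_def flip: sum_distrib_left sum_divide_distrib)
    from eq[OF this] show "B *v v = C *v v"
      using B C by (simp add: sym_endo_def matrix_vector_mult_diff_distrib matrix_vector_mult_scaleR)
  qed
qed

lemma sqdist_inertia:
  fixes m :: "'n::finite disp" and x :: "'n \<Rightarrow> 'e::euclidean_space"
  assumes "\<And>i. 0 < m $ i"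
  shows "sqdist m (inertia m x) i j = (dist (x i) (x j))\<^sup>2"
proof -
  have D: "(axis i 1 - axis j 1 :: 'n disp) \<in> Dstar"
    by (simp add: Dstar_def sum_subtractf axis_def)
  have "config_map x (axis i 1 - axis j 1) = x i - x j"
    by (simp add: config_map_def scaleR_diff_left sum_subtractf axis_def if_distrib[of "\<lambda>c. c *\<^sub>R _"]
        cong: if_cong)
  then show ?thesis
    using theI'[OF inertia_unique_existence[of m x, OF assms]] D
    by (simp add: sqdist_def inertia_def dist_norm power2_norm_eq_inner)
qed

definition Phi :: "real \<Rightarrow> real \<Rightarrow> real" where
  "Phi G s = G * s powr (- 1 / 2)"

definition potential :: "'n::{finite,linorder} disp \<Rightarrow> real \<Rightarrow> 'n endo \<Rightarrow> real" where
  "potential m G B = (\<Sum>(i, j) | i < j. m $ i * m $ j * Phi G (sqdist m B i j))"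

definition wintner_conley ::
  "'n::{finite,linorder} disp \<Rightarrow> real \<Rightarrow> ('n \<Rightarrow> 'n \<Rightarrow> real) \<Rightarrow> 'n endo" where
  "wintner_conley m G s = matrix (\<lambda>\<xi>. \<Sum>(i, j) | i < j.
     (deriv (Phi G) (s i j) * (m $ j * \<xi> $ i - m $ i * \<xi> $ j)) *\<^sub>R (axis i 1 - axis j 1))"

definition WC_config ::
  "'n::{finite,linorder} disp \<Rightarrow> real \<Rightarrow> ('n \<Rightarrow> 'e::euclidean_space) \<Rightarrow> 'n endo" where
  "WC_config m G x = wintner_conley m G (\<lambda>i j. (dist (x i) (x j))\<^sup>2)"

definition WC_inertia :: "'n::{finite,linorder} disp \<Rightarrow> real \<Rightarrow> 'n endo \<Rightarrow> 'n endo" where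
  "WC_inertia m G B = wintner_conley m G (sqdist m B)"

definition balanced ::
  "'n::{finite,linorder} disp \<Rightarrow> real \<Rightarrow> ('n \<Rightarrow> 'e::euclidean_space) \<Rightarrow> bool" where
  "balanced m G x \<longleftrightarrow> noncollision x \<and>
     WC_config m G x ** inertia m x = inertia m x ** WC_config m G x"

definition central ::
  "'n::{finite,linorder} disp \<Rightarrow> real \<Rightarrow> ('n \<Rightarrow> 'e::euclidean_space) \<Rightarrow> bool" where
  "central m G x \<longleftrightarrow> balanced m G x \<and>
     (\<exists>c. \<forall>\<xi>\<in>endo_image (inertia m x). WC_config m G x *v \<xi> = c *\<^sub>R \<xi>)"

definition general_type ::
  "'n::{finite,linorder} disp \<Rightarrow> real \<Rightarrow> ('n \<Rightarrow> 'e::euclidean_space) \<Rightarrow> bool" where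
  "general_type m G x \<longleftrightarrow> balanced m G x \<and>
     (\<forall>c. c \<noteq> 0 \<longrightarrow> dim (eigenspace_on Dstar (inertia m x) c) \<le> 1) \<and>
     nondegenerate_critical_point_on (potential m G) (isospectral m (inertia m x)) (inertia m x)"

text \<open>Only the rank of \<open>x0\<close> and the type of its ambient space matter here.\<close>

definition balanced_inertias ::
  "'n::{finite,linorder} disp \<Rightarrow> real \<Rightarrow> ('n \<Rightarrow> 'e::euclidean_space) \<Rightarrow> ('n endo) set" where
  "balanced_inertias m G x0 =
     {inertia m x | x :: 'n \<Rightarrow> 'e. balanced m G x \<and> config_rank x = config_rank x0}"

text \<open>In \<open>condition_H\<close>, \<open>J B\<close> induces the isometry from \<open>endo_image B\<close> onto \<open>endo_image B0\<close>, and \<open>F B\<close> is the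
  endomorphism \<open>J B \<circ> A \<circ> (J B)\<inverse>\<close> of \<open>endo_image B0\<close> obtained by transporting the
  restriction to \<open>endo_image B\<close> of the Wintner--Conley endomorphism \<open>A\<close>; it is encoded by its extension by \<open>0\<close>
  to the orthogonal complement of \<open>endo_image B0\<close>.\<close>

definition condition_H ::
  "'n::{finite,linorder} disp \<Rightarrow> real \<Rightarrow> ('n \<Rightarrow> 'e::euclidean_space) \<Rightarrow> bool" where
  "condition_H m G x0 \<longleftrightarrow> (let B0 = inertia m x0 in
     \<exists>W J F K. open W \<and> B0 \<in> W \<and>
       (let N = W \<inter> balanced_inertias m G x0 in
         smooth_on N J \<and>
         (\<forall>\<xi>\<in>endo_image B0. J B0 *v \<xi> = \<xi>) \<and>
         (\<forall>B\<in>N. (\<lambda>\<xi>. J B *v \<xi>) ` endo_image B = endo_image B0 \<and>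
           (\<forall>\<xi>\<in>endo_image B. \<forall>\<eta>\<in>endo_image B. mdot m (J B *v \<xi>) (J B *v \<eta>) = mdot m \<xi> \<eta>) \<and>
           (\<forall>\<xi>\<in>endo_image B. F B *v (J B *v \<xi>) = J B *v (WC_inertia m G B *v \<xi>)) \<and>
           (\<forall>\<eta>. (\<forall>\<zeta>\<in>endo_image B0. mdot m \<eta> \<zeta> = 0) \<longrightarrow> F B *v \<eta> = 0)) \<and>
         diffeomorphism N (F ` N) F (K :: 'n endo \<Rightarrow> 'n endo)))"

end

theory Submission
  imports Defs
begin

text \<open>Write \<open>B\<^sub>0 = diag v0\<close> in an eigenbasis \<open>u\<close> of its image, the eigenvalues \<open>v0 $ i\<close> being distinct and
positive, and let \<open>A(B)\<close> be the Wintner--Conley endomorphism.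

Every symmetric endomorphism near \<open>B\<^sub>0\<close> is uniquely \<open>Q D Q\<inverse>\<close>, where \<open>Q\<close> is the Cayley transform of a small
skew endomorphism without component inside the kernel of \<open>B\<^sub>0\<close>, and \<open>D\<close> commutes with \<open>B\<^sub>0\<close>
(\<open>spectral_chart\<close>, inverted by the inverse function theorem). This gives the eigenvalues and
eigenvectors as smooth functions of \<open>B\<close>. The rank of \<open>B\<close> is \<open>d\<close> exactly when \<open>D\<close> vanishes on the kernel of
\<open>B\<^sub>0\<close>, so that \<open>D = diag v\<close>, and then \<open>B\<close> is balanced exactly when \<open>Q\<inverse> A(B) Q\<close> has no off-diagonal part.

The differential of the potential at \<open>B\<close> is \<open>V \<mapsto> trace (A(B) V)\<close>. Hence the derivative at \<open>B\<^sub>0\<close> of that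
off-diagonal part, in the directions tangent to the isospectral manifold, represents the Hessian of the
restricted potential; this is \<open>balance_defect_derivative_nonzero\<close>. Non-degeneracy and the inverse function
theorem then yield exactly one balanced endomorphism \<open>\<psi> v\<close> of rank \<open>d\<close> near \<open>B\<^sub>0\<close> for each spectrum \<open>v\<close>
near \<open>v0\<close>, depending smoothly on \<open>v\<close> (\<open>balanced_local_structure\<close>). Being positive, it is the
inertia of a configuration. As \<open>\<psi>\<close> has a left inverse that is smooth in the ambient space, its image is a
submanifold (\<open>slice_chart_of_parametrization\<close>), parametrized by the eigenvalues.

Let \<open>\<Lambda> v\<close> be the eigenvalues of \<open>A(\<psi> v)\<close> on the image, up to the factor \<open>- 1 / 2\<close>. At the central
configuration they all coincide, so to first order the transported endomorphism \<open>F\<close> of condition (H) feels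
only the variation of \<open>\<Lambda>\<close>, and neither that of the eigenvectors nor that of the transporting isometries.
If \<open>D\<Lambda> h = 0\<close>, the derivative of \<open>F \<circ> \<psi>\<close> in the direction \<open>h\<close> is therefore \<open>0\<close>, and \<open>h = 0\<close> because \<open>F\<close>
has a smooth inverse (\<open>condition_H_injective\<close>). So \<open>\<Lambda>\<close> is a local diffeomorphism, the balanced
endomorphisms are also parametrized by \<open>\<Lambda>\<close>, and in these coordinates the coincidence of two eigenvalues is
a hyperplane.\<close>

section \<open>Calculus of smooth maps\<close>

lemma frechet_derivativeI:
  "(f has_derivative f') (at p) \<Longrightarrow> frechet_derivative f (at p) = f'"
  by (rule frechet_derivative_at[symmetric])

text \<open>\<open>Ck_on\<close> refers to derivatives at points in the ambient space, hence the openness assumption.\<close>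

lemma Ck_on_cong:
  assumes U: "open U" and "\<And>p. p \<in> U \<Longrightarrow> f p = g p" "Ck_on k U f"
  shows "Ck_on k U g"
  using assms(2,3)
proof (induction k arbitrary: f g)
  case 0
  then show ?case
    unfolding Ck_on.simps by (metis continuous_on_cong)
next
  case (Suc k)
  have D: "(g has_derivative frechet_derivative f (at p)) (at p)" if p: "p \<in> U" for p
  proof (rule has_derivative_transform_within_open[OF _ U p])
    show "(f has_derivative frechet_derivative f (at p)) (at p)"
      using Suc.prems(2) p unfolding Ck_on.simps frechet_derivative_works by blast
  qed (rule Suc.prems(1))
  have E: "frechet_derivative f (at p) = frechet_derivative g (at p)" if "p \<in> U" for p
    by (rule frechet_derivativeI[OF D[OF that], symmetric])
  have "Ck_on k U (\<lambda>p. frechet_derivative g (at p) v)" for v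
    by (rule Suc.IH[of "\<lambda>p. frechet_derivative f (at p) v"], simp only: E)
      (use Suc.prems(2) in \<open>unfold Ck_on.simps, blast\<close>)
  moreover have "\<forall>p\<in>U. g differentiable (at p)"
    using D differentiableI by blast
  ultimately show ?case by simp
qed

lemma Ck_on_subset: "Ck_on k U f \<Longrightarrow> V \<subseteq> U \<Longrightarrow> Ck_on k V f"
  by (induction k arbitrary: f) (auto intro: continuous_on_subset)

lemma Ck_on_SucI:
  assumes "open U" "\<And>p. p \<in> U \<Longrightarrow> (f has_derivative f' p) (at p)"
    and "\<And>v. Ck_on k U (\<lambda>p. f' p v)"
  shows "Ck_on (Suc k) U f"
proof -
  have "Ck_on k U (\<lambda>p. frechet_derivative f (at p) v)" for v
    using _ assms(3)[of v]
    by (rule Ck_on_cong[OF assms(1)]) (simp add: frechet_derivativeI[OF assms(2)])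
  then show ?thesis using assms(2) by (auto intro: differentiableI)
qed

lemma Ck_on_Suc_has_derivative:
  "Ck_on (Suc k) U f \<Longrightarrow> p \<in> U \<Longrightarrow> (f has_derivative frechet_derivative f (at p)) (at p)"
  by (simp add: frechet_derivative_works)

lemma Ck_on_SucD: "Ck_on (Suc k) U f \<Longrightarrow> Ck_on k U (\<lambda>p. frechet_derivative f (at p) v)"
  by auto

lemma Ck_on_Suc_imp: "Ck_on (Suc k) U f \<Longrightarrow> Ck_on k U f"
proof (induction k arbitrary: f)
  case 0
  then show ?case
    by (auto intro!: continuous_at_imp_continuous_on differentiable_imp_continuous_within)
next
  case (Suc k)
  then have "Ck_on k U (\<lambda>p. frechet_derivative f (at p) v)" for v
    by (intro Suc.IH Ck_on_SucD)
  with Suc.prems show ?case by simp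
qed

lemma Ck_on_mono: "j \<le> k \<Longrightarrow> Ck_on k U f \<Longrightarrow> Ck_on j U f"
proof (induction k)
  case (Suc k)
  then show ?case by (cases "j = Suc k") (auto simp del: Ck_on.simps dest: Ck_on_Suc_imp)
qed simp

lemma Ck_on_const: "Ck_on k U (\<lambda>p. c)"
  by (induction k arbitrary: c) auto

lemma Ck_on_bounded_linear: "bounded_linear f \<Longrightarrow> Ck_on k U f"
  by (cases k) (auto intro: linear_continuous_on bounded_linear_imp_differentiable
      simp: frechet_derivativeI[OF bounded_linear_imp_has_derivative] Ck_on_const)

lemma Ck_on_linear_compose:
  assumes "open U" "bounded_linear h" "Ck_on k U f"
  shows "Ck_on k U (\<lambda>p. h (f p))"
  using assms(3)
proof (induction k arbitrary: f)
  case 0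
  then show ?case
    by (auto intro: bounded_linear.continuous_on[OF assms(2)])
next
  case (Suc k)
  show ?case
    by (rule Ck_on_SucI[OF assms(1) bounded_linear.has_derivative[OF assms(2)
          Ck_on_Suc_has_derivative[OF Suc.prems]]]) (use Suc in auto)
qed

lemma Ck_on_add:
  assumes "open U" "Ck_on k U f" "Ck_on k U g"
  shows "Ck_on k U (\<lambda>p. f p + g p)"
  using assms(2,3)
proof (induction k arbitrary: f g)
  case 0
  then show ?case by (auto intro: continuous_intros)
next
  case (Suc k)
  show ?case
    by (rule Ck_on_SucI[OF assms(1) has_derivative_add[OF
          Ck_on_Suc_has_derivative[OF Suc.prems(1)] Ck_on_Suc_has_derivative[OF Suc.prems(2)]]])
      (use Suc in auto)
qed

lemma Ck_on_sum:
  assumes "open U" "\<And>i. i \<in> I \<Longrightarrow> Ck_on k U (f i)"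
  shows "Ck_on k U (\<lambda>p. \<Sum>i\<in>I. f i p)"
  using assms(2) by (induction I rule: infinite_finite_induct) (auto intro: Ck_on_const Ck_on_add assms(1))

lemma (in bounded_bilinear) Ck_on:
  assumes "open U" "Ck_on k U f" "Ck_on k U g"
  shows "Ck_on k U (\<lambda>p. prod (f p) (g p))"
  using assms(2,3)
proof (induction k arbitrary: f g)
  case 0
  then show ?case by (auto intro: continuous_on)
next
  case (Suc k)
  show ?case
    by (rule Ck_on_SucI[OF assms(1) FDERIV[OF
          Ck_on_Suc_has_derivative[OF Suc.prems(1)] Ck_on_Suc_has_derivative[OF Suc.prems(2)]]])
      (use Suc in \<open>auto intro!: Ck_on_add[OF assms(1)] Suc.IH intro: Ck_on_Suc_imp
         simp del: Ck_on.simps(2) dest: Ck_on_SucD\<close>)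
qed

lemma linear_Basis_expansion:
  fixes f :: "'a::euclidean_space \<Rightarrow> 'b::real_vector"
  assumes "linear f"
  shows "f x = (\<Sum>b\<in>Basis. (x \<bullet> b) *\<^sub>R f b)"
proof -
  have "f x = f (\<Sum>b\<in>Basis. (x \<bullet> b) *\<^sub>R b)" by (simp add: euclidean_representation)
  then show ?thesis by (simp add: linear_sum[OF assms] linear_cmul[OF assms])
qed

text \<open>A family of linear maps is as regular as its values at fixed vectors, also when it is applied to a
  moving vector.\<close>

lemma Ck_on_apply_linear:
  fixes w :: "'a::real_normed_vector \<Rightarrow> 'b::euclidean_space"
    and L :: "'a \<Rightarrow> 'b \<Rightarrow> 'c::real_normed_vector"
  assumes U: "open U" and w: "Ck_on k U w"
    and L: "\<And>p. p \<in> U \<Longrightarrow> linear (L p)" "\<And>b. Ck_on k U (\<lambda>p. L p b)"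
  shows "Ck_on k U (\<lambda>p. L p (w p))"
proof -
  have "Ck_on k U (\<lambda>p. \<Sum>b\<in>Basis. (w p \<bullet> b) *\<^sub>R L p b)"
    by (intro Ck_on_sum U bounded_bilinear.Ck_on[OF bounded_bilinear_scaleR] L
        Ck_on_linear_compose[OF U bounded_linear_inner_left] w)
  then show ?thesis
    by (rule Ck_on_cong[OF U, rotated]) (simp flip: linear_Basis_expansion[OF L(1)])
qed

lemma Ck_on_compose:
  fixes f :: "'a::real_normed_vector \<Rightarrow> 'b::euclidean_space"
    and g :: "'b \<Rightarrow> 'c::real_normed_vector"
  assumes U: "open U" and "Ck_on k U f" "Ck_on k V g" "f ` U \<subseteq> V"
  shows "Ck_on k U (\<lambda>p. g (f p))"
  using assms(2-)
proof (induction k arbitrary: g)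
  case 0
  then show ?case by (auto intro: continuous_on_compose2)
next
  case (Suc k)
  have D: "((\<lambda>p. g (f p)) has_derivative
      (\<lambda>v. frechet_derivative g (at (f p)) (frechet_derivative f (at p) v))) (at p)" if "p \<in> U" for p
    using Suc.prems that
    by (intro has_derivative_compose[OF Ck_on_Suc_has_derivative Ck_on_Suc_has_derivative]) auto
  show ?case
  proof (rule Ck_on_SucI[OF U D])
    fix v
    show "Ck_on k U (\<lambda>p. frechet_derivative g (at (f p)) (frechet_derivative f (at p) v))"
    proof (rule Ck_on_apply_linear[OF U])
      show "linear (frechet_derivative g (at (f p)))" if "p \<in> U" for p
        using Suc.prems that by (intro linear_frechet_derivative) auto
      show "Ck_on k U (\<lambda>p. frechet_derivative g (at (f p)) b)" for b
        using Suc.prems by (intro Suc.IH) (auto intro: Ck_on_Suc_imp simp del: Ck_on.simps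
            intro: Ck_on_SucD)
    qed (use Suc.prems in auto)
  qed
qed

lemma Ck_on_local:
  assumes "\<And>p. p \<in> S \<Longrightarrow> \<exists>U. open U \<and> p \<in> U \<and> Ck_on k U f"
  shows "Ck_on k S f"
  using assms
proof (induction k arbitrary: f)
  case 0
  then show ?case
    by (metis Ck_on.simps(1) continuous_at_imp_continuous_on continuous_on_eq_continuous_at)
next
  case (Suc k)
  then show ?case by (metis Ck_on.simps(2))
qed

text \<open>Inverting a linear map that depends on a parameter loses no regularity: the derivative of
  \<open>p \<mapsto> M p v\<close> in direction \<open>h\<close> is \<open>- M p (L' h (M p v))\<close> with \<open>L'\<close> the derivative of \<open>L\<close>, which
  lets the regularity be bootstrapped.\<close>

lemma inverse_family_bounded:
  fixes L M :: "'p::real_normed_vector \<Rightarrow> 'a::euclidean_space \<Rightarrow> 'a"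
  assumes U: "open U" "p \<in> U" and cont: "\<And>w. continuous_on U (\<lambda>p. L p w)"
    and lin: "\<And>p. p \<in> U \<Longrightarrow> linear (L p)" "\<And>p. p \<in> U \<Longrightarrow> linear (M p)"
    and inv: "\<And>p v. p \<in> U \<Longrightarrow> M p (L p v) = v" "\<And>p v. p \<in> U \<Longrightarrow> L p (M p v) = v"
  shows "\<exists>C>0. \<forall>\<^sub>F q in at p. \<forall>v. norm (M q v) \<le> C * norm v"
proof -
  obtain c where c: "c > 0" "\<And>v. norm (M p v) \<le> c * norm v"
    using linear_bounded_pos[OF lin(2)[OF U(2)]] by blast
  define S where "S q = (\<Sum>b\<in>Basis. norm (L q b - L p b))" for q
  have "((\<lambda>q. S q) \<longlongrightarrow> S p) (at p)"
    unfolding S_def using cont U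
    by (intro tendsto_intros) (simp add: continuous_on_eq_continuous_at isCont_def)
  then have "\<forall>\<^sub>F q in at p. S q < 1 / (2 * c)"
    using c(1) by (intro order_tendstoD) (auto simp: S_def)
  moreover have "\<forall>\<^sub>F q in at p. q \<in> U"
    using U by (intro eventually_at_in_open') auto
  ultimately have "\<forall>\<^sub>F q in at p. \<forall>v. norm (M q v) \<le> 2 * c * norm v"
  proof eventually_elim
    case (elim q)
    show ?case
    proof
      fix v
      define w where "w = M q v"
      have "L q w - L p w = (\<Sum>b\<in>Basis. (w \<bullet> b) *\<^sub>R (L q b - L p b))"
        by (subst (1 2) linear_Basis_expansion[OF lin(1)])
          (use elim U in \<open>auto simp: sum_subtractf scaleR_diff_right\<close>)
      also have "norm \<dots> \<le> (\<Sum>b\<in>Basis. norm w * norm (L q b - L p b))"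
        by (rule order_trans[OF norm_sum sum_mono]) (auto intro!: mult_right_mono Basis_le_norm)
      finally have d: "norm (L q w - L p w) \<le> norm w * S q"
        by (simp add: S_def sum_distrib_left)
      have "norm w = norm (M p (L p w))" by (simp add: inv U)
      also have "\<dots> \<le> c * norm (L p w)" by (rule c)
      also have "\<dots> \<le> c * (norm (L q w) + norm (L q w - L p w))"
        using c(1) norm_triangle_ineq4[of "L q w" "L q w - L p w"] by (intro mult_left_mono) auto
      also have "\<dots> \<le> c * (norm v + norm w * (1 / (2 * c)))"
        using d c(1) elim inv(2)[of q v]
          mult_left_mono[OF less_imp_le[OF elim(1)], of "norm w"]
        by (intro mult_left_mono add_mono) (auto simp: w_def)
      also have "\<dots> = c * norm v + norm w / 2" using c(1) by (simp add: field_simps)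
      finally show "norm (M q v) \<le> 2 * c * norm v" by (simp add: w_def)
    qed
  qed
  then show ?thesis using c(1) by (intro exI[of _ "2 * c"]) auto
qed

text \<open>No differentiability of \<open>g\<close> is needed, since \<open>f\<close> vanishes at \<open>p\<close>.\<close>

lemma has_derivative_scaleR_vanishing:
  fixes f :: "'p::real_normed_vector \<Rightarrow> real" and g :: "'p \<Rightarrow> 'a::real_normed_vector"
  assumes f: "(f has_derivative f') (at p)" "f p = 0" and g: "(g \<longlongrightarrow> a) (at p)"
  shows "((\<lambda>q. f q *\<^sub>R (g q - a)) has_derivative (\<lambda>h. 0)) (at p)"
proof -
  obtain K where K: "\<And>h. norm (f' h) \<le> norm h * K" "K \<ge> 0"
    using bounded_linear.nonneg_bounded[OF has_derivative_bounded_linear[OF f(1)]] by blast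
  define e where "e q = (f q - f' (q - p)) /\<^sub>R norm (q - p)" for q
  have e: "(e \<longlongrightarrow> 0) (at p)"
    using f unfolding e_def has_derivative_within by (simp add: divide_inverse mult.commute)
  have bound: "norm ((f q *\<^sub>R (g q - a)) /\<^sub>R norm (q - p)) \<le> (norm (e q) + K) * norm (g q - a)" for q
  proof (cases "q = p")
    case False
    then have n: "norm (q - p) > 0" by simp
    have "f q = norm (q - p) * e q + f' (q - p)"
      using n unfolding e_def by (simp add: field_simps del: norm_eq_zero zero_less_norm_iff)
    then have "\<bar>f q\<bar> \<le> norm (q - p) * norm (e q) + norm (f' (q - p))"
      by (metis abs_mult abs_norm_cancel abs_triangle_ineq real_norm_def)
    also have "\<dots> \<le> norm (q - p) * (norm (e q) + K)"
      using K(1)[of "q - p"] by (simp add: algebra_simps)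
    finally have "\<bar>f q\<bar> / norm (q - p) \<le> norm (e q) + K"
      using n by (simp add: divide_le_eq mult.commute)
    from mult_right_mono[OF this, of "norm (g q - a)"] show ?thesis
      by (simp add: divide_inverse abs_mult mult_ac)
  qed (simp add: K)
  have "((\<lambda>q. (f q *\<^sub>R (g q - a)) /\<^sub>R norm (q - p)) \<longlongrightarrow> 0) (at p)"
  proof (rule Lim_null_comparison)
    show "\<forall>\<^sub>F q in at p. norm ((f q *\<^sub>R (g q - a)) /\<^sub>R norm (q - p))
       \<le> (norm (e q) + K) * norm (g q - a)"
      using bound by simp
    have "((\<lambda>q. (norm (e q) + K) * norm (g q - a)) \<longlongrightarrow> (norm (0::real) + K) * 0) (at p)"
      by (intro tendsto_intros e tendsto_norm_zero LIM_zero g)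
    then show "((\<lambda>q. (norm (e q) + K) * norm (g q - a)) \<longlongrightarrow> 0) (at p)" by simp
  qed
  then show ?thesis by (simp add: has_derivative_within f(2) divide_inverse)
qed

lemma tendsto_inverse_family:
  fixes L M :: "'p::real_normed_vector \<Rightarrow> 'a::euclidean_space \<Rightarrow> 'a"
  assumes U: "open U" "p \<in> U" and cont: "\<And>w. continuous_on U (\<lambda>p. L p w)"
    and lin: "\<And>p. p \<in> U \<Longrightarrow> linear (L p)" "\<And>p. p \<in> U \<Longrightarrow> linear (M p)"
    and inv: "\<And>p v. p \<in> U \<Longrightarrow> M p (L p v) = v" "\<And>p v. p \<in> U \<Longrightarrow> L p (M p v) = v"
  shows "((\<lambda>q. M q w) \<longlongrightarrow> M p w) (at p)"
proof -
  obtain C where C: "C > 0" "\<forall>\<^sub>F q in at p. \<forall>v. norm (M q v) \<le> C * norm v"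
    using inverse_family_bounded[OF U cont lin inv] by blast
  have M: "M q w - M p w = - M q (L q (M p w) - L p (M p w))" if "q \<in> U" for q
    using that U by (simp add: inv linear_diff[OF lin(2)])
  have 1: "\<forall>\<^sub>F q in at p. norm (M q w - M p w) \<le> C * norm (L q (M p w) - L p (M p w))"
    using C(2) eventually_at_in_open'[OF U]
  proof eventually_elim
    case (elim q) then show ?case by (simp only: M norm_minus_cancel)
  qed
  have "((\<lambda>q. L q (M p w)) \<longlongrightarrow> L p (M p w)) (at p)"
    using cont U by (auto simp: continuous_on_eq_continuous_at isCont_def)
  from tendsto_mult_left[OF tendsto_norm[OF LIM_zero[OF this]], of C]
  have 2: "((\<lambda>q. C * norm (L q (M p w) - L p (M p w))) \<longlongrightarrow> 0) (at p)" by simp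
  show ?thesis by (rule LIM_zero_cancel[OF Lim_null_comparison[OF 1 2]])
qed

lemma has_derivative_inverse_family:
  fixes L M :: "'p::real_normed_vector \<Rightarrow> 'a::euclidean_space \<Rightarrow> 'a"
  assumes U: "open U" "p \<in> U"
    and L': "\<And>p w. p \<in> U \<Longrightarrow> ((\<lambda>p. L p w) has_derivative (\<lambda>h. L' p h w)) (at p)"
    and lin: "\<And>p. p \<in> U \<Longrightarrow> linear (L p)" "\<And>p. p \<in> U \<Longrightarrow> linear (M p)"
    and inv: "\<And>p v. p \<in> U \<Longrightarrow> M p (L p v) = v" "\<And>p v. p \<in> U \<Longrightarrow> L p (M p v) = v"
  shows "((\<lambda>q. M q v) has_derivative (\<lambda>h. - M p (L' p h (M p v)))) (at p)"
proof -
  have cont: "continuous_on U (\<lambda>p. L p w)" for w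
    using L' by (meson continuous_at_imp_continuous_on has_derivative_continuous)
  have M: "M q v - M p v = - M q (L q (M p v) - L p (M p v))" if "q \<in> U" for q v
    using that U by (simp add: inv linear_diff[OF lin(2)])
  note Mcont = tendsto_inverse_family[OF U cont lin inv]
  define l where "l q = L q (M p v) - L p (M p v)" for q
  have l: "(l has_derivative (\<lambda>h. L' p h (M p v))) (at p)"
    unfolding l_def using L'[OF U(2), of "M p v"] by (auto intro!: derivative_eq_intros)
  have "((\<lambda>q. M p v - M p (l q) - (\<Sum>b\<in>Basis. (l q \<bullet> b) *\<^sub>R (M q b - M p b)))
      has_derivative (\<lambda>h. 0 - M p (L' p h (M p v)) - (\<Sum>b\<in>(Basis::'a set). 0))) (at p)"
    by (intro has_derivative_diff has_derivative_sum has_derivative_const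
        bounded_linear.has_derivative[OF linear_conv_bounded_linear[THEN iffD1, OF lin(2)[OF U(2)]] l]
        has_derivative_scaleR_vanishing[OF bounded_linear.has_derivative[OF bounded_linear_inner_left l]]
        Mcont) (simp add: l_def)
  then have "((\<lambda>q. M p v - M p (l q) - (\<Sum>b\<in>Basis. (l q \<bullet> b) *\<^sub>R (M q b - M p b)))
      has_derivative (\<lambda>h. - M p (L' p h (M p v)))) (at p)" by simp
  then show ?thesis
  proof (rule has_derivative_transform_within_open[OF _ U])
    fix q assume q: "q \<in> U"
    have "M q (l q) - M p (l q) = (\<Sum>b\<in>Basis. (l q \<bullet> b) *\<^sub>R (M q b - M p b))"
      by (subst (1 2) linear_Basis_expansion[OF lin(2)])
        (use q U in \<open>auto simp: sum_subtractf scaleR_diff_right\<close>)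
    then show "M p v - M p (l q) - (\<Sum>b\<in>Basis. (l q \<bullet> b) *\<^sub>R (M q b - M p b)) = M q v"
      using M[OF q, of v] by (simp add: l_def algebra_simps)
  qed
qed

lemma Ck_on_inverse_family:
  fixes L M :: "'p::real_normed_vector \<Rightarrow> 'a::euclidean_space \<Rightarrow> 'a"
  assumes U: "open U" and L: "\<And>w. Ck_on k U (\<lambda>p. L p w)"
    and lin: "\<And>p. p \<in> U \<Longrightarrow> linear (L p)" "\<And>p. p \<in> U \<Longrightarrow> linear (M p)"
    and inv: "\<And>p v. p \<in> U \<Longrightarrow> M p (L p v) = v" "\<And>p v. p \<in> U \<Longrightarrow> L p (M p v) = v"
  shows "Ck_on k U (\<lambda>p. M p v)"
proof (cases k)
  case 0
  have cont: "continuous_on U (\<lambda>p. L p w)" for w using L[of w] unfolding 0 by simp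
  have "continuous_on U (\<lambda>p. M p v)"
    unfolding continuous_on_eq_continuous_at[OF U] isCont_def
    by (intro ballI tendsto_inverse_family[OF U _ cont lin inv])
  then show ?thesis unfolding 0 by simp
next
  case k: (Suc k')
  note L = L[unfolded k]
  define L' where "L' p h w = frechet_derivative (\<lambda>p. L p w) (at p) h" for p h w
  have dL: "((\<lambda>p. L p w) has_derivative (\<lambda>h. L' p h w)) (at p)" if "p \<in> U" for p w
    unfolding L'_def using Ck_on_Suc_has_derivative[OF L that] by simp
  note D = has_derivative_inverse_family[OF U _ dL lin inv]
  have linL': "linear (L' p h)" if "p \<in> U" for p h
  proof
    fix x y and c :: real
    have "((\<lambda>p. L p (x + y)) has_derivative (\<lambda>h. L' p h x + L' p h y)) (at p)"
      by (rule has_derivative_transform_within_open[OF has_derivative_add[OF dL dL] U])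
        (auto simp: that linear_add[OF lin(1)])
    from fun_cong[OF has_derivative_unique[OF this dL[OF that]]]
    show "L' p h (x + y) = L' p h x + L' p h y" by simp
    have "((\<lambda>p. L p (c *\<^sub>R x)) has_derivative (\<lambda>h. c *\<^sub>R L' p h x)) (at p)"
      by (rule has_derivative_transform_within_open[OF has_derivative_scaleR_right[OF dL] U])
        (auto simp: that linear_cmul[OF lin(1)])
    from fun_cong[OF has_derivative_unique[OF this dL[OF that]]]
    show "L' p h (c *\<^sub>R x) = c *\<^sub>R L' p h x" by simp
  qed
  have L'C: "Ck_on k' U (\<lambda>p. L' p h w)" for h w
    unfolding L'_def by (rule Ck_on_SucD[OF L])
  have step: "Ck_on (Suc j) U (\<lambda>p. M p v)"
    if M: "\<And>v. Ck_on j U (\<lambda>p. M p v)" and "j \<le> k'" for j v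
  proof (rule Ck_on_SucI[OF U D])
    fix h
    have L'j: "Ck_on j U (\<lambda>p. L' p h w)" for w
      by (rule Ck_on_mono[OF \<open>j \<le> k'\<close> L'C])
    have "Ck_on j U (\<lambda>p. L' p h (M p v))"
      by (rule Ck_on_apply_linear[where L = "\<lambda>p. L' p h" and w = "\<lambda>p. M p v"])
        (use U M linL' L'j in blast)+
    then have "Ck_on j U (\<lambda>p. M p (L' p h (M p v)))"
      by (intro Ck_on_apply_linear[where L = M and w = "\<lambda>p. L' p h (M p v)"])
        (use U M lin(2) in blast)+
    then show "Ck_on j U (\<lambda>p. - M p (L' p h (M p v)))"
      by (rule Ck_on_linear_compose[OF U bounded_linear_minus[OF bounded_linear_ident]])
  qed
  have "Ck_on (Suc j) U (\<lambda>p. M p v)" if "j \<le> k'" for j v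
    using that
  proof (induction j arbitrary: v)
    case 0
    have "Ck_on 0 U (\<lambda>p. M p v)" for v
      using has_derivative_continuous[OF D] by (simp add: continuous_at_imp_continuous_on)
    then show ?case by (rule step) simp
  next
    case (Suc j)
    show ?case by (rule step[OF Suc.IH]) (use Suc.prems in auto)
  qed
  from this[OF order_refl] show ?thesis by (simp only: k)
qed

text \<open>Infinitely differentiable maps on an open set; openness is part of the notion.\<close>

definition Cinf :: "'a::real_normed_vector set \<Rightarrow> ('a \<Rightarrow> 'b::real_normed_vector) \<Rightarrow> bool" where
  "Cinf U f \<longleftrightarrow> open U \<and> (\<forall>k. Ck_on k U f)"

lemma Cinf_open: "Cinf U f \<Longrightarrow> open U"
  by (simp add: Cinf_def)

lemma Cinf_continuous_on: "Cinf U f \<Longrightarrow> continuous_on U f"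
  unfolding Cinf_def by (auto dest!: spec[of _ 0])

lemma Cinf_has_derivative:
  "Cinf U f \<Longrightarrow> p \<in> U \<Longrightarrow> (f has_derivative frechet_derivative f (at p)) (at p)"
  using Ck_on_Suc_has_derivative[of 0] unfolding Cinf_def by blast

lemma Cinf_linear_derivative: "Cinf U f \<Longrightarrow> p \<in> U \<Longrightarrow> linear (frechet_derivative f (at p))"
  by (meson Cinf_has_derivative has_derivative_linear)

lemma Cinf_frechet_derivative: "Cinf U f \<Longrightarrow> Cinf U (\<lambda>p. frechet_derivative f (at p) v)"
  unfolding Cinf_def using Ck_on_SucD by blast

lemma Cinf_subset: "Cinf U f \<Longrightarrow> open V \<Longrightarrow> V \<subseteq> U \<Longrightarrow> Cinf V f"
  unfolding Cinf_def using Ck_on_subset by blast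

lemma Cinf_cong: "Cinf U f \<Longrightarrow> (\<And>p. p \<in> U \<Longrightarrow> f p = g p) \<Longrightarrow> Cinf U g"
  unfolding Cinf_def using Ck_on_cong[of U f g] by blast

lemma Cinf_const: "open U \<Longrightarrow> Cinf U (\<lambda>p. c)"
  by (simp add: Cinf_def Ck_on_const)

lemma Cinf_bounded_linear: "open U \<Longrightarrow> bounded_linear f \<Longrightarrow> Cinf U f"
  by (simp add: Cinf_def Ck_on_bounded_linear)

lemma Cinf_ident: "open U \<Longrightarrow> Cinf U (\<lambda>x. x)"
  by (simp add: Cinf_bounded_linear)

lemma Cinf_linear_compose: "bounded_linear h \<Longrightarrow> Cinf U f \<Longrightarrow> Cinf U (\<lambda>p. h (f p))"
  by (simp add: Cinf_def Ck_on_linear_compose)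

lemma Cinf_add: "Cinf U f \<Longrightarrow> Cinf U g \<Longrightarrow> Cinf U (\<lambda>p. f p + g p)"
  by (simp add: Cinf_def Ck_on_add)

lemma Cinf_diff: "Cinf U f \<Longrightarrow> Cinf U g \<Longrightarrow> Cinf U (\<lambda>p. f p - g p)"
  using Cinf_add[of U f "\<lambda>p. - g p"]
    Cinf_linear_compose[OF bounded_linear_minus[OF bounded_linear_ident], of U g] by simp

lemma Cinf_sum: "open U \<Longrightarrow> (\<And>i. i \<in> I \<Longrightarrow> Cinf U (f i)) \<Longrightarrow> Cinf U (\<lambda>p. \<Sum>i\<in>I. f i p)"
  by (simp add: Cinf_def Ck_on_sum)

lemma Cinf_bilinear:
  "bounded_bilinear h \<Longrightarrow> Cinf U f \<Longrightarrow> Cinf U g \<Longrightarrow> Cinf U (\<lambda>p. h (f p) (g p))"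
  by (simp add: Cinf_def bounded_bilinear.Ck_on)

lemma Cinf_compose:
  fixes f :: "'a::real_normed_vector \<Rightarrow> 'b::euclidean_space"
  shows "Cinf U f \<Longrightarrow> Cinf V g \<Longrightarrow> f ` U \<subseteq> V \<Longrightarrow> Cinf U (\<lambda>p. g (f p))"
  by (auto simp: Cinf_def intro: Ck_on_compose)

lemma Cinf_inverse_family:
  fixes L M :: "'p::real_normed_vector \<Rightarrow> 'a::euclidean_space \<Rightarrow> 'a"
  assumes "open U" "\<And>w. Cinf U (\<lambda>p. L p w)"
    and "\<And>p. p \<in> U \<Longrightarrow> linear (L p)" "\<And>p. p \<in> U \<Longrightarrow> linear (M p)"
    and "\<And>p v. p \<in> U \<Longrightarrow> M p (L p v) = v" "\<And>p v. p \<in> U \<Longrightarrow> L p (M p v) = v"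
  shows "Cinf U (\<lambda>p. M p v)"
proof -
  have "Ck_on k U (\<lambda>p. L p w)" for k w
    using assms(2) by (simp add: Cinf_def)
  from Ck_on_inverse_family[where L = L and M = M, OF assms(1) this assms(3-6)]
  show ?thesis by (simp add: Cinf_def assms(1))
qed

lemma Cinf_vec_lambda:
  fixes f :: "'i::finite \<Rightarrow> 'a::real_normed_vector \<Rightarrow> 'b::real_normed_vector"
  assumes U: "open U" and f: "\<And>i. Cinf U (f i)"
  shows "Cinf U (\<lambda>p. \<chi> i. f i p)"
proof -
  have axis: "bounded_linear (axis i :: 'b \<Rightarrow> 'b^'i)" for i
  proof (rule bounded_linear_intro[where K = 1])
    fix x :: 'b
    have "norm (axis i x) \<le> (\<Sum>j\<in>UNIV. norm (axis i x $ j))"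
      unfolding norm_vec_def by (rule L2_set_le_sum) simp
    also have "\<dots> = norm x" by (simp add: axis_def if_distrib[of norm] cong: if_cong)
    finally show "norm (axis i x) \<le> norm x * 1" by simp
  qed (simp_all add: vec_eq_iff axis_def)
  have "Cinf U (\<lambda>p. \<Sum>i\<in>UNIV. axis i (f i p))"
    by (rule Cinf_sum[OF U Cinf_linear_compose[OF axis f]])
  then show ?thesis
    by (rule Cinf_cong) (simp add: vec_eq_iff axis_def)
qed

lemma Cinf_powr: "Cinf {0<..} (\<lambda>s::real. c * s powr a)"
proof -
  have "Ck_on k {0<..} (\<lambda>s::real. c * s powr a)" for k
  proof (induction k arbitrary: c a)
    case 0
    then show ?case by (auto intro!: continuous_intros)
  next
    case (Suc k)
    show ?case
    proof (rule Ck_on_SucI)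
      fix s :: real assume "s \<in> {0<..}"
      then show "((\<lambda>s. c * s powr a) has_derivative (\<lambda>h. (c * a * s powr (a - 1)) * h)) (at s)"
        by (auto intro!: derivative_eq_intros simp: fun_eq_iff powr_diff field_simps)
    next
      fix v
      show "Ck_on k {0<..} (\<lambda>s. (c * a * s powr (a - 1)) * v)"
        using Suc.IH[of "v * c * a" "a - 1"] by (simp add: mult_ac)
    qed simp
  qed
  then show ?thesis by (simp add: Cinf_def)
qed

lemma Cinf_imp_smooth_on:
  assumes f: "Cinf U f" and S: "S \<subseteq> U" "\<And>p. p \<in> S \<Longrightarrow> g p = f p"
  shows "smooth_on S g"
  unfolding smooth_on_def
proof
  fix p assume "p \<in> S"
  then show "\<exists>U f. open U \<and> p \<in> U \<and> (\<forall>k. Ck_on k U f) \<and> (\<forall>q\<in>U \<inter> S. f q = g q)"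
    using f S(1) S(2)[symmetric] unfolding Cinf_def
    by (intro exI[of _ U] exI[of _ f] conjI ballI) (simp_all add: subset_iff)
qed

lemma smooth_on_obtain:
  assumes "smooth_on S f" "p \<in> S"
  obtains U g where "p \<in> U" "Cinf U g" "\<And>q. q \<in> U \<Longrightarrow> q \<in> S \<Longrightarrow> g q = f q"
proof -
  obtain U g where "open U \<and> p \<in> U \<and> (\<forall>k. Ck_on k U g) \<and> (\<forall>q\<in>U \<inter> S. g q = f q)"
    using assms unfolding smooth_on_def by fast
  then show ?thesis by (intro that[of U g]) (auto simp: Cinf_def)
qed

lemma smooth_on_imp_Cinf:
  assumes S: "open S" and f: "smooth_on S f"
  shows "Cinf S f"
proof -
  have "\<exists>U. open U \<and> p \<in> U \<and> Ck_on k U f" if p: "p \<in> S" for p k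
  proof -
    obtain U g where U: "p \<in> U" "Cinf U g" "\<And>q. q \<in> U \<Longrightarrow> q \<in> S \<Longrightarrow> g q = f q"
      using smooth_on_obtain[OF f p] by blast
    have "open (U \<inter> S)" using S Cinf_open[OF U(2)] by blast
    then have "Cinf (U \<inter> S) f"
      by (rule Cinf_cong[OF Cinf_subset[OF U(2)]]) (auto intro: U(3))
    then show ?thesis
      using U(1) p unfolding Cinf_def by (intro exI[of _ "U \<inter> S"]) simp
  qed
  then have "Ck_on k S f" for k by (rule Ck_on_local)
  then show ?thesis using S by (simp add: Cinf_def)
qed

text \<open>The regularity of the local inverse \<open>g\<close> is bootstrapped: its derivative is the inverse of the
  derivative of \<open>f\<close> at \<open>g y\<close>, hence as regular as \<open>g\<close> itself.\<close>

theorem smooth_inverse_function_theorem: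
  fixes f :: "'a::euclidean_space \<Rightarrow> 'a"
  assumes f: "Cinf U f" "p \<in> U"
    and D: "(f has_derivative D) (at p)" and inj: "\<And>v. D v = 0 \<Longrightarrow> v = 0"
  obtains U' V g where "open U'" "U' \<subseteq> U" "p \<in> U'" "Cinf V g" "f ` U' = V" "g ` V = U'"
    "\<And>x. x \<in> U' \<Longrightarrow> g (f x) = x" "\<And>y. y \<in> V \<Longrightarrow> f (g y) = y"
proof -
  define f' where "f' x = Blinfun (frechet_derivative f (at x))" for x
  have f': "blinfun_apply (f' x) = frechet_derivative f (at x)" if "x \<in> U" for x
    unfolding f'_def
    by (rule bounded_linear_Blinfun_apply[OF has_derivative_bounded_linear[OF
            Cinf_has_derivative[OF f(1) that]]])
  have D': "blinfun_apply (f' p) = D" by (simp add: f' f frechet_derivativeI[OF D])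
  have linD: "linear D" using D has_derivative_linear by blast
  then have "inj D" using inj by (simp add: linear_injective_0)
  then obtain E where E: "linear E" "\<And>v. E (D v) = v" "\<And>v. D (E v) = v"
    using linear_injective_isomorphism[OF linD] by blast
  obtain U' V g g' where *: "open U'" "U' \<subseteq> U" "p \<in> U'" "open V" "f p \<in> V" "homeomorphism U' V f g"
    "\<And>y. y \<in> V \<Longrightarrow> (g has_derivative (g' y)) (at y)"
    "\<And>y. y \<in> V \<Longrightarrow> g' y = inv (blinfun_apply (f'(g y)))"
    "\<And>y. y \<in> V \<Longrightarrow> bij (blinfun_apply (f'(g y)))"
  proof (rule inverse_function_theorem[of U f f' p "Blinfun E"])
    show "open U" using f Cinf_open by blast
    show "(f has_derivative blinfun_apply (f' x)) (at x)" if "x \<in> U" for x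
      using Cinf_has_derivative[OF f(1) that] by (simp add: f' that)
    show "continuous_on U f'"
    proof (rule continuous_on_blinfun_componentwise)
      fix i :: 'a
      show "continuous_on U (\<lambda>x. blinfun_apply (f' x) i)"
        using Cinf_continuous_on[OF Cinf_frechet_derivative[OF f(1), of i]]
        by (rule continuous_on_eq) (simp add: f')
    qed
    show "Blinfun E o\<^sub>L f' p = id_blinfun"
      by (rule blinfun_eqI) (simp add: bounded_linear_Blinfun_apply E D'
          linear_conv_bounded_linear[THEN iffD1])
  qed (use f in auto)
  have gV: "g y \<in> U'" if "y \<in> V" for y using that *(6) by (auto simp: homeomorphism_def)
  have gU: "g y \<in> U" if "y \<in> V" for y using gV[OF that] *(2) by blast
  have "Ck_on k V g" for k
  proof (induction k)
    case 0
    then show ?case using *(6) by (simp add: homeomorphism_def)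
  next
    case (Suc k)
    show ?case
    proof (rule Ck_on_SucI[OF *(4,7)])
      fix v
      show "Ck_on k V (\<lambda>y. g' y v)"
      proof (rule Ck_on_inverse_family[where L = "\<lambda>y. frechet_derivative f (at (g y))", OF *(4)])
        have "Ck_on k U (\<lambda>p. frechet_derivative f (at p) w)" for w
          using Cinf_frechet_derivative[OF f(1)] by (simp add: Cinf_def)
        then show "Ck_on k V (\<lambda>y. frechet_derivative f (at (g y)) w)" for w
          using gU by (intro Ck_on_compose[OF *(4) Suc.IH]) auto
        fix y assume y: "y \<in> V"
        show "linear (frechet_derivative f (at (g y)))"
          by (rule Cinf_linear_derivative[OF f(1) gU[OF y]])
        show "linear (g' y)" using *(7)[OF y] has_derivative_linear by blast
        have b: "bij (frechet_derivative f (at (g y)))" "g' y = inv (frechet_derivative f (at (g y)))"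
          using *(8,9)[OF y] by (simp_all add: f' gU[OF y])
        show "g' y (frechet_derivative f (at (g y)) v) = v" for v
          unfolding b(2) using b(1) by (simp add: bij_is_inj inv_f_f)
        show "frechet_derivative f (at (g y)) (g' y v) = v" for v
          unfolding b(2) using b(1) by (simp add: bij_is_surj surj_f_inv_f)
      qed
    qed
  qed
  then have "Cinf V g" using *(4) by (simp add: Cinf_def)
  with * show ?thesis by (intro that[of U' V g]) (auto simp: homeomorphism_def)
qed

lemma diffeomorphismI:
  assumes "Cinf U' f" "S \<subseteq> U'" "f ` S \<subseteq> T" "Cinf V' g" "T \<subseteq> V'" "g ` T \<subseteq> S"
    and "\<And>p. p \<in> S \<Longrightarrow> g (f p) = p" "\<And>q. q \<in> T \<Longrightarrow> f (g q) = q"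
  shows "diffeomorphism S T f g"
proof -
  have "T \<subseteq> f ` S" "S \<subseteq> g ` T"
    using assms(3,6) assms(7,8)[symmetric] by blast+
  then show ?thesis
    unfolding diffeomorphism_def
    using Cinf_imp_smooth_on[OF assms(1,2) refl] Cinf_imp_smooth_on[OF assms(4,5) refl] assms(3,6-8)
    by (simp add: subset_antisym)
qed

text \<open>A set that is the image of a (linear piece of a) smooth parametrization \<open>\<psi>\<close> with a smooth left
  inverse \<open>r\<close> defined in the ambient space is flattened by
  \<open>x \<mapsto> x - \<psi> (r x) + D\<psi> (r x - r p)\<close>, whose derivative at \<open>p\<close> is the identity.\<close>

lemma slice_chart_of_parametrization:
  fixes S :: "'a::euclidean_space set" and r :: "'a \<Rightarrow> 'b::euclidean_space"
  assumes r: "Cinf U0 r" and \<psi>: "Cinf V0 \<psi>" and T: "subspace T" and p: "p \<in> S" "p \<in> U0"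
    and S: "\<And>x. x \<in> S \<Longrightarrow> x \<in> U0 \<Longrightarrow> r x \<in> V0 \<and> r x \<in> T \<and> \<psi> (r x) = x"
    and \<psi>S: "\<And>y. y \<in> V0 \<Longrightarrow> y \<in> T \<Longrightarrow> \<psi> y \<in> S"
    and r\<psi>: "\<And>y. y \<in> V0 \<Longrightarrow> r (\<psi> y) = y"
  shows "\<exists>L U V f g. slice_chart S p L U V f g \<and> dim L = dim T"
proof -
  define y0 where "y0 = r p"
  have y0: "y0 \<in> V0" "y0 \<in> T" "\<psi> y0 = p" unfolding y0_def using S[OF p] by blast+
  define D where "D = frechet_derivative \<psi> (at y0)"
  define D' where "D' = frechet_derivative r (at p)"
  have D: "(\<psi> has_derivative D) (at y0)" unfolding D_def by (rule Cinf_has_derivative[OF \<psi> y0(1)])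
  have D': "(r has_derivative D') (at p)" unfolding D'_def by (rule Cinf_has_derivative[OF r p(2)])
  have lin: "linear D" "linear D'" using D D' has_derivative_linear by blast+
  have "((\<lambda>y. r (\<psi> y)) has_derivative (\<lambda>v. D' (D v))) (at y0)"
    by (rule has_derivative_compose[OF D]) (use D' in \<open>simp add: y0\<close>)
  moreover have "((\<lambda>y. r (\<psi> y)) has_derivative (\<lambda>v. v)) (at y0)"
    by (rule has_derivative_transform_within_open[OF has_derivative_ident Cinf_open[OF \<psi>] y0(1)])
      (simp add: r\<psi>)
  ultimately have D'D: "D' (D v) = v" for v by (rule fun_cong[OF has_derivative_unique])
  \<comment> \<open>On the image of \<open>\<psi>\<close> the first two terms cancel, so that \<open>f\<close> maps it into the range of \<open>D\<close>.\<close>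
  define f where "f x = x - \<psi> (r x) + D (r x - y0)" for x
  define U1 where "U1 = U0 \<inter> r -` V0"
  have U1: "open U1" unfolding U1_def
    by (rule continuous_open_preimage[OF Cinf_continuous_on[OF r] Cinf_open[OF r] Cinf_open[OF \<psi>]])
  have rU1: "Cinf U1 r" by (rule Cinf_subset[OF r U1]) (auto simp: U1_def)
  have blD: "bounded_linear D" using lin(1) by (simp add: linear_conv_bounded_linear)
  have "Cinf U1 (\<lambda>x. \<psi> (r x))"
    by (rule Cinf_compose[OF rU1 \<psi>]) (auto simp: U1_def)
  moreover have "Cinf U1 (\<lambda>x. D (r x - y0))"
    by (rule Cinf_linear_compose[OF blD Cinf_diff[OF rU1 Cinf_const[OF U1]]])
  ultimately have f: "Cinf U1 f"
    unfolding f_def using Cinf_ident[OF U1] Cinf_add Cinf_diff by blast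
  have pU1: "p \<in> U1" using p y0(1) by (simp add: U1_def y0_def)
  have "((\<lambda>x. \<psi> (r x)) has_derivative (\<lambda>v. D (D' v))) (at p)"
    by (rule has_derivative_compose[OF D']) (use D in \<open>simp add: y0_def\<close>)
  from has_derivative_add[OF has_derivative_diff[OF has_derivative_ident this]
      bounded_linear.has_derivative[OF blD has_derivative_diff[OF D' has_derivative_const]]]
  have "(f has_derivative (\<lambda>v. v - D (D' v) + D (D' v - 0))) (at p)"
    unfolding f_def .
  then have "(f has_derivative (\<lambda>v. v)) (at p)" by simp
  from smooth_inverse_function_theorem[OF f pU1 this]
  obtain U' V' g where g: "open U'" "U' \<subseteq> U1" "p \<in> U'" "Cinf V' g" "f ` U' = V'" "g ` V' = U'"
    "\<And>x. x \<in> U' \<Longrightarrow> g (f x) = x" "\<And>y. y \<in> V' \<Longrightarrow> f (g y) = y"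
    by blast
  define V2 where "V2 = V0 \<inter> \<psi> -` U'"
  have V2: "open V2" unfolding V2_def
    by (rule continuous_open_preimage[OF Cinf_continuous_on[OF \<psi>] Cinf_open[OF \<psi>] g(1)])
  define V where "V = V' \<inter> (\<lambda>v. y0 + D' v) -` V2"
  have "continuous_on V' (\<lambda>v. y0 + D' v)"
    by (intro continuous_intros linear_continuous_on linear_conv_bounded_linear[THEN iffD1, OF lin(2)])
  then have V: "open V" unfolding V_def
    by (rule continuous_open_preimage[OF _ Cinf_open[OF g(4)] V2])
  define U where "U = U' \<inter> f -` V"
  have "continuous_on U' f" using Cinf_continuous_on[OF f] g(2) continuous_on_subset by blast
  then have U: "open U" unfolding U_def by (rule continuous_open_preimage[OF _ g(1) V])
  have f0: "f p = 0"
    unfolding f_def y0_def[symmetric] by (simp add: y0(3) linear_0[OF lin(1)])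
  have pU: "p \<in> U"
  proof -
    have "f p \<in> V'" using g(3,5) by blast
    then show ?thesis
      using g(3) y0(1,3) by (simp add: U_def V_def V2_def f0 linear_0[OF lin(2)])
  qed
  have diffeo: "diffeomorphism U V f g"
  proof (rule diffeomorphismI[OF f _ _ g(4)])
    show "U \<subseteq> U1" "f ` U \<subseteq> V" "V \<subseteq> V'" using g(2) by (auto simp: U_def V_def)
    show "g ` V \<subseteq> U"
    proof clarify
      fix v assume v: "v \<in> V"
      then have "v \<in> V'" by (simp add: V_def)
      then show "g v \<in> U" using v g(6) by (auto simp: U_def g(8))
    qed
    show "g (f x) = x" if "x \<in> U" for x using that by (intro g(7)) (simp add: U_def)
    show "f (g v) = v" if "v \<in> V" for v using that by (intro g(8)) (simp add: V_def)
  qed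
  define L where "L = D ` T"
  have L: "subspace L" unfolding L_def by (rule linear_subspace_image[OF lin(1) T])
  have "f ` (U \<inter> S) = V \<inter> L"
  proof
    show "f ` (U \<inter> S) \<subseteq> V \<inter> L"
    proof clarify
      fix x assume x: "x \<in> U" "x \<in> S"
      then have "x \<in> U0" using g(2) by (auto simp: U_def U1_def)
      from S[OF x(2) this] have "r x \<in> T" "\<psi> (r x) = x" by blast+
      then have "f x = D (r x - y0)" "r x - y0 \<in> T"
        using subspace_diff[OF T _ y0(2)] by (simp_all add: f_def)
      then have "f x \<in> L" unfolding L_def by blast
      then show "f x \<in> V \<inter> L" using x(1) by (simp add: U_def)
    qed
    show "V \<inter> L \<subseteq> f ` (U \<inter> S)"
    proof clarify
      fix v assume v: "v \<in> V" "v \<in> L"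
      then obtain w where w: "w \<in> T" "v = D w" by (auto simp: L_def)
      define y where "y = y0 + w"
      have y: "y \<in> V2" "y \<in> T"
        using v(1) subspace_add[OF T y0(2) w(1)] by (simp_all add: V_def y_def w(2) D'D)
      have y': "y \<in> V0" "\<psi> y \<in> U'" using y(1) by (simp_all add: V2_def)
      have "f (\<psi> y) = v" unfolding f_def r\<psi>[OF y'(1)] by (simp add: y_def w(2))
      moreover have "\<psi> y \<in> U" "\<psi> y \<in> S"
        using y' v(1) \<psi>S[OF y'(1) y(2)] \<open>f (\<psi> y) = v\<close> by (simp_all add: U_def)
      ultimately show "v \<in> f ` (U \<inter> S)" by blast
    qed
  qed
  moreover have "dim L = dim T"
    unfolding L_def by (rule dim_image_eq[OF lin(1) inj_on_inverseI[where g = D']]) (rule D'D)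
  ultimately show ?thesis
    using L U pU V diffeo unfolding slice_chart_def
    by (intro exI[of _ L] exI[of _ U] exI[of _ V] exI[of _ f] exI[of _ g]) simp
qed

section \<open>Endomorphisms and the mass inner product\<close>

lemma bounded_bilinear_matrix_mult:
  "bounded_bilinear (\<lambda>(A :: real^'n::finite^'m::finite) (B :: real^'p::finite^'n). A ** B)"
  by (rule bilinear_conv_bounded_bilinear[THEN iffD1])
    (auto simp: bilinear_def matrix_matrix_mult_def vec_eq_iff sum.distrib algebra_simps
      sum_distrib_left intro!: linearI)

lemma bounded_bilinear_matrix_vector_mult:
  "bounded_bilinear (\<lambda>(A :: real^'n::finite^'m::finite) (x :: real^'n). A *v x)"
  by (rule bilinear_conv_bounded_bilinear[THEN iffD1])
    (auto simp: bilinear_def matrix_vector_mult_def vec_eq_iff sum.distrib algebra_simps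
      sum_distrib_left intro!: linearI)

lemmas mm_simps =
  bounded_bilinear.add_left[OF bounded_bilinear_matrix_mult]
  bounded_bilinear.add_right[OF bounded_bilinear_matrix_mult]
  bounded_bilinear.diff_left[OF bounded_bilinear_matrix_mult]
  bounded_bilinear.diff_right[OF bounded_bilinear_matrix_mult]
  bounded_bilinear.minus_left[OF bounded_bilinear_matrix_mult]
  bounded_bilinear.minus_right[OF bounded_bilinear_matrix_mult]
  bounded_bilinear.zero_left[OF bounded_bilinear_matrix_mult]
  bounded_bilinear.zero_right[OF bounded_bilinear_matrix_mult]
  bounded_bilinear.scaleR_left[OF bounded_bilinear_matrix_mult]
  bounded_bilinear.scaleR_right[OF bounded_bilinear_matrix_mult]
  bounded_bilinear.sum_left[OF bounded_bilinear_matrix_mult]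
  bounded_bilinear.sum_right[OF bounded_bilinear_matrix_mult]

lemmas mv_simps =
  bounded_bilinear.add_left[OF bounded_bilinear_matrix_vector_mult]
  bounded_bilinear.add_right[OF bounded_bilinear_matrix_vector_mult]
  bounded_bilinear.diff_left[OF bounded_bilinear_matrix_vector_mult]
  bounded_bilinear.diff_right[OF bounded_bilinear_matrix_vector_mult]
  bounded_bilinear.minus_left[OF bounded_bilinear_matrix_vector_mult]
  bounded_bilinear.minus_right[OF bounded_bilinear_matrix_vector_mult]
  bounded_bilinear.zero_left[OF bounded_bilinear_matrix_vector_mult]
  bounded_bilinear.zero_right[OF bounded_bilinear_matrix_vector_mult]
  bounded_bilinear.scaleR_left[OF bounded_bilinear_matrix_vector_mult]
  bounded_bilinear.scaleR_right[OF bounded_bilinear_matrix_vector_mult]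
  bounded_bilinear.sum_left[OF bounded_bilinear_matrix_vector_mult]
  bounded_bilinear.sum_right[OF bounded_bilinear_matrix_vector_mult]

lemma mv_assoc: "(A ** B) *v x = A *v (B *v x)" for A :: "real^'n::finite^'m::finite"
  by (simp add: matrix_vector_mul_assoc)

lemma bounded_bilinear_mdot: "bounded_bilinear (mdot m)" for m :: "'n::finite disp"
  by (rule bilinear_conv_bounded_bilinear[THEN iffD1])
    (auto simp: bilinear_def mdot_def algebra_simps add_divide_distrib sum.distrib sum_distrib_left
      sum_divide_distrib intro!: linearI)

lemmas mdot_simps =
  bounded_bilinear.add_left[OF bounded_bilinear_mdot]
  bounded_bilinear.add_right[OF bounded_bilinear_mdot]
  bounded_bilinear.diff_left[OF bounded_bilinear_mdot]
  bounded_bilinear.diff_right[OF bounded_bilinear_mdot]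
  bounded_bilinear.minus_left[OF bounded_bilinear_mdot]
  bounded_bilinear.minus_right[OF bounded_bilinear_mdot]
  bounded_bilinear.zero_left[OF bounded_bilinear_mdot]
  bounded_bilinear.zero_right[OF bounded_bilinear_mdot]
  bounded_bilinear.scaleR_left[OF bounded_bilinear_mdot]
  bounded_bilinear.scaleR_right[OF bounded_bilinear_mdot]
  bounded_bilinear.sum_left[OF bounded_bilinear_mdot]
  bounded_bilinear.sum_right[OF bounded_bilinear_mdot]

lemma mdot_commute: "mdot m \<xi> \<eta> = mdot m \<eta> \<xi>"
  by (simp add: mdot_def mult.commute)

text \<open>The map \<open>\<xi> \<mapsto> \<langle>\<xi>, u\<rangle> u\<close>, which is the orthogonal projection onto the line of \<open>u\<close> when \<open>u\<close> is a unit
  vector.\<close>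

definition proj :: "'n::finite disp \<Rightarrow> 'n disp \<Rightarrow> 'n endo" where
  "proj m u = (\<chi> k l. u $ k * u $ l / m $ l)"

lemma proj_mult_vec: "proj m u *v \<xi> = mdot m \<xi> u *\<^sub>R u"
  by (simp add: vec_eq_iff proj_def matrix_vector_mult_def mdot_def sum_distrib_left
      sum_distrib_right mult_ac)

lemma subspace_Dstar: "subspace Dstar"
  by (auto simp: subspace_def Dstar_def sum.distrib simp flip: sum_distrib_left)

text \<open>All endomorphisms are matrices acting on the whole of \<open>\<real>\<^sup>n\<close>, with \<open>mdot m\<close> as inner product there;
  \<open>Dstar\<close> is the hyperplane orthogonal to \<open>m\<close>.\<close>

locale masses =
  fixes m :: "'n::finite disp"
  assumes m_pos: "\<And>i. 0 < m $ i"
begin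

lemma m_nonzero [simp]: "m $ i \<noteq> 0"
  using m_pos[of i] by simp

lemma mdot_m: "mdot m \<xi> m = (\<Sum>i\<in>UNIV. \<xi> $ i)"
  by (simp add: mdot_def)

lemma Dstar_iff: "\<xi> \<in> Dstar \<longleftrightarrow> mdot m \<xi> m = 0"
  by (simp add: mdot_m Dstar_def)

lemma mdot_nonneg: "0 \<le> mdot m \<xi> \<xi>"
  unfolding mdot_def by (intro sum_nonneg) (simp add: m_pos less_imp_le)

lemma mdot_eq_0: "mdot m \<xi> \<xi> = 0 \<Longrightarrow> \<xi> = 0"
  unfolding mdot_def
  by (subst (asm) sum_nonneg_eq_0_iff) (auto simp: m_pos less_imp_le vec_eq_iff)

lemma vec_eqI_mdot:
  assumes "\<And>\<eta>. mdot m \<xi> \<eta> = mdot m \<zeta> \<eta>" shows "\<xi> = \<zeta>"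
  using mdot_eq_0[of "\<xi> - \<zeta>"] assms by (simp add: mdot_simps)

lemma endo_eqI_mdot:
  assumes "\<And>\<xi> \<eta>. mdot m (A *v \<xi>) \<eta> = mdot m (B *v \<xi>) \<eta>" shows "A = B"
  unfolding matrix_eq using vec_eqI_mdot assms by blast

lemma mdot_axis: "mdot m \<xi> (axis k 1) = \<xi> $ k / m $ k"
  by (simp add: mdot_def axis_def if_distrib[of "\<lambda>x. _ * x"] if_distrib[of "\<lambda>x. x / _"] cong: if_cong)

lemma decompose_Dstar: "\<exists>t. \<xi> - t *\<^sub>R m \<in> Dstar"
proof
  have "mdot m m m > 0" unfolding mdot_m by (intro sum_pos m_pos) auto
  then show "\<xi> - (mdot m \<xi> m / mdot m m m) *\<^sub>R m \<in> Dstar"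
    by (simp add: Dstar_iff mdot_simps)
qed

text \<open>Symmetric endomorphisms for the mass inner product on all of \<open>\<real>\<^sup>n\<close>.\<close>

definition selfadjoint :: "'n endo \<Rightarrow> bool" where
  "selfadjoint A \<longleftrightarrow> (\<forall>\<xi> \<eta>. mdot m (A *v \<xi>) \<eta> = mdot m \<xi> (A *v \<eta>))"

text \<open>Antisymmetric endomorphisms for the mass inner product on all of \<open>\<real>\<^sup>n\<close>.\<close>

definition skew :: "'n endo \<Rightarrow> bool" where
  "skew A \<longleftrightarrow> (\<forall>\<xi> \<eta>. mdot m (A *v \<xi>) \<eta> = - mdot m \<xi> (A *v \<eta>))"

lemma sym_endo_iff: "B \<in> sym_endo m \<longleftrightarrow> selfadjoint B \<and> B *v m = 0"
proof
  assume B: "B \<in> sym_endo m"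
  have "mdot m (B *v \<xi>) \<eta> = mdot m \<xi> (B *v \<eta>)" for \<xi> \<eta>
  proof -
    obtain s t where st: "\<xi> - s *\<^sub>R m \<in> Dstar" "\<eta> - t *\<^sub>R m \<in> Dstar"
      using decompose_Dstar by metis
    have Bm: "mdot m (B *v \<zeta>) m = 0" "B *v m = 0" for \<zeta>
      using B by (auto simp: sym_endo_def Dstar_iff)
    have "mdot m (B *v (\<xi> - s *\<^sub>R m)) (\<eta> - t *\<^sub>R m) = mdot m (\<xi> - s *\<^sub>R m) (B *v (\<eta> - t *\<^sub>R m))"
      using B st by (simp add: sym_endo_def)
    then show ?thesis
      using Bm mdot_commute[of m m] by (simp add: mv_simps mdot_simps)
  qed
  then show "selfadjoint B \<and> B *v m = 0"
    using B by (auto simp: selfadjoint_def sym_endo_def)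
next
  assume B: "selfadjoint B \<and> B *v m = 0"
  then have "mdot m (B *v \<xi>) m = 0" for \<xi>
    by (simp add: selfadjoint_def mdot_simps)
  then show "B \<in> sym_endo m"
    using B by (simp add: sym_endo_def selfadjoint_def Dstar_iff)
qed

lemma subspace_sym_endo: "subspace (sym_endo m)"
  by (rule subspaceI) (auto simp: sym_endo_iff selfadjoint_def mv_simps mdot_simps)

lemma sym_endo_Dstar: "B \<in> sym_endo m \<Longrightarrow> B *v \<xi> \<in> Dstar"
  by (simp add: sym_endo_def)

text \<open>The Cayley transform turns skew endomorphisms into isometries.\<close>

definition cayley :: "'n endo \<Rightarrow> 'n endo" where
  "cayley Y = (mat 1 + Y) ** matrix_inv (mat 1 - Y)"

lemma invertible_1_minus_skew:
  assumes "skew Y" shows "invertible (mat 1 - Y)"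
proof -
  have "v = 0" if "(mat 1 - Y) *v v = 0" for v
  proof (rule mdot_eq_0)
    have Yv: "Y *v v = v" using that by (simp add: mv_simps)
    have "mdot m (Y *v v) v = - mdot m v (Y *v v)" using assms by (simp add: skew_def)
    then show "mdot m v v = 0" by (simp add: Yv)
  qed
  then obtain C where "C ** (mat 1 - Y) = mat 1"
    using matrix_left_invertible_ker[of "mat 1 - Y"] by blast
  then show ?thesis by (metis invertible_def matrix_left_right_inverse)
qed

lemma skew_minus: "skew Y \<Longrightarrow> skew (- Y)"
  by (simp add: skew_def mv_simps mdot_simps)

lemma matrix_inv_1_minus_skew:
  assumes "skew Y"
  shows "(mat 1 - Y) ** matrix_inv (mat 1 - Y) = mat 1" "matrix_inv (mat 1 - Y) ** (mat 1 - Y) = mat 1"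
  using someI_ex[OF invertible_1_minus_skew[OF assms, unfolded invertible_def]]
  unfolding matrix_inv_def by blast+

lemma cayley_mult: "skew Y \<Longrightarrow> cayley Y ** (mat 1 - Y) = mat 1 + Y"
  by (simp add: cayley_def matrix_mul_assoc[symmetric] matrix_inv_1_minus_skew)

lemma cayley_minus_cayley:
  assumes "skew Y" shows "cayley (- Y) ** cayley Y = mat 1"
proof -
  have "cayley (- Y) ** (mat 1 + Y) = mat 1 - Y"
    using cayley_mult[OF skew_minus[OF assms]] by simp
  then have "cayley (- Y) ** (mat 1 + Y) ** matrix_inv (mat 1 - Y) = mat 1"
    by (simp add: matrix_inv_1_minus_skew assms)
  then show ?thesis by (simp add: cayley_def[of Y] matrix_mul_assoc)
qed

lemma cayley_cayley_minus:
  assumes "skew Y" shows "cayley Y ** cayley (- Y) = mat 1"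
  using cayley_minus_cayley[OF skew_minus[OF assms]] by simp

lemma cayley_isometry:
  assumes "skew Y" shows "mdot m (cayley Y *v \<xi>) (cayley Y *v \<eta>) = mdot m \<xi> \<eta>"
proof -
  define a where "a = matrix_inv (mat 1 - Y) *v \<xi>"
  define b where "b = matrix_inv (mat 1 - Y) *v \<eta>"
  have "(mat 1 - Y) *v a = \<xi>" "(mat 1 - Y) *v b = \<eta>"
    by (simp_all add: a_def b_def matrix_vector_mul_assoc matrix_inv_1_minus_skew assms)
  then have ab: "\<xi> = a - Y *v a" "\<eta> = b - Y *v b" by (simp_all add: mv_simps)
  have "cayley Y *v \<xi> = a + Y *v a" "cayley Y *v \<eta> = b + Y *v b"
    by (simp_all add: cayley_def mv_assoc mv_simps flip: a_def b_def)
  then show ?thesis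
    using assms by (simp add: ab mdot_simps skew_def)
qed

lemma cayley_fixes:
  assumes "skew Y" "Y *v \<xi> = 0" shows "cayley Y *v \<xi> = \<xi>"
proof -
  have "cayley Y *v ((mat 1 - Y) *v \<xi>) = (mat 1 + Y) *v \<xi>"
    by (simp add: matrix_vector_mul_assoc cayley_mult assms)
  then show ?thesis by (simp add: mv_simps assms)
qed

lemma cayley_0: "cayley 0 = mat 1"
  using cayley_mult[of 0] by (simp add: skew_def mv_simps mdot_simps)

lemma cayley_adjoint:
  assumes "skew Y" shows "mdot m (cayley Y *v \<xi>) \<eta> = mdot m \<xi> (cayley (- Y) *v \<eta>)"
proof -
  have "\<eta> = cayley Y *v (cayley (- Y) *v \<eta>)"
    by (simp add: matrix_vector_mul_assoc cayley_cayley_minus assms)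
  then show ?thesis by (metis cayley_isometry[OF assms])
qed

lemma Cinf_cayley:
  fixes Y :: "'p::real_normed_vector \<Rightarrow> 'n endo"
  assumes Y: "bounded_linear Y" "\<And>p. skew (Y p)"
  shows "Cinf UNIV (\<lambda>p. cayley (Y p))"
proof -
  have YC: "Cinf UNIV Y" by (rule Cinf_bounded_linear[OF open_UNIV Y(1)])
  have C1: "Cinf UNIV (\<lambda>p. mat 1 - Y p)" by (rule Cinf_diff[OF Cinf_const[OF open_UNIV] YC])
  have inv: "Cinf UNIV (\<lambda>p. matrix_inv (mat 1 - Y p) *v v)" for v
  proof (rule Cinf_inverse_family[where L = "\<lambda>p w. (mat 1 - Y p) *v w"])
    show "Cinf UNIV (\<lambda>p. (mat 1 - Y p) *v w)" for w
      by (rule Cinf_bilinear[OF bounded_bilinear_matrix_vector_mult C1 Cinf_const[OF open_UNIV]])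
  qed (simp_all add: matrix_vector_mul_assoc matrix_inv_1_minus_skew Y(2))
  have "Cinf UNIV (\<lambda>p. \<chi> k l. (matrix_inv (mat 1 - Y p) *v axis l 1) $ k)"
    by (rule Cinf_vec_lambda[OF open_UNIV Cinf_vec_lambda[OF open_UNIV
            Cinf_linear_compose[OF bounded_linear_vec_nth inv]]])
  then have "Cinf UNIV (\<lambda>p. matrix_inv (mat 1 - Y p))"
    by (rule Cinf_cong) (simp add: vec_eq_iff matrix_vector_mul_component inner_axis)
  from Cinf_bilinear[OF bounded_bilinear_matrix_mult Cinf_add[OF Cinf_const[OF open_UNIV] YC] this]
  show ?thesis unfolding cayley_def .
qed

text \<open>Differentiate \<open>cayley Y (1 - Y) = 1 + Y\<close> at \<open>Y = 0\<close>.\<close>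

lemma cayley_has_derivative:
  fixes Y :: "'p::real_normed_vector \<Rightarrow> 'n endo"
  assumes Y: "bounded_linear Y" "\<And>p. skew (Y p)"
  shows "((\<lambda>p. cayley (Y p)) has_derivative (\<lambda>h. 2 *\<^sub>R Y h)) (at 0)"
proof -
  define C' where "C' = frechet_derivative (\<lambda>p. cayley (Y p)) (at 0)"
  have Y0: "Y 0 = 0" using Y(1) by (simp add: bounded_linear.linear linear_0)
  have C': "((\<lambda>p. cayley (Y p)) has_derivative C') (at 0)"
    unfolding C'_def by (rule Cinf_has_derivative[OF Cinf_cayley[OF Y]]) simp
  note Y' = bounded_linear_imp_has_derivative[OF Y(1), of "at 0"]
  have "((\<lambda>p. cayley (Y p) ** (mat 1 - Y p)) has_derivative
      (\<lambda>h. cayley (Y 0) ** (0 - Y h) + C' h ** (mat 1 - Y 0))) (at 0)"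
    by (rule bounded_bilinear.FDERIV[OF bounded_bilinear_matrix_mult C'
          has_derivative_diff[OF has_derivative_const Y']])
  then have "((\<lambda>p. mat 1 + Y p) has_derivative (\<lambda>h. C' h - Y h)) (at 0)"
    unfolding cayley_mult[OF Y(2)] by (simp add: Y0 cayley_0 mm_simps)
  moreover have "((\<lambda>p. mat 1 + Y p) has_derivative (\<lambda>h. 0 + Y h)) (at 0)"
    by (rule has_derivative_add[OF has_derivative_const Y'])
  ultimately have "C' h - Y h = 0 + Y h" for h
    by (rule fun_cong[OF has_derivative_unique])
  then have "C' = (\<lambda>h. 2 *\<^sub>R Y h)" by (auto simp: fun_eq_iff scaleR_2 diff_eq_eq)
  then show ?thesis using C' by simp
qed

lemma trace_proj_mult: "trace (proj m e ** V) = mdot m (V *v e) e"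
proof -
  have "trace (proj m e ** V) = (\<Sum>k\<in>UNIV. \<Sum>l\<in>UNIV. e $ k * e $ l / m $ l * V $ l $ k)"
    by (simp add: trace_def matrix_matrix_mult_def proj_def)
  also have "\<dots> = (\<Sum>l\<in>UNIV. \<Sum>k\<in>UNIV. e $ k * e $ l / m $ l * V $ l $ k)" by (rule sum.swap)
  also have "\<dots> = mdot m (V *v e) e"
    by (simp add: mdot_def matrix_vector_mult_def sum_distrib_right sum_distrib_left
        sum_divide_distrib mult_ac)
  finally show ?thesis .
qed

end

section \<open>Spectral decomposition in a fixed eigenframe\<close>

lemma sum_UNIV_option: "(\<Sum>a\<in>UNIV. f a) = f None + (\<Sum>i\<in>UNIV. f (Some i))"
  for f :: "'a::finite option \<Rightarrow> 'b::comm_monoid_add"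
  by (simp add: UNIV_option_conv sum.reindex)

lemma bounded_linear_of_linear: "linear f \<Longrightarrow> bounded_linear f"
  for f :: "'a::euclidean_space \<Rightarrow> 'b::real_normed_vector"
  by (simp add: linear_conv_bounded_linear)

context masses
begin

lemma orthonormal_inj:
  assumes "\<And>i j. mdot m (w i) (w j) = (if i = j then 1 else 0)" shows "inj w"
  by (rule injI) (metis assms zero_neq_one)

lemma orthonormal_independent:
  fixes w :: "'i::finite \<Rightarrow> 'n disp"
  assumes w: "\<And>i j. mdot m (w i) (w j) = (if i = j then 1 else 0)"
  shows "independent (range w)"
  unfolding dependent_finite[OF finite_imageI[OF finite]]
proof
  assume "\<exists>c. (\<exists>v\<in>range w. c v \<noteq> 0) \<and> (\<Sum>v\<in>range w. c v *\<^sub>R v) = 0"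
  then obtain c k where k: "c (w k) \<noteq> 0" and "(\<Sum>v\<in>range w. c v *\<^sub>R v) = 0"
    by blast
  then have "(\<Sum>i\<in>UNIV. c (w i) *\<^sub>R w i) = 0"
    by (simp add: sum.reindex[OF orthonormal_inj[OF w]])
  then have "mdot m (\<Sum>i\<in>UNIV. c (w i) *\<^sub>R w i) (w k) = 0" by (simp add: mdot_simps)
  then show False
    using k by (simp add: mdot_simps w if_distrib[of "\<lambda>x. _ * x"] cong: if_cong)
qed

lemma orthonormal_dim_span:
  fixes w :: "'i::finite \<Rightarrow> 'n disp"
  assumes w: "\<And>i j. mdot m (w i) (w j) = (if i = j then 1 else 0)"
  shows "dim (span (range w)) = CARD('i)"
  using dim_span_eq_card_independent[OF orthonormal_independent[of w, OF w]]
    card_image[OF orthonormal_inj[of w, OF w]] by simp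

end

text \<open>An orthonormal family \<open>u\<close> in \<open>Dstar\<close> together with distinct non-zero numbers \<open>v0\<close>: the data of a
  symmetric endomorphism with simple non-zero eigenvalues.\<close>

locale eigenframe = masses m for m :: "'n::finite disp" +
  fixes u :: "'d::finite \<Rightarrow> 'n disp" and v0 :: "real^'d"
  assumes orthonormal: "\<And>i j. mdot m (u i) (u j) = (if i = j then 1 else 0)"
    and u_Dstar: "\<And>i. u i \<in> Dstar"
    and v0_inj: "\<And>i j. v0 $ i = v0 $ j \<Longrightarrow> i = j"
    and v0_nonzero: "\<And>i. v0 $ i \<noteq> 0"
begin

text \<open>The orthogonal projections onto the lines of the \<open>u i\<close> and, for the index \<open>None\<close>, onto their common
  orthogonal complement in \<open>\<real>\<^sup>n\<close>, which contains \<open>m\<close>.\<close>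

definition eproj :: "'d option \<Rightarrow> 'n endo" where
  "eproj a = (case a of None \<Rightarrow> mat 1 - (\<Sum>i\<in>UNIV. proj m (u i)) | Some i \<Rightarrow> proj m (u i))"

lemma eproj_Some: "eproj (Some i) = proj m (u i)" and eproj_None: "eproj None = mat 1 - (\<Sum>i\<in>UNIV. proj m (u i))"
  by (simp_all add: eproj_def)

text \<open>The eigenvalues of \<open>diag v\<close>, extended by \<open>0\<close> at the index \<open>None\<close> of the kernel.\<close>

definition eigval :: "real^'d \<Rightarrow> 'd option \<Rightarrow> real" where
  "eigval v a = (case a of None \<Rightarrow> 0 | Some i \<Rightarrow> v $ i)"

lemma eigval_simps [simp]: "eigval v None = 0" "eigval v (Some i) = v $ i"
  by (simp_all add: eigval_def)

text \<open>The endomorphism with eigenvectors \<open>u i\<close> and eigenvalues \<open>v $ i\<close>, zero on the orthogonal complement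
  of the \<open>u i\<close>.\<close>

definition diag :: "real^'d \<Rightarrow> 'n endo" where
  "diag v = (\<Sum>i\<in>UNIV. v $ i *\<^sub>R eproj (Some i))"

text \<open>The entries of \<open>v\<close> are distinct and different from \<open>0\<close>; the eigenspaces of \<open>diag v\<close> are then the images of the
  projections \<open>eproj\<close>.\<close>

definition separated :: "real^'d \<Rightarrow> bool" where
  "separated v \<longleftrightarrow> inj (eigval v)"

lemma separatedI:
  assumes "\<And>i j. v $ i = v $ j \<Longrightarrow> i = j" "\<And>i. v $ i \<noteq> 0" shows "separated v"
  unfolding separated_def
proof (rule injI)
  fix a c assume "eigval v a = eigval v c"
  then show "a = c"
    using assms(1) assms(2) assms(2)[symmetric] by (cases a; cases c) auto
qed

lemma separated_v0: "separated v0"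
  by (rule separatedI[OF v0_inj v0_nonzero])

lemma separated_ne: "separated v \<Longrightarrow> a \<noteq> c \<Longrightarrow> eigval v a \<noteq> eigval v c"
  unfolding separated_def by (meson injD)

lemma proj_proj: "proj m (u i) ** proj m (u j) = (if i = j then proj m (u i) else 0)"
  unfolding matrix_eq by (auto simp: mv_assoc proj_mult_vec mdot_simps orthonormal mv_simps)

lemma eproj_eproj: "eproj a ** eproj c = (if a = c then eproj a else 0)"
  by (cases a; cases c) (auto simp: eproj_def mm_simps proj_proj)

lemma eproj_eproj_assoc: "A ** eproj a ** eproj c = (if a = c then A ** eproj a else 0)"
  by (simp add: matrix_mul_assoc[symmetric] eproj_eproj mm_simps)

lemma sum_eproj: "(\<Sum>a\<in>UNIV. eproj a) = mat 1"
  by (simp add: sum_UNIV_option eproj_def)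

lemma selfadjoint_eproj: "mdot m (eproj a *v \<xi>) \<eta> = mdot m \<xi> (eproj a *v \<eta>)"
  using mdot_commute[of m]
  by (cases a) (auto simp: eproj_def proj_mult_vec mdot_simps mv_simps intro!: sum.cong)

lemma eproj_m: "eproj a *v m = (if a = None then m else 0)"
  using u_Dstar mdot_commute[of m m]
  by (cases a) (auto simp: eproj_def proj_mult_vec mv_simps Dstar_iff)

lemma eproj_u: "eproj a *v u i = (if a = Some i then u i else 0)"
  by (cases a) (auto simp: eproj_def proj_mult_vec mv_simps orthonormal
      if_distrib[of "\<lambda>c. c *\<^sub>R _"] cong: if_cong)

lemma block_expansion: "H = (\<Sum>a\<in>UNIV. \<Sum>c\<in>UNIV. eproj a ** H ** eproj c)"
proof -
  have "H = (\<Sum>a\<in>UNIV. eproj a) ** H ** (\<Sum>c\<in>UNIV. eproj c)" by (simp add: sum_eproj)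
  also have "\<dots> = (\<Sum>c\<in>UNIV. \<Sum>a\<in>UNIV. eproj a ** H ** eproj c)" by (simp add: mm_simps)
  finally show ?thesis by (subst (asm) sum.swap)
qed

lemma diag_eproj: "diag v ** eproj c = eigval v c *\<^sub>R eproj c" "eproj c ** diag v = eigval v c *\<^sub>R eproj c"
  by (cases c; simp add: diag_def mm_simps eproj_eproj if_distrib[of "\<lambda>x. _ *\<^sub>R x"] cong: if_cong)+

lemma diag_u: "diag v *v u i = v $ i *\<^sub>R u i"
  by (simp add: diag_def mv_simps eproj_u if_distrib[of "\<lambda>x. _ *\<^sub>R x"] cong: if_cong)

lemma eproj_diag_assoc: "A ** eproj c ** diag v = eigval v c *\<^sub>R (A ** eproj c)"
  by (simp add: matrix_mul_assoc[symmetric] diag_eproj mm_simps)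

text \<open>The solution \<open>Y\<close> of \<open>Y B\<^sub>0 - B\<^sub>0 Y = H\<close>, up to the block-diagonal part of \<open>H\<close>, where \<open>B\<^sub>0 = diag v0\<close>.
  The diagonal terms of the sum vanish because \<open>1 / 0 = 0\<close>.\<close>

definition comm_inv :: "'n endo \<Rightarrow> 'n endo" where
  "comm_inv H = (\<Sum>a\<in>UNIV. \<Sum>c\<in>UNIV. (1 / (eigval v0 c - eigval v0 a)) *\<^sub>R (eproj a ** H ** eproj c))"

text \<open>The block-diagonal part of \<open>H\<close>, that is, the part that commutes with \<open>diag v0\<close>. It includes the whole
  block of the kernel.\<close>

definition diag_part :: "'n endo \<Rightarrow> 'n endo" where
  "diag_part H = (\<Sum>a\<in>UNIV. eproj a ** H ** eproj a)"

text \<open>The diagonal entries of \<open>H\<close> at the indices of the \<open>u i\<close>.\<close>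

definition diag_entries :: "'n endo \<Rightarrow> real^'d" where
  "diag_entries H = (\<chi> i. mdot m (H *v u i) (u i))"

lemma linear_comm_inv: "linear comm_inv"
  by (rule linearI) (simp_all add: comm_inv_def mm_simps scaleR_add_right sum.distrib scaleR_sum_right mult.commute)

lemma linear_diag_part: "linear diag_part"
  by (rule linearI) (simp_all add: diag_part_def mm_simps sum.distrib scaleR_sum_right)

lemma linear_diag: "linear diag"
  by (rule linearI) (simp_all add: diag_def scaleR_add_left sum.distrib scaleR_sum_right)

lemma linear_diag_entries: "linear diag_entries"
  by (rule linearI) (simp_all add: diag_entries_def vec_eq_iff mv_simps mdot_simps)

lemma diag_part_eq: "diag_part H = (\<Sum>a\<in>UNIV. \<Sum>c\<in>UNIV. if a = c then eproj a ** H ** eproj c else 0)"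
  by (simp add: diag_part_def)

lemma comm_inv_commutator: "comm_inv H ** diag v0 - diag v0 ** comm_inv H = H - diag_part H"
proof -
  have "comm_inv H ** diag v0 - diag v0 ** comm_inv H = (\<Sum>a\<in>UNIV. \<Sum>c\<in>UNIV.
      (eigval v0 c / (eigval v0 c - eigval v0 a)) *\<^sub>R (eproj a ** H ** eproj c) -
      (eigval v0 a / (eigval v0 c - eigval v0 a)) *\<^sub>R (eproj a ** H ** eproj c))"
    by (simp add: comm_inv_def mm_simps eproj_diag_assoc matrix_mul_assoc diag_eproj sum_subtractf[symmetric])
  also have "\<dots> =
      (\<Sum>a\<in>UNIV. \<Sum>c\<in>UNIV. ((eigval v0 c - eigval v0 a) / (eigval v0 c - eigval v0 a)) *\<^sub>R (eproj a ** H ** eproj c))"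
    by (simp only: diff_divide_distrib scaleR_diff_left)
  also have "\<dots> = (\<Sum>a\<in>UNIV. \<Sum>c\<in>UNIV. eproj a ** H ** eproj c - (if a = c then eproj a ** H ** eproj c else 0))"
    using separated_ne[OF separated_v0] by (intro sum.cong refl) auto
  also have "\<dots> = H - diag_part H"
    unfolding sum_subtractf diag_part_eq[symmetric] block_expansion[symmetric] ..
  finally show ?thesis .
qed

lemma mdot_block:
  assumes "selfadjoint H"
  shows "mdot m ((eproj a ** H ** eproj c) *v \<xi>) \<eta> = mdot m \<xi> ((eproj c ** H ** eproj a) *v \<eta>)"
  using assms by (simp add: mv_assoc selfadjoint_eproj selfadjoint_def)

lemma skew_comm_inv: assumes "selfadjoint H" shows "skew (comm_inv H)"
  unfolding skew_def
proof (intro allI)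
  fix \<xi> \<eta>
  have "mdot m (comm_inv H *v \<xi>) \<eta> = (\<Sum>a\<in>UNIV. \<Sum>c\<in>UNIV. (1 / (eigval v0 c - eigval v0 a)) * mdot m \<xi> ((eproj c ** H ** eproj a) *v \<eta>))"
    by (simp add: comm_inv_def mv_simps mdot_simps mdot_block[OF assms])
  also have "\<dots> = (\<Sum>c\<in>UNIV. \<Sum>a\<in>UNIV. - ((1 / (eigval v0 a - eigval v0 c)) * mdot m \<xi> ((eproj c ** H ** eproj a) *v \<eta>)))"
    by (subst sum.swap) (intro sum.cong refl, simp add: minus_divide_right)
  also have "\<dots> = - mdot m \<xi> (comm_inv H *v \<eta>)"
    by (simp add: comm_inv_def mv_simps mdot_simps sum_negf)
  finally show "mdot m (comm_inv H *v \<xi>) \<eta> = - mdot m \<xi> (comm_inv H *v \<eta>)" .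
qed

lemma comm_inv_m: assumes "H *v m = 0" shows "comm_inv H *v m = 0"
  by (simp add: comm_inv_def mv_simps mv_assoc eproj_m assms if_distrib[of "\<lambda>x. _ *v x"] cong: if_cong)

lemma diag_part_sym: assumes "H \<in> sym_endo m" shows "diag_part H \<in> sym_endo m"
  using assms mdot_block[of H]
  by (auto simp: sym_endo_iff diag_part_def selfadjoint_def mv_simps mdot_simps mv_assoc eproj_m
      if_distrib[of "\<lambda>x. _ *v x"] intro!: sum.cong cong: if_cong)

lemma eproj_diag_part_eproj: "eproj a ** diag_part H ** eproj c = (if a = c then eproj a ** H ** eproj a else 0)"
  by (simp add: diag_part_def mm_simps matrix_mul_assoc eproj_eproj eproj_eproj_assoc if_distrib[of "\<lambda>x. x ** _"] cong: if_cong)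

lemma diag_part_diag_part: "diag_part (diag_part H) = diag_part H"
  by (simp add: diag_part_def[of "diag_part H"] eproj_diag_part_eproj) (simp add: diag_part_def)

lemma trace_sum: "trace (\<Sum>a\<in>I. f a) = (\<Sum>a\<in>I. trace (f a))" for f :: "'i \<Rightarrow> 'n endo"
  by (simp add: trace_def) (rule sum.swap)

lemma trace_diag_part: "trace (diag_part M ** H) = trace (M ** diag_part H)"
proof -
  have "trace (eproj a ** M ** eproj a ** H) = trace (M ** (eproj a ** H ** eproj a))" for a
    by (metis matrix_mul_assoc trace_mul_sym)
  then show ?thesis by (simp add: diag_part_def mm_simps trace_sum)
qed

lemma diag_part_commutes: "diag_part M ** diag v = diag v ** diag_part M"
  by (simp add: diag_part_def mm_simps eproj_diag_assoc matrix_mul_assoc diag_eproj)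

lemma diag_part_eq_of_commutes:
  assumes v: "separated v" and M: "M ** diag v = diag v ** M"
  shows "diag_part M = M"
proof -
  have "eproj a ** M ** eproj c = 0" if "a \<noteq> c" for a c
  proof -
    have "eigval v c *\<^sub>R (eproj a ** M ** eproj c) = eproj a ** (M ** diag v) ** eproj c"
      by (simp add: matrix_mul_assoc[symmetric] diag_eproj mm_simps)
    also have "\<dots> = eigval v a *\<^sub>R (eproj a ** M ** eproj c)"
      by (simp add: M matrix_mul_assoc diag_eproj mm_simps)
    finally show ?thesis using separated_ne[OF v that] by auto
  qed
  then have "(\<Sum>a\<in>UNIV. \<Sum>c\<in>UNIV. eproj a ** M ** eproj c) = diag_part M"
    unfolding diag_part_eq by (intro sum.cong refl) auto
  then show ?thesis by (simp flip: block_expansion)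
qed

lemma diag_sym: "diag v \<in> sym_endo m"
  using selfadjoint_eproj
  by (auto simp: sym_endo_iff diag_def selfadjoint_def mv_simps mdot_simps eproj_m)

lemma diag_part_diag: "diag_part (diag v) = diag v"
  by (rule diag_part_eq_of_commutes[OF separated_v0])
    (simp add: diag_def mm_simps eproj_eproj if_distrib[of "\<lambda>x. _ *\<^sub>R x"] cong: if_cong,
     simp add: mult.commute)

lemma diag_entries_diag: "diag_entries (diag v) = v"
  by (simp add: diag_entries_def diag_u mdot_simps orthonormal vec_eq_iff)

lemma diag_entries_diag_part: "diag_entries (diag_part H) = diag_entries H"
proof -
  have "mdot m (diag_part H *v u i) (u i) = mdot m (H *v u i) (u i)" for i
    by (simp add: diag_part_def mv_simps mdot_simps mv_assoc selfadjoint_eproj eproj_u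
        if_distrib[of "\<lambda>x. _ *v x"] if_distrib[of "mdot m _"] cong: if_cong)
  then show ?thesis by (simp add: diag_entries_def)
qed

lemma eproj_Some_block: "eproj (Some i) ** H ** eproj (Some i) = diag_entries H $ i *\<^sub>R eproj (Some i)"
  unfolding matrix_eq
  by (simp add: mv_assoc eproj_Some proj_mult_vec mv_simps mdot_simps diag_entries_def)

lemma diag_part_eq_diag:
  assumes "eproj None ** H ** eproj None = 0" shows "diag_part H = diag (diag_entries H)"
  by (simp add: diag_part_def sum_UNIV_option assms eproj_Some_block diag_def)

end

section \<open>A chart of symmetric endomorphisms adapted to the spectrum\<close>

context eigenframe
begin

text \<open>An arbitrary linear projection of the space of matrices onto the symmetric endomorphisms of \<open>Dstar\<close>. It
  serves to extend maps defined on symmetric endomorphisms to all matrices, so that the inverse function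
  theorem applies in the ambient space.\<close>

definition sym_proj :: "'n endo \<Rightarrow> 'n endo" where
  "sym_proj = (SOME p. linear p \<and> range p \<subseteq> sym_endo m \<and> (\<forall>H\<in>sym_endo m. p H = H))"

lemma sym_proj_exists: "\<exists>p :: 'n endo \<Rightarrow> 'n endo.
    linear p \<and> range p \<subseteq> sym_endo m \<and> (\<forall>H\<in>sym_endo m. p H = H)"
  using linear_exists_left_inverse_on[of "\<lambda>H. H" "sym_endo m"] subspace_sym_endo
  by (metis inj_on_id2 linear_ident)

lemma linear_sym_proj: "linear sym_proj" and sym_proj_sym: "sym_proj H \<in> sym_endo m"
  and sym_proj_eq: "H \<in> sym_endo m \<Longrightarrow> sym_proj H = H"
  using someI_ex[OF sym_proj_exists] unfolding sym_proj_def[symmetric] by blast+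

text \<open>The skew endomorphism encoding the off-diagonal part of \<open>H\<close>. The factor \<open>1 / 2\<close> compensates the
  derivative \<open>2 Y\<close> of the Cayley transform.\<close>

definition rot_gen :: "'n endo \<Rightarrow> 'n endo" where
  "rot_gen H = (1/2) *\<^sub>R comm_inv (sym_proj H)"

lemma bounded_linear_rot_gen: "bounded_linear rot_gen"
  unfolding rot_gen_def
  by (rule bounded_linear_of_linear)
    (auto intro!: linearI simp: linear_add[OF linear_comm_inv] linear_add[OF linear_sym_proj] linear_cmul[OF linear_comm_inv]
      linear_cmul[OF linear_sym_proj] scaleR_add_right)

lemma skew_rot_gen: "skew (rot_gen H)"
  using skew_comm_inv[of "sym_proj H"] sym_proj_sym[of H]
  by (simp add: rot_gen_def skew_def sym_endo_iff mv_simps mdot_simps)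

lemma rot_gen_m: "rot_gen H *v m = 0"
  using comm_inv_m[of "sym_proj H"] sym_proj_sym[of H] by (simp add: rot_gen_def sym_endo_iff mv_simps)

text \<open>The rotation \<open>Q\<close> carrying the frame \<open>u\<close> to eigenvectors of \<open>spectral_chart H\<close>, for symmetric \<open>H\<close>.\<close>

definition rot :: "'n endo \<Rightarrow> 'n endo" where
  "rot H = cayley (rot_gen H)"

text \<open>The inverse, and adjoint, of \<open>rot H\<close>.\<close>

definition rot_inv :: "'n endo \<Rightarrow> 'n endo" where
  "rot_inv H = cayley (- rot_gen H)"

lemma rot_rot_inv: "rot H ** rot_inv H = mat 1" and rot_inv_rot: "rot_inv H ** rot H = mat 1"
  by (simp_all add: rot_def rot_inv_def cayley_cayley_minus cayley_minus_cayley skew_rot_gen)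

lemma rot_rot_inv_vec [simp]: "rot H *v (rot_inv H *v \<xi>) = \<xi>" "rot_inv H *v (rot H *v \<xi>) = \<xi>"
  by (simp_all add: matrix_vector_mul_assoc rot_rot_inv rot_inv_rot)

lemma rot_isometry: "mdot m (rot H *v \<xi>) (rot H *v \<eta>) = mdot m \<xi> \<eta>"
  by (simp add: rot_def cayley_isometry skew_rot_gen)

lemma rot_adjoint: "mdot m (rot H *v \<xi>) \<eta> = mdot m \<xi> (rot_inv H *v \<eta>)"
  by (simp add: rot_def rot_inv_def cayley_adjoint skew_rot_gen)

lemma rot_inv_adjoint: "mdot m (rot_inv H *v \<xi>) \<eta> = mdot m \<xi> (rot H *v \<eta>)"
  using rot_adjoint[of H \<eta> \<xi>] mdot_commute by metis

lemma rot_m: "rot H *v m = m" and rot_inv_m: "rot_inv H *v m = m"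
  by (simp_all add: rot_def rot_inv_def cayley_fixes skew_rot_gen skew_minus rot_gen_m mv_simps)

lemma rot_Dstar: "rot H *v \<xi> \<in> Dstar \<longleftrightarrow> \<xi> \<in> Dstar"
  by (simp add: Dstar_iff rot_adjoint rot_inv_m)

lemma rot_inv_Dstar: "rot_inv H *v \<xi> \<in> Dstar \<longleftrightarrow> \<xi> \<in> Dstar"
  by (simp add: Dstar_iff rot_inv_adjoint rot_m)

lemma rot_0: "rot 0 = mat 1" and rot_inv_0: "rot_inv 0 = mat 1"
  using bounded_linear.linear[OF bounded_linear_rot_gen, THEN linear_0]
  by (simp_all add: rot_def rot_inv_def cayley_0)

lemma Cinf_rot: "Cinf UNIV rot" and Cinf_rot_inv: "Cinf UNIV rot_inv"
  unfolding rot_def rot_inv_def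
  by (rule Cinf_cayley, simp_all add: bounded_linear_rot_gen skew_rot_gen bounded_linear_minus skew_minus)+

lemma conj_sym: assumes "M \<in> sym_endo m" shows "rot H ** M ** rot_inv H \<in> sym_endo m"
  using assms by (simp add: sym_endo_iff selfadjoint_def mv_assoc rot_inv_m rot_adjoint rot_inv_adjoint mv_simps)

lemma conj_sym': assumes "M \<in> sym_endo m" shows "rot_inv H ** M ** rot H \<in> sym_endo m"
  using assms by (simp add: sym_endo_iff selfadjoint_def mv_assoc rot_m rot_adjoint rot_inv_adjoint mv_simps)

lemma conj_eq_iff: "rot H ** M ** rot_inv H = N \<longleftrightarrow> M = rot_inv H ** N ** rot H"
proof
  assume "rot H ** M ** rot_inv H = N"
  then have "rot_inv H ** N ** rot H = (rot_inv H ** rot H) ** M ** (rot_inv H ** rot H)"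
    by (metis matrix_mul_assoc)
  then show "M = rot_inv H ** N ** rot H" by (simp add: rot_inv_rot)
next
  assume "M = rot_inv H ** N ** rot H"
  then have "rot H ** M ** rot_inv H = (rot H ** rot_inv H) ** N ** (rot H ** rot_inv H)"
    by (metis matrix_mul_assoc)
  then show "rot H ** M ** rot_inv H = N" by (simp add: rot_rot_inv)
qed

text \<open>The map \<open>H \<mapsto> Q D Q\<inverse>\<close>: the off-diagonal part of \<open>H\<close> moves the eigenspaces of \<open>diag v0\<close>, its
  block-diagonal part moves the eigenvalues and the kernel block. The last summand makes it a local diffeomorphism
  of the space of all matrices that preserves the symmetric ones in both directions.\<close>

definition spectral_chart :: "'n endo \<Rightarrow> 'n endo" where
  "spectral_chart H = rot H ** (diag v0 + diag_part (sym_proj H)) ** rot_inv H + (H - sym_proj H)"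

lemma spectral_chart_eq: "H \<in> sym_endo m \<Longrightarrow> spectral_chart H = rot H ** (diag v0 + diag_part H) ** rot_inv H"
  by (simp add: spectral_chart_def sym_proj_eq)

lemma spectral_chart_sym_iff: "spectral_chart H \<in> sym_endo m \<longleftrightarrow> H \<in> sym_endo m"
proof -
  have "rot H ** (diag v0 + diag_part (sym_proj H)) ** rot_inv H \<in> sym_endo m"
    by (intro conj_sym subspace_add[OF subspace_sym_endo] diag_sym diag_part_sym sym_proj_sym)
  note 1 = this
  show ?thesis
  proof
    assume "spectral_chart H \<in> sym_endo m"
    then have "H - sym_proj H \<in> sym_endo m"
      using subspace_diff[OF subspace_sym_endo _ 1] by (force simp: spectral_chart_def)
    then show "H \<in> sym_endo m"
      using subspace_add[OF subspace_sym_endo _ sym_proj_sym[of H]] by force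
  next
    assume "H \<in> sym_endo m" then show "spectral_chart H \<in> sym_endo m" using 1 by (simp add: spectral_chart_def sym_proj_eq)
  qed
qed

lemma spectral_chart_0: "spectral_chart 0 = diag v0"
  using linear_0[OF linear_sym_proj] linear_0[OF linear_diag_part] by (simp add: spectral_chart_def rot_0 rot_inv_0)

lemma bounded_linear_sym_proj: "bounded_linear sym_proj" and bounded_linear_diag_part: "bounded_linear diag_part"
  and bounded_linear_diag_entries: "bounded_linear diag_entries" and bounded_linear_diag: "bounded_linear diag"
  by (simp_all add: bounded_linear_of_linear linear_sym_proj linear_diag_part linear_diag_entries linear_diag)

lemma Cinf_spectral_chart: "Cinf UNIV spectral_chart"
proof -
  note sym_proj = Cinf_bounded_linear[OF open_UNIV bounded_linear_sym_proj]
  have "Cinf UNIV (\<lambda>H. diag v0 + diag_part (sym_proj H))"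
    by (rule Cinf_add[OF Cinf_const[OF open_UNIV] Cinf_linear_compose[OF bounded_linear_diag_part sym_proj]])
  from Cinf_add[OF Cinf_bilinear[OF bounded_bilinear_matrix_mult Cinf_bilinear[OF bounded_bilinear_matrix_mult
        Cinf_rot this] Cinf_rot_inv] Cinf_diff[OF Cinf_ident[OF open_UNIV] sym_proj]]
  show ?thesis unfolding spectral_chart_def .
qed

lemma spectral_chart_has_derivative: "(spectral_chart has_derivative (\<lambda>Z. Z)) (at 0)"
proof -
  have rot: "(rot has_derivative (\<lambda>Z. comm_inv (sym_proj Z))) (at 0)"
    using cayley_has_derivative[OF bounded_linear_rot_gen skew_rot_gen] unfolding rot_def rot_gen_def by simp
  have "((\<lambda>H. cayley (- rot_gen H)) has_derivative (\<lambda>Z. 2 *\<^sub>R (- rot_gen Z))) (at 0)"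
    by (rule cayley_has_derivative) (simp_all add: bounded_linear_rot_gen skew_rot_gen bounded_linear_minus skew_minus)
  then have rot_inv: "(rot_inv has_derivative (\<lambda>Z. - comm_inv (sym_proj Z))) (at 0)"
    unfolding rot_inv_def rot_gen_def by simp
  have sym_proj: "(sym_proj has_derivative sym_proj) (at 0)" by (rule bounded_linear_imp_has_derivative[OF bounded_linear_sym_proj])
  have D: "((\<lambda>H. diag v0 + diag_part (sym_proj H)) has_derivative (\<lambda>Z. 0 + diag_part (sym_proj Z))) (at 0)"
    by (rule has_derivative_add[OF has_derivative_const bounded_linear.has_derivative[OF bounded_linear_diag_part sym_proj]])
  have z: "sym_proj 0 = 0" "diag_part 0 = 0" using linear_0[OF linear_sym_proj] linear_0[OF linear_diag_part] by auto
  have deriv: "(spectral_chart has_derivative (\<lambda>Z. (rot 0 ** (diag v0 + diag_part (sym_proj 0))) ** (- comm_inv (sym_proj Z)) +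
      (rot 0 ** (0 + diag_part (sym_proj Z)) + comm_inv (sym_proj Z) ** (diag v0 + diag_part (sym_proj 0))) ** rot_inv 0 + (Z - sym_proj Z))) (at 0)"
    unfolding spectral_chart_def
    by (rule has_derivative_add[OF bounded_bilinear.FDERIV[OF bounded_bilinear_matrix_mult
            bounded_bilinear.FDERIV[OF bounded_bilinear_matrix_mult rot D] rot_inv]
          has_derivative_diff[OF has_derivative_ident sym_proj]])
  have eq: "(rot 0 ** (diag v0 + diag_part (sym_proj 0))) ** (- comm_inv (sym_proj Z)) +
      (rot 0 ** (0 + diag_part (sym_proj Z)) + comm_inv (sym_proj Z) ** (diag v0 + diag_part (sym_proj 0))) ** rot_inv 0 + (Z - sym_proj Z) = Z" for Z
    using comm_inv_commutator[of "sym_proj Z"] by (simp add: rot_0 rot_inv_0 z mm_simps algebra_simps)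
  show ?thesis using deriv unfolding eq .
qed

lemma spectral_chart_local_inverse:
  obtains U1 V1 S where "open U1" "0 \<in> U1" "Cinf V1 S" "spectral_chart ` U1 = V1" "S ` V1 = U1"
    "\<And>H. H \<in> U1 \<Longrightarrow> S (spectral_chart H) = H" "\<And>B. B \<in> V1 \<Longrightarrow> spectral_chart (S B) = B"
    "(S has_derivative (\<lambda>Z. Z)) (at (diag v0))" "diag v0 \<in> V1" "S (diag v0) = 0"
proof -
  obtain U1 V1 S where *: "open U1" "0 \<in> U1" "Cinf V1 S" "spectral_chart ` U1 = V1" "S ` V1 = U1"
    "\<And>H. H \<in> U1 \<Longrightarrow> S (spectral_chart H) = H" "\<And>B. B \<in> V1 \<Longrightarrow> spectral_chart (S B) = B"
  proof (rule smooth_inverse_function_theorem[OF Cinf_spectral_chart UNIV_I spectral_chart_has_derivative])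
    fix U V and g :: "'n endo \<Rightarrow> 'n endo"
    assume "open U" "0 \<in> U" "Cinf V g" "spectral_chart ` U = V" "g ` V = U"
      "\<And>x. x \<in> U \<Longrightarrow> g (spectral_chart x) = x" "\<And>y. y \<in> V \<Longrightarrow> spectral_chart (g y) = y"
    then show thesis by (rule that)
  qed
  have B0: "diag v0 \<in> V1" "S (diag v0) = 0"
    using imageI[OF *(2), of spectral_chart] *(6)[OF *(2)] by (simp_all add: *(4) spectral_chart_0)
  define S' where "S' = frechet_derivative S (at (diag v0))"
  have S': "(S has_derivative S') (at (diag v0))"
    unfolding S'_def by (rule Cinf_has_derivative[OF *(3) B0(1)])
  have "((\<lambda>B. spectral_chart (S B)) has_derivative (\<lambda>Z. S' Z)) (at (diag v0))"
    using has_derivative_compose[OF S', of spectral_chart "\<lambda>Z. Z"] spectral_chart_has_derivative by (simp add: B0)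
  moreover have "((\<lambda>B. spectral_chart (S B)) has_derivative (\<lambda>Z. Z)) (at (diag v0))"
    by (rule has_derivative_transform_within_open[OF has_derivative_ident Cinf_open[OF *(3)] B0(1)])
      (rule *(7)[symmetric])
  ultimately have "S' = (\<lambda>Z. Z)" by (rule has_derivative_unique)
  with S' have dS: "(S has_derivative (\<lambda>Z. Z)) (at (diag v0))" by simp
  show ?thesis by (rule that[OF * dS B0])
qed

lemma eigenspace_conj:
  "eigenspace_on Dstar (rot H ** D ** rot_inv H) c = (\<lambda>\<xi>. rot H *v \<xi>) ` eigenspace_on Dstar D c"
proof (intro equalityI subsetI)
  fix \<xi> assume \<xi>: "\<xi> \<in> eigenspace_on Dstar (rot H ** D ** rot_inv H) c"
  have "rot_inv H *v (rot H *v (D *v (rot_inv H *v \<xi>))) = rot_inv H *v (c *\<^sub>R \<xi>)"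
    using \<xi> by (simp add: eigenspace_on_def mv_assoc)
  then have "rot_inv H *v \<xi> \<in> eigenspace_on Dstar D c"
    using \<xi> by (simp add: eigenspace_on_def rot_inv_Dstar mv_simps)
  then show "\<xi> \<in> (\<lambda>\<xi>. rot H *v \<xi>) ` eigenspace_on Dstar D c"
    by (rule rev_image_eqI) simp
next
  fix \<xi> assume "\<xi> \<in> (\<lambda>\<xi>. rot H *v \<xi>) ` eigenspace_on Dstar D c"
  then show "\<xi> \<in> eigenspace_on Dstar (rot H ** D ** rot_inv H) c"
    by (auto simp: eigenspace_on_def mv_assoc rot_Dstar mv_simps)
qed

lemma inj_rot: "inj_on (\<lambda>\<xi>. rot H *v \<xi>) S"
  by (rule inj_on_inverseI[where g = "\<lambda>\<xi>. rot_inv H *v \<xi>"]) simp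

lemma dim_rot_image: "dim ((\<lambda>\<xi>. rot H *v \<xi>) ` S) = dim S"
  by (rule dim_image_eq[OF _ inj_rot]) simp

lemma endo_image_conj: "endo_image (rot H ** D ** rot_inv H) = (\<lambda>\<xi>. rot H *v \<xi>) ` endo_image D"
proof -
  have "(\<lambda>\<xi>. rot_inv H *v \<xi>) ` Dstar = Dstar"
  proof (intro equalityI subsetI)
    fix \<xi> assume "\<xi> \<in> (Dstar :: 'n disp set)"
    then show "\<xi> \<in> (\<lambda>\<xi>. rot_inv H *v \<xi>) ` Dstar"
      by (intro rev_image_eqI[of "rot H *v \<xi>"]) (simp_all add: rot_Dstar)
  qed (auto simp: rot_inv_Dstar)
  then have "(\<lambda>\<xi>. rot H *v \<xi>) ` (\<lambda>\<xi>. D *v \<xi>) ` (\<lambda>\<xi>. rot_inv H *v \<xi>) ` Dstar = (\<lambda>\<xi>. rot H *v \<xi>) ` endo_image D"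
    by (simp add: endo_image_def)
  then show ?thesis by (simp add: endo_image_def image_image mv_assoc)
qed

lemma diag_part_expansion: "diag_part H = diag (diag_entries H) + eproj None ** H ** eproj None"
  by (simp add: diag_part_def sum_UNIV_option eproj_Some_block diag_def)

lemma eproj_None_Dstar: "\<xi> \<in> Dstar \<Longrightarrow> eproj None *v \<xi> \<in> Dstar"
  by (simp add: Dstar_iff selfadjoint_eproj eproj_m)

text \<open>The kernel block of a symmetric endomorphism vanishes as soon as it vanishes on \<open>Dstar\<close>.\<close>

lemma kernel_block_0I:
  assumes H: "H \<in> sym_endo m" and 0: "\<And>\<xi>. \<xi> \<in> Dstar \<Longrightarrow> (eproj None ** H ** eproj None) *v \<xi> = 0"
  shows "eproj None ** H ** eproj None = 0"
proof -
  have "(eproj None ** H ** eproj None) *v \<xi> = 0" for \<xi>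
  proof -
    obtain t where "\<xi> - t *\<^sub>R m \<in> Dstar" using decompose_Dstar by blast
    from 0[OF this] H show ?thesis
      by (simp add: mv_simps mv_assoc eproj_m sym_endo_iff)
  qed
  then show ?thesis by (simp add: matrix_eq mv_simps)
qed

lemma dim_span_u: "dim (span (range u)) = CARD('d)"
  by (rule orthonormal_dim_span[OF orthonormal])

text \<open>Spectra whose entries are distinct and non-zero, and whose \<open>i\<close>-th entry differs from the \<open>j\<close>-th entry of
  \<open>v0\<close> for \<open>j \<noteq> i\<close>. This is an open neighbourhood of \<open>v0\<close>; the comparison with \<open>v0\<close> prevents a permutation of the
  eigenvalues.\<close>

definition generic :: "(real^'d) set" where
  "generic = {v. (\<forall>i j. i \<noteq> j \<longrightarrow> v $ i \<noteq> v $ j \<and> v $ i \<noteq> v0 $ j) \<and> (\<forall>i. v $ i \<noteq> 0)}"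

lemma open_generic: "open generic"
proof -
  have "generic = (\<Inter>i. {v. v $ i \<noteq> 0}) \<inter> (\<Inter>i. \<Inter>j\<in>- {i}. {v. v $ i \<noteq> v $ j} \<inter> {v. v $ i \<noteq> v0 $ j})"
    by (auto simp: generic_def)
  moreover have "open \<dots>"
    by (intro open_Int open_INT ballI open_Collect_neq continuous_intros) auto
  ultimately show ?thesis by simp
qed

lemma v0_generic: "v0 \<in> generic"
  using v0_inj v0_nonzero by (auto simp: generic_def)

lemma generic_separated: "v \<in> generic \<Longrightarrow> separated v"
  by (rule separatedI) (auto simp: generic_def)

lemma block_diag: "diag v0 + diag_part H = diag (v0 + diag_entries H) + eproj None ** H ** eproj None"
  by (simp add: diag_part_expansion linear_add[OF linear_diag])

lemma diag_part_of_block_0: "eproj None ** H ** eproj None = 0 \<Longrightarrow> diag v0 + diag_part H = diag (v0 + diag_entries H)"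
  by (simp add: block_diag)

lemma eproj_None_block_u: "(eproj None ** H ** eproj None) *v u i = 0"
  by (simp add: mv_assoc eproj_u mv_simps)

text \<open>All \<open>u i\<close> are in the image of the block-diagonal endomorphism, so if its rank is \<open>CARD('d)\<close> they
  span the image, and nothing is left for the kernel block.\<close>

lemma rank_imp_block_0:
  assumes H: "H \<in> sym_endo m" and nz: "\<And>i. (v0 + diag_entries H) $ i \<noteq> 0"
    and rank: "dim (endo_image (rot H' ** (diag v0 + diag_part H) ** rot_inv H')) = CARD('d)"
  shows "eproj None ** H ** eproj None = 0"
proof (rule kernel_block_0I[OF H])
  define D where "D = diag v0 + diag_part H"
  have D: "D = diag (v0 + diag_entries H) + eproj None ** H ** eproj None" by (simp add: D_def block_diag)
  have sub: "subspace (endo_image D)"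
    unfolding endo_image_def by (rule linear_subspace_image[OF _ subspace_Dstar]) simp
  have "u i \<in> endo_image D" for i
  proof -
    have "D *v u i = (v0 + diag_entries H) $ i *\<^sub>R u i"
      by (simp only: D mv_simps diag_u eproj_None_block_u add_0_right)
    then have "D *v ((1 / (v0 + diag_entries H) $ i) *\<^sub>R u i) = u i" using nz[of i] by (simp add: mv_simps)
    then show ?thesis
      unfolding endo_image_def by (rule rev_image_eqI[rotated, OF sym])
        (rule subspace_scale[OF subspace_Dstar u_Dstar])
  qed
  then have "span (range u) \<subseteq> endo_image D" by (intro span_minimal sub) auto
  moreover have "dim (endo_image D) = CARD('d)"
    using rank by (simp add: endo_image_conj dim_rot_image flip: D_def)
  ultimately have img: "span (range u) = endo_image D"
    using subspace_dim_equal[OF subspace_span sub] dim_span_u by simp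
  fix \<xi> :: "'n disp" assume \<xi>: "\<xi> \<in> Dstar"
  have "D *v (eproj None *v \<xi>) = (eproj None ** H ** eproj None) *v \<xi>"
  proof -
    have "diag (v0 + diag_entries H) *v (eproj None *v \<xi>) = 0"
      by (simp add: matrix_vector_mul_assoc diag_eproj mv_simps)
    moreover have "(eproj None ** H ** eproj None) *v (eproj None *v \<xi>) = (eproj None ** H ** eproj None) *v \<xi>"
      by (simp add: matrix_vector_mul_assoc eproj_eproj_assoc)
    ultimately show ?thesis by (simp only: D mv_simps add_0_left)
  qed
  then have "(eproj None ** H ** eproj None) *v \<xi> \<in> span (range u)"
    unfolding img endo_image_def using eproj_None_Dstar[OF \<xi>] by (metis imageI)
  then have "eproj None *v ((eproj None ** H ** eproj None) *v \<xi>) = 0"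
  proof (rule span_induct)
    show "subspace {x. eproj None *v x = 0}" by (auto simp: subspace_def mv_simps)
  qed (auto simp: eproj_u)
  then show "(eproj None ** H ** eproj None) *v \<xi> = 0"
    by (simp add: mv_assoc[symmetric] matrix_mul_assoc eproj_eproj)
qed

text \<open>An isospectral endomorphism near \<open>diag v0\<close> has no block-diagonal part in the coordinates of
  \<open>spectral_chart\<close>: its kernel has the dimension of that of \<open>diag v0\<close>, which forces the kernel block to
  vanish, and by genericity no eigenvalue of \<open>diag v0\<close> can have moved.\<close>

lemma isospectral_imp_diag_part_0:
  assumes H: "H \<in> sym_endo m" and gen: "v0 + diag_entries H \<in> generic"
    and iso: "rot H' ** (diag v0 + diag_part H) ** rot_inv H' \<in> isospectral m (diag v0)"
  shows "diag_part H = 0"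
proof -
  define D where "D = diag v0 + diag_part H"
  define E where "E B c = eigenspace_on Dstar B c" for B :: "'n endo" and c
  have D: "D = diag (v0 + diag_entries H) + eproj None ** H ** eproj None" by (simp add: D_def block_diag)
  have subE: "subspace (E B c)" for B c
    unfolding E_def eigenspace_on_def using subspace_Dstar
    by (auto simp: subspace_def mv_simps scaleR_add_right)
  have dims: "dim (E D c) = dim (E (diag v0) c)" for c
    using iso by (simp add: isospectral_def eigenspace_conj dim_rot_image E_def flip: D_def)
  have PD: "eproj (Some i) *v (D *v \<xi>) = (v0 + diag_entries H) $ i *\<^sub>R (eproj (Some i) *v \<xi>)" for i \<xi>
    by (simp add: D mv_simps mm_simps matrix_vector_mul_assoc diag_eproj matrix_mul_assoc eproj_eproj)
  have nz: "(v0 + diag_entries H) $ i \<noteq> 0" for i using gen by (simp add: generic_def)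
  have "E D 0 \<subseteq> E (diag v0) 0"
  proof
    fix \<xi> assume \<xi>: "\<xi> \<in> E D 0"
    then have "eproj (Some i) *v \<xi> = 0" for i
      using PD[of i \<xi>] nz[of i] by (simp add: E_def eigenspace_on_def mv_simps)
    then have "diag v0 *v \<xi> = 0" by (simp add: diag_def mv_simps)
    then show "\<xi> \<in> E (diag v0) 0" using \<xi> by (simp add: E_def eigenspace_on_def)
  qed
  then have ker: "E D 0 = E (diag v0) 0"
    by (intro subspace_dim_equal subE) (simp_all add: dims)
  have C0: "eproj None ** H ** eproj None = 0"
  proof (rule kernel_block_0I[OF H])
    fix \<xi> :: "'n disp" assume "\<xi> \<in> Dstar"
    then have "eproj None *v \<xi> \<in> E (diag v0) 0"
      by (simp add: E_def eigenspace_on_def eproj_None_Dstar matrix_vector_mul_assoc diag_eproj mv_simps)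
    then have "D *v (eproj None *v \<xi>) = 0" unfolding ker[symmetric] by (simp add: E_def eigenspace_on_def)
    then show "(eproj None ** H ** eproj None) *v \<xi> = 0"
      by (simp add: D mv_simps matrix_vector_mul_assoc mm_simps diag_eproj eproj_eproj_assoc)
  qed
  have "diag_entries H $ i = 0" for i
  proof -
    have "u i \<in> E (diag v0) (v0 $ i)" by (simp add: E_def eigenspace_on_def diag_u u_Dstar)
    moreover have "u i \<noteq> 0" using orthonormal[of i i] by (auto simp: mdot_simps)
    ultimately have "\<not> E (diag v0) (v0 $ i) \<subseteq> {0}" by blast
    then have "\<not> E D (v0 $ i) \<subseteq> {0}" using dims[of "v0 $ i"] by (metis dim_eq_0)
    then obtain \<xi> where \<xi>: "\<xi> \<noteq> 0" "D *v \<xi> = (v0 $ i) *\<^sub>R \<xi>"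
      by (auto simp: E_def eigenspace_on_def)
    have "eproj None *v (D *v \<xi>) = 0"
      by (simp add: D C0 mv_simps matrix_vector_mul_assoc diag_eproj)
    then have PN: "eproj None *v \<xi> = 0" using v0_nonzero[of i] by (simp add: \<xi> mv_simps)
    have "\<exists>j. eproj (Some j) *v \<xi> \<noteq> 0"
    proof (rule ccontr)
      assume "\<not> (\<exists>j. eproj (Some j) *v \<xi> \<noteq> 0)"
      then have "(\<Sum>a\<in>UNIV. eproj a) *v \<xi> = 0" by (simp add: sum_UNIV_option mv_simps PN)
      then show False using \<xi>(1) by (simp add: sum_eproj)
    qed
    then obtain j where j: "eproj (Some j) *v \<xi> \<noteq> 0" by blast
    have "(v0 + diag_entries H) $ j *\<^sub>R (eproj (Some j) *v \<xi>) = v0 $ i *\<^sub>R (eproj (Some j) *v \<xi>)"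
      using PD[of j \<xi>, symmetric] unfolding \<xi>(2) mv_simps .
    then have e: "(v0 + diag_entries H) $ j = v0 $ i" using j unfolding scaleR_cancel_right by blast
    then have "j = i" using gen by (auto simp: generic_def)
    then show ?thesis using e by simp
  qed
  then have "diag_entries H = 0" by (simp add: vec_eq_iff)
  then show ?thesis by (simp add: diag_part_expansion C0 linear_0[OF linear_diag])
qed

lemma conj_isospectral':
  "N \<in> isospectral m B \<Longrightarrow> rot H ** N ** rot_inv H \<in> isospectral m B"
  by (simp add: isospectral_def conj_sym eigenspace_conj dim_rot_image)

lemma conj_isospectral: "rot H ** diag v0 ** rot_inv H \<in> isospectral m (diag v0)"
  by (simp add: isospectral_def conj_sym diag_sym eigenspace_conj dim_rot_image)

end

section \<open>Wintner--Conley endomorphism and potential\<close>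

lemma has_vector_derivative_cong_nhds:
  assumes D: "(f has_vector_derivative D) (at x)" and ev: "\<forall>\<^sub>F s in nhds x. f s = g s"
  shows "(g has_vector_derivative D) (at x)"
proof -
  obtain S where S: "open S" "x \<in> S" "\<And>s. s \<in> S \<Longrightarrow> f s = g s"
    using ev unfolding eventually_nhds by auto
  show ?thesis by (rule has_vector_derivative_transform_within_open[OF D S])
qed

text \<open>Compose with a linear projection onto \<open>L\<close>.\<close>

lemma has_vector_derivative_subspace:
  fixes \<gamma> :: "real \<Rightarrow> 'a::euclidean_space"
  assumes L: "subspace L" and D: "(\<gamma> has_vector_derivative D) (at 0)"
    and ev: "\<forall>\<^sub>F s in at 0. \<gamma> s \<in> L" and 0: "\<gamma> 0 \<in> L"
  shows "D \<in> L"
proof -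
  obtain p :: "'a \<Rightarrow> 'a" where p: "range p \<subseteq> L" "linear p" "\<forall>v\<in>L. p v = v"
    using linear_exists_left_inverse_on[OF linear_ident L] by (auto simp: inj_on_def)
  have "((\<lambda>s. \<gamma> s - p (\<gamma> s)) has_vector_derivative (D - p D)) (at 0)"
    by (rule has_vector_derivative_diff[OF D bounded_linear.has_vector_derivative[OF bounded_linear_of_linear[OF p(2)] D]])
  moreover have "((\<lambda>s. \<gamma> s - p (\<gamma> s)) has_vector_derivative 0) (at 0)"
  proof -
    have "\<forall>\<^sub>F s in nhds 0. \<gamma> s \<in> L"
      using ev 0 by (simp add: eventually_nhds_conv_at)
    then have "\<forall>\<^sub>F s in nhds 0. 0 = \<gamma> s - p (\<gamma> s)"
      by (rule eventually_mono) (use p(3) in simp)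
    then show ?thesis by (rule has_vector_derivative_cong_nhds[OF has_vector_derivative_const])
  qed
  ultimately have "D - p D = 0" by (rule vector_derivative_unique_at)
  then show ?thesis using p(1) by auto
qed

text \<open>The second summand is the second derivative of \<open>f\<close>; it becomes the Hessian for real-valued \<open>f\<close>.\<close>

lemma frechet_derivative_along_curve:
  fixes f :: "'a::euclidean_space \<Rightarrow> 'b::euclidean_space" and c w :: "real \<Rightarrow> 'a"
  assumes f: "Cinf U f" and c: "(c has_vector_derivative c') (at 0)" "c 0 \<in> U"
    and w: "(w has_vector_derivative w') (at 0)"
  shows "((\<lambda>s. frechet_derivative f (at (c s)) (w s)) has_vector_derivative
     (frechet_derivative f (at (c 0)) w' +
      frechet_derivative (\<lambda>q. frechet_derivative f (at q) (w 0)) (at (c 0)) c')) (at 0)"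
proof -
  define df where "df b q = frechet_derivative f (at q) b" for b q
  define ddf where "ddf b = frechet_derivative (df b) (at (c 0))" for b
  have ddf: "(df b has_derivative ddf b) (at (c 0))" for b
    unfolding ddf_def df_def by (rule Cinf_has_derivative[OF Cinf_frechet_derivative[OF f] c(2)])
  have expand: "df v q = (\<Sum>b\<in>Basis. (v \<bullet> b) *\<^sub>R df b q)" if "q \<in> U" for v q
    unfolding df_def by (rule linear_Basis_expansion[OF Cinf_linear_derivative[OF f that]])
  have "((\<lambda>s. df b (c s)) has_vector_derivative ddf b c') (at 0)" for b
    using has_derivative_compose[OF c(1)[unfolded has_vector_derivative_def] ddf]
      linear_cmul[OF has_derivative_linear[OF ddf]]
    by (simp add: has_vector_derivative_def)
  then have "((\<lambda>s. \<Sum>b\<in>Basis. (w s \<bullet> b) *\<^sub>R df b (c s)) has_vector_derivative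
      (\<Sum>b\<in>Basis. (w 0 \<bullet> b) *\<^sub>R ddf b c' + (w' \<bullet> b) *\<^sub>R df b (c 0))) (at 0)"
    by (intro has_vector_derivative_sum has_vector_derivative_scaleR)
      (auto simp: has_real_derivative_iff_has_vector_derivative
        intro: bounded_linear.has_vector_derivative[OF bounded_linear_inner_left w])
  moreover have "(\<Sum>b\<in>Basis. (w 0 \<bullet> b) *\<^sub>R ddf b c' + (w' \<bullet> b) *\<^sub>R df b (c 0)) =
      df w' (c 0) + ddf (w 0) c'"
  proof -
    have "(df (w 0) has_derivative (\<lambda>v. \<Sum>b\<in>Basis. (w 0 \<bullet> b) *\<^sub>R ddf b v)) (at (c 0))"
      by (rule has_derivative_transform_within_open[OF has_derivative_sum[OF has_derivative_scaleR_right[OF ddf]]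
            Cinf_open[OF f] c(2)]) (rule expand[symmetric])
    then have "ddf (w 0) = (\<lambda>v. \<Sum>b\<in>Basis. (w 0 \<bullet> b) *\<^sub>R ddf b v)"
      by (rule has_derivative_unique[OF ddf])
    then have "ddf (w 0) c' = (\<Sum>b\<in>Basis. (w 0 \<bullet> b) *\<^sub>R ddf b c')" by simp
    then show ?thesis using expand[OF c(2), of w'] by (simp add: sum.distrib)
  qed
  ultimately have "((\<lambda>s. \<Sum>b\<in>Basis. (w s \<bullet> b) *\<^sub>R df b (c s)) has_vector_derivative
      (df w' (c 0) + ddf (w 0) c')) (at 0)" by simp
  moreover have "\<forall>\<^sub>F s in nhds 0. (\<Sum>b\<in>Basis. (w s \<bullet> b) *\<^sub>R df b (c s)) = df (w s) (c s)"
  proof -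
    have "isCont c 0" by (rule has_vector_derivative_continuous[OF c(1)])
    then have "\<forall>\<^sub>F s in nhds 0. c s \<in> U"
      using c(2) Cinf_open[OF f] by (simp add: continuous_at_open eventually_nhds) 
    then show ?thesis by (rule eventually_mono) (rule expand[symmetric])
  qed
  ultimately have "((\<lambda>s. df (w s) (c s)) has_vector_derivative (df w' (c 0) + ddf (w 0) c')) (at 0)"
    by (rule has_vector_derivative_cong_nhds)
  then show ?thesis unfolding ddf_def df_def[abs_def] .
qed

locale nbody_frame = eigenframe m u v0
  for m :: "'n::{finite,linorder} disp" and u :: "'d::finite \<Rightarrow> 'n disp" and v0 +
  fixes G :: real
begin

text \<open>The difference \<open>e\<^sub>i - e\<^sub>j\<close> of standard basis vectors, an element of \<open>Dstar\<close>.\<close>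

definition edge :: "'n \<Rightarrow> 'n \<Rightarrow> 'n disp" where
  "edge i j = axis i 1 - axis j 1"

lemma mdot_edge: "mdot m \<xi> (edge i j) = \<xi> $ i / m $ i - \<xi> $ j / m $ j"
  by (simp add: edge_def mdot_simps mdot_axis)

lemma deriv_Phi:
  assumes "0 < s"
  shows "(Phi G has_real_derivative (- (G / 2) * s powr (- 3 / 2))) (at s)"
    and "deriv (Phi G) s = - (G / 2) * s powr (- 3 / 2)"
proof -
  show "(Phi G has_real_derivative (- (G / 2) * s powr (- 3 / 2))) (at s)"
    unfolding Phi_def[abs_def] using assms by (auto intro!: derivative_eq_intros simp: powr_diff field_simps)
  then show "deriv (Phi G) s = - (G / 2) * s powr (- 3 / 2)" by (rule DERIV_imp_deriv)
qed

definition pairs :: "('n \<times> 'n) set" where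
  "pairs = {p. fst p < snd p}"

lemma pairs_eq: "{(i, j). i < j} = pairs"
  by (auto simp: pairs_def)

abbreviation dist2 :: "'n endo \<Rightarrow> 'n \<times> 'n \<Rightarrow> real" where
  "dist2 B p \<equiv> sqdist m B (fst p) (snd p)"

lemma dist2_eq: "dist2 B p = mdot m (B *v edge (fst p) (snd p)) (edge (fst p) (snd p))"
  by (simp add: sqdist_def edge_def)

abbreviation WC :: "'n endo \<Rightarrow> 'n endo" where
  "WC \<equiv> WC_inertia m G"

text \<open>In terms of rank one projections, \<open>A = \<Sum> \<phi>(s\<^sub>i\<^sub>j) m\<^sub>i m\<^sub>j \<langle>\<cdot>, e\<^sub>i - e\<^sub>j\<rangle> (e\<^sub>i - e\<^sub>j)\<close>.\<close>

lemma WC_eq: "WC B = (\<Sum>p\<in>pairs. (deriv (Phi G) (dist2 B p) * m $ fst p * m $ snd p) *\<^sub>R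
    proj m (edge (fst p) (snd p)))" (is "_ = ?A")
proof -
  have "(\<lambda>\<xi>. \<Sum>(i, j) | i < j. (deriv (Phi G) (sqdist m B i j) * (m $ j * \<xi> $ i - m $ i * \<xi> $ j)) *\<^sub>R
      (axis i 1 - axis j 1)) = (\<lambda>\<xi>. ?A *v \<xi>)"
  proof
    fix \<xi>
    show "(\<Sum>(i, j) | i < j. (deriv (Phi G) (sqdist m B i j) * (m $ j * \<xi> $ i - m $ i * \<xi> $ j)) *\<^sub>R
      (axis i 1 - axis j 1)) = ?A *v \<xi>"
      unfolding mv_simps proj_mult_vec mdot_edge pairs_eq case_prod_beta
    proof (intro sum.cong refl)
      fix p :: "'n \<times> 'n"
      have "d * (m $ snd p * \<xi> $ fst p - m $ fst p * \<xi> $ snd p) =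
          d * m $ fst p * m $ snd p * (\<xi> $ fst p / m $ fst p - \<xi> $ snd p / m $ snd p)" for d
        by (simp add: field_simps)
      then show "(deriv (Phi G) (dist2 B p) * (m $ snd p * \<xi> $ fst p - m $ fst p * \<xi> $ snd p)) *\<^sub>R
          (axis (fst p) 1 - axis (snd p) 1) =
          (deriv (Phi G) (dist2 B p) * m $ fst p * m $ snd p) *\<^sub>R
          (\<xi> $ fst p / m $ fst p - \<xi> $ snd p / m $ snd p) *\<^sub>R edge (fst p) (snd p)"
        by (simp only: scaleR_scaleR edge_def)
    qed
  qed
  then show ?thesis unfolding WC_inertia_def wintner_conley_def by simp
qed

lemma WC_sym: "WC B \<in> sym_endo m"
  unfolding WC_eq
proof (intro subspace_sum[OF subspace_sym_endo] subspace_scale[OF subspace_sym_endo])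
  fix p :: "'n \<times> 'n"
  have "mdot m m (edge (fst p) (snd p)) = 0" by (simp add: mdot_edge)
  then show "proj m (edge (fst p) (snd p)) \<in> sym_endo m"
    using mdot_commute[of m] by (simp add: sym_endo_iff selfadjoint_def proj_mult_vec mdot_simps)
qed

text \<open>The open set of non-collision endomorphisms, on which the potential is smooth.\<close>

definition \<Omega> :: "'n endo set" where
  "\<Omega> = {B. \<forall>i j. i \<noteq> j \<longrightarrow> 0 < sqdist m B i j}"

lemma bounded_linear_sqdist: "bounded_linear (\<lambda>B. sqdist m B i j)"
  by (rule bounded_linear_of_linear) (auto intro!: linearI simp: sqdist_def mv_simps mdot_simps right_diff_distrib)

lemma open_\<Omega>: "open \<Omega>"
proof -
  have "\<Omega> = (\<Inter>i. \<Inter>j\<in>- {i}. {B. 0 < sqdist m B i j})" by (auto simp: \<Omega>_def)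
  moreover have "open \<dots>"
    by (intro open_INT ballI open_Collect_less continuous_intros
        linear_continuous_on[OF bounded_linear_sqdist]) auto
  ultimately show ?thesis by simp
qed

lemma \<Omega>_dist2: "B \<in> \<Omega> \<Longrightarrow> p \<in> pairs \<Longrightarrow> 0 < dist2 B p"
  by (auto simp: \<Omega>_def pairs_def)

lemma Cinf_powr_dist2:
  assumes p: "p \<in> pairs" shows "Cinf \<Omega> (\<lambda>B. c * dist2 B p powr a)"
  by (rule Cinf_compose[OF Cinf_bounded_linear[OF open_\<Omega> bounded_linear_sqdist] Cinf_powr])
    (use p \<Omega>_dist2 in auto)

lemma Cinf_WC: "Cinf \<Omega> WC"
proof -
  have "Cinf \<Omega> (\<lambda>B. \<Sum>p\<in>pairs. (- (G / 2) * m $ fst p * m $ snd p * dist2 B p powr (- 3 / 2)) *\<^sub>R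
      proj m (edge (fst p) (snd p)))"
    by (rule Cinf_sum[OF open_\<Omega> Cinf_bilinear[OF bounded_bilinear_scaleR Cinf_powr_dist2 Cinf_const[OF open_\<Omega>]]])
  then show ?thesis
    by (rule Cinf_cong) (auto simp: WC_eq deriv_Phi(2)[OF \<Omega>_dist2] intro!: sum.cong)
qed

lemma potential_eq: "potential m G B = (\<Sum>p\<in>pairs. m $ fst p * m $ snd p * Phi G (dist2 B p))"
  unfolding potential_def pairs_eq by (simp add: case_prod_beta)

lemma Cinf_potential: "Cinf \<Omega> (potential m G)"
proof -
  have "Cinf \<Omega> (\<lambda>B. \<Sum>p\<in>pairs. m $ fst p * m $ snd p * G * dist2 B p powr (- 1 / 2))"
    by (rule Cinf_sum[OF open_\<Omega> Cinf_powr_dist2])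
  then show ?thesis
    by (rule Cinf_cong) (simp add: potential_eq Phi_def mult.assoc)
qed

lemma potential_has_derivative:
  assumes B: "B \<in> \<Omega>"
  shows "(potential m G has_derivative (\<lambda>V. trace (WC B ** V))) (at B)"
proof -
  have 1: "((\<lambda>B. Phi G (dist2 B p)) has_derivative (\<lambda>V. deriv (Phi G) (dist2 B p) * dist2 V p)) (at B)"
    if "p \<in> pairs" for p
    using has_derivative_compose[OF bounded_linear_imp_has_derivative[OF bounded_linear_sqdist]
        deriv_Phi(1)[OF \<Omega>_dist2[OF B that], unfolded has_field_derivative_def]]
      deriv_Phi(2)[OF \<Omega>_dist2[OF B that]] by simp
  have "(potential m G has_derivative
      (\<lambda>V. \<Sum>p\<in>pairs. m $ fst p * m $ snd p * (deriv (Phi G) (dist2 B p) * dist2 V p))) (at B)"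
    unfolding potential_eq[abs_def]
    by (rule has_derivative_sum[OF has_derivative_mult_right[OF 1]])
  moreover have "(\<Sum>p\<in>pairs. m $ fst p * m $ snd p * (deriv (Phi G) (dist2 B p) * dist2 V p)) =
      trace (WC B ** V)" for V
  proof -
    have "trace (c *\<^sub>R A) = c * trace A" for c and A :: "'n endo"
      by (simp add: trace_def sum_distrib_left)
    then show ?thesis
      by (simp add: WC_eq mm_simps trace_sum trace_proj_mult dist2_eq mult_ac)
  qed
  ultimately show ?thesis by simp
qed

text \<open>The Wintner--Conley endomorphism of \<open>spectral_chart H\<close>, rotated back to the fixed frame.\<close>

definition pulled_WC :: "'n endo \<Rightarrow> 'n endo" where
  "pulled_WC H = rot_inv H ** WC (spectral_chart H) ** rot H"

text \<open>The off-diagonal part of \<open>pulled_WC H\<close>. For symmetric \<open>H\<close> with vanishing kernel block and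
  generic spectrum, it is \<open>0\<close> exactly when \<open>spectral_chart H\<close> is balanced.\<close>

definition balance_defect :: "'n endo \<Rightarrow> 'n endo" where
  "balance_defect H = pulled_WC H - diag_part (pulled_WC H)"

lemma pulled_WC_sym: "pulled_WC H \<in> sym_endo m"
  unfolding pulled_WC_def by (rule conj_sym'[OF WC_sym])

lemma balance_defect_sym: "balance_defect H \<in> sym_endo m"
  unfolding balance_defect_def by (intro subspace_diff[OF subspace_sym_endo] pulled_WC_sym diag_part_sym)

lemma diag_part_balance_defect: "diag_part (balance_defect H) = 0"
  by (simp add: balance_defect_def linear_diff[OF linear_diag_part] diag_part_diag_part)

lemma open_spectral_chart_\<Omega>: "open (spectral_chart -` \<Omega>)"
  using continuous_open_preimage[OF Cinf_continuous_on[OF Cinf_spectral_chart] open_UNIV open_\<Omega>] by simp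

lemma Cinf_balance_defect: "Cinf (spectral_chart -` \<Omega>) balance_defect"
proof -
  note sub = Cinf_subset[OF _ open_spectral_chart_\<Omega> subset_UNIV]
  have "Cinf (spectral_chart -` \<Omega>) (\<lambda>H. WC (spectral_chart H))"
    by (rule Cinf_compose[OF sub[OF Cinf_spectral_chart] Cinf_WC]) auto
  from Cinf_bilinear[OF bounded_bilinear_matrix_mult Cinf_bilinear[OF bounded_bilinear_matrix_mult
        sub[OF Cinf_rot_inv] this] sub[OF Cinf_rot]]
  have "Cinf (spectral_chart -` \<Omega>) pulled_WC" unfolding pulled_WC_def .
  from Cinf_diff[OF this Cinf_linear_compose[OF bounded_linear_diag_part this]]
  show ?thesis unfolding balance_defect_def .
qed

end

section \<open>Balance equation and Hessian of the restricted potential\<close>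

lemma isCont_eventually_in_open:
  assumes "isCont c x" "open U" "c x \<in> U"
  shows "\<forall>\<^sub>F s in nhds x. c s \<in> U"
  using assms topological_tendstoD[of c "c x" "at x" U]
  by (simp add: isCont_def eventually_nhds_conv_at)

lemma eventually_at_0_scaleR_in_open:
  fixes p v :: "'a::real_normed_vector"
  assumes "open U" "p \<in> U"
  shows "\<forall>\<^sub>F s in nhds (0::real). p + s *\<^sub>R v \<in> U"
  by (rule isCont_eventually_in_open[where c = "\<lambda>s. p + s *\<^sub>R v"]) (use assms in auto)

lemma Cinf_comp_has_vector_derivative:
  assumes f: "Cinf U f" and c: "(c has_vector_derivative c') (at s)" "c s \<in> U"
  shows "((\<lambda>s. f (c s)) has_vector_derivative frechet_derivative f (at (c s)) c') (at s)"
  using has_derivative_compose[OF c(1)[unfolded has_vector_derivative_def] Cinf_has_derivative[OF f c(2)]]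
    linear_cmul[OF Cinf_linear_derivative[OF f c(2)]]
  by (simp add: has_vector_derivative_def)

lemma has_vector_derivative_line: "((\<lambda>s. p + s *\<^sub>R v) has_vector_derivative v) (at s)"
  unfolding has_vector_derivative_def by (auto intro!: derivative_eq_intros)

context nbody_frame
begin

lemma spectral_chart_scaleR_has_vector_derivative: "((\<lambda>s. spectral_chart (s *\<^sub>R y)) has_vector_derivative y) (at 0)"
  using Cinf_comp_has_vector_derivative[OF Cinf_spectral_chart has_vector_derivative_line[of 0 y 0] UNIV_I]
    frechet_derivativeI[OF spectral_chart_has_derivative] by simp

text \<open>The tangent space at \<open>diag v0\<close> of the isospectral manifold: the symmetric endomorphisms without block-diagonal
  part.\<close>

definition tangent :: "'n endo set" where
  "tangent = {y \<in> sym_endo m. diag_part y = 0}"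

lemma subspace_tangent: "subspace tangent"
  using subspace_sym_endo
  by (auto simp: tangent_def subspace_def linear_0[OF linear_diag_part] linear_add[OF linear_diag_part] linear_cmul[OF linear_diag_part])

lemma spectral_chart_tangent: "y \<in> tangent \<Longrightarrow> spectral_chart y = rot y ** diag v0 ** rot_inv y"
  by (simp add: tangent_def spectral_chart_eq)

text \<open>The endomorphisms \<open>Q y Q\<inverse>\<close>, with \<open>y\<close> in \<open>tangent\<close>, are tangent to the isospectral
  manifold at \<open>spectral_chart H\<close>, being the velocities of the isospectral curves
  \<open>s \<mapsto> Q (spectral_chart (s y)) Q\<inverse>\<close>.\<close>

lemma chart_derivative_tangent:
  assumes chart: "slice_chart (isospectral m (diag v0)) (diag v0) L U V f g"
    and fC: "Cinf U f" and H: "H \<in> tangent" "spectral_chart H \<in> U" and y: "y \<in> tangent"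
  shows "frechet_derivative f (at (spectral_chart H)) (rot H ** y ** rot_inv H) \<in> L"
proof -
  have L: "subspace L" and im: "f ` (U \<inter> isospectral m (diag v0)) = V \<inter> L"
    using chart by (auto simp: slice_chart_def)
  define c where "c s = rot H ** spectral_chart (s *\<^sub>R y) ** rot_inv H" for s
  have "bounded_linear (\<lambda>N. rot H ** N ** rot_inv H)"
    by (rule bounded_linear_of_linear) (auto intro!: linearI simp: mm_simps)
  from bounded_linear.has_vector_derivative[OF this spectral_chart_scaleR_has_vector_derivative]
  have c: "(c has_vector_derivative rot H ** y ** rot_inv H) (at 0)" unfolding c_def .
  have c0: "c 0 = spectral_chart H" by (simp add: c_def spectral_chart_0 spectral_chart_tangent H)
  have iso: "c s \<in> isospectral m (diag v0)" for s
    unfolding c_def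
    using subspace_scale[OF subspace_tangent y] by (simp add: spectral_chart_tangent conj_isospectral conj_isospectral')
  have inL: "f (c s) \<in> L" if "c s \<in> U" for s using im iso[of s] that by blast
  have "frechet_derivative f (at (c 0)) (rot H ** y ** rot_inv H) \<in> L"
  proof (rule has_vector_derivative_subspace[OF L])
    show "((\<lambda>s. f (c s)) has_vector_derivative frechet_derivative f (at (c 0)) (rot H ** y ** rot_inv H)) (at 0)"
      by (rule Cinf_comp_has_vector_derivative[OF fC c]) (simp add: c0 H)
    have "\<forall>\<^sub>F s in nhds 0. c s \<in> U"
      by (rule isCont_eventually_in_open[OF has_vector_derivative_continuous[OF c] Cinf_open[OF fC]])
        (simp add: c0 H)
    then have "\<forall>\<^sub>F s in nhds 0. f (c s) \<in> L" by (rule eventually_mono) (rule inL)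
    then show "\<forall>\<^sub>F s in at 0. f (c s) \<in> L" "f (c 0) \<in> L"
      by (auto simp: eventually_nhds_conv_at)
  qed
  then show ?thesis by (simp add: c0)
qed

text \<open>Conversely, every velocity of an isospectral curve at \<open>diag v0\<close> lies in \<open>tangent\<close>, since in the
  coordinates given by \<open>spectral_chart\<close> the curve has no block-diagonal part.\<close>

lemma chart_inverse_derivative_tangent:
  assumes chart: "slice_chart (isospectral m (diag v0)) (diag v0) L U V f g"
    and gC: "Cinf V g" and v: "v \<in> L"
  shows "frechet_derivative g (at (f (diag v0))) v \<in> tangent"
proof -
  define q0 where "q0 = f (diag v0)"
  have L: "subspace L" and U: "open U" "diag v0 \<in> U" and V: "open V"
    and im: "f ` (U \<inter> isospectral m (diag v0)) = V \<inter> L"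
    and gf: "\<And>p. p \<in> U \<Longrightarrow> g (f p) = p"
    using chart by (auto simp: slice_chart_def diffeomorphism_def)
  have iso0: "diag v0 \<in> isospectral m (diag v0)" by (simp add: isospectral_def diag_sym)
  have q0: "q0 \<in> V" "q0 \<in> L" using im U iso0 unfolding q0_def by blast+
  have g0: "g q0 = diag v0" unfolding q0_def by (rule gf[OF U(2)])
  have giso: "g q \<in> isospectral m (diag v0)" if "q \<in> V" "q \<in> L" for q
  proof -
    have "q \<in> f ` (U \<inter> isospectral m (diag v0))" using im that by blast
    then show ?thesis using gf by auto
  qed
  define c where "c s = g (q0 + s *\<^sub>R v)" for s :: real
  define c' where "c' = frechet_derivative g (at q0) v"
  have c: "(c has_vector_derivative c') (at 0)"
    using Cinf_comp_has_vector_derivative[OF gC has_vector_derivative_line[of q0 v 0]] q0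
    by (simp add: c_def[abs_def] c'_def)
  have c0: "c 0 = diag v0" by (simp add: c_def g0)
  have "\<forall>\<^sub>F s in nhds 0. q0 + s *\<^sub>R v \<in> V" by (rule eventually_at_0_scaleR_in_open[OF V q0(1)])
  then have ev: "\<forall>\<^sub>F s in nhds 0. c s \<in> isospectral m (diag v0)"
    by (rule eventually_mono)
      (auto simp: c_def intro!: giso subspace_add[OF L q0(2)] subspace_scale[OF L v])
  obtain U1 V1 S where S: "open U1" "0 \<in> U1" "Cinf V1 S" "spectral_chart ` U1 = V1" "S ` V1 = U1"
    "\<And>H. H \<in> U1 \<Longrightarrow> S (spectral_chart H) = H" "\<And>B. B \<in> V1 \<Longrightarrow> spectral_chart (S B) = B"
    "(S has_derivative (\<lambda>Z. Z)) (at (diag v0))" "diag v0 \<in> V1" "S (diag v0) = 0"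
    by (rule spectral_chart_local_inverse) (rule that)
  have "c' \<in> sym_endo m"
  proof (rule has_vector_derivative_subspace[OF subspace_sym_endo c])
    have "\<forall>\<^sub>F s in nhds 0. c s \<in> sym_endo m"
      using ev by (rule eventually_mono) (simp add: isospectral_def)
    then show "\<forall>\<^sub>F s in at 0. c s \<in> sym_endo m" "c 0 \<in> sym_endo m"
      by (auto simp: eventually_nhds_conv_at)
  qed
  moreover have "diag_part c' = 0"
  proof -
    have Sc: "((\<lambda>s. S (c s)) has_vector_derivative c') (at 0)"
      using Cinf_comp_has_vector_derivative[OF S(3) c] frechet_derivativeI[OF S(8)] S(9) by (simp add: c0)
    have D: "((\<lambda>s. diag_part (S (c s))) has_vector_derivative diag_part c') (at 0)"
      by (rule bounded_linear.has_vector_derivative[OF bounded_linear_diag_part Sc])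
    have ev1: "\<forall>\<^sub>F s in nhds 0. c s \<in> V1"
      by (rule isCont_eventually_in_open[OF has_vector_derivative_continuous[OF c] Cinf_open[OF S(3)]])
        (simp add: c0 S)
    have "((\<lambda>s. v0 + diag_entries (S (c s))) has_vector_derivative (0 + diag_entries c')) (at 0)"
      by (rule has_vector_derivative_add[OF has_vector_derivative_const
            bounded_linear.has_vector_derivative[OF bounded_linear_diag_entries Sc]])
    then have "isCont (\<lambda>s. v0 + diag_entries (S (c s))) 0" by (rule has_vector_derivative_continuous)
    then have ev2: "\<forall>\<^sub>F s in nhds 0. v0 + diag_entries (S (c s)) \<in> generic"
      by (rule isCont_eventually_in_open[OF _ open_generic])
        (simp add: c0 S v0_generic linear_0[OF linear_diag_entries])
    from ev ev1 ev2 have "\<forall>\<^sub>F s in nhds 0. diag_part (S (c s)) = 0"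
    proof eventually_elim
      case (elim s)
      have SgS: "spectral_chart (S (c s)) = c s" by (rule S(7)[OF elim(2)])
      have sym: "S (c s) \<in> sym_endo m"
        using elim(1) spectral_chart_sym_iff[of "S (c s)"] by (simp add: SgS isospectral_def)
      show ?case
        by (rule isospectral_imp_diag_part_0[OF sym elim(3), of "S (c s)"])
          (use elim(1) SgS spectral_chart_eq[OF sym] in simp)
    qed
    from has_vector_derivative_cong_nhds[OF D this] show ?thesis
      using has_vector_derivative_const by (rule vector_derivative_unique_at)
  qed
  ultimately show ?thesis by (simp add: tangent_def c'_def q0_def)
qed

text \<open>Let \<open>k\<close> be the potential read in a chart \<open>f\<close>, with inverse \<open>g\<close>, flattening the isospectral manifold to \<open>L\<close>.
  Differentiating \<open>trace (balance_defect (s Z) y) = Dk (w s)\<close> at \<open>s = 0\<close>, where \<open>w s\<close> in \<open>L\<close> is the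
  image under \<open>f\<close> of the tangent vector \<open>Q y Q\<inverse>\<close>, gives the Hessian of \<open>k\<close> at \<open>Df Z\<close> and \<open>Df y\<close>: the term
  \<open>Dk (w' 0)\<close> vanishes because the point is critical along \<open>L\<close>. So a direction \<open>Z\<close> in which the defect does
  not vary is in the kernel of the Hessian.\<close>

lemma balance_defect_derivative_nonzero:
  assumes nd: "nondegenerate_critical_point_on (potential m G) (isospectral m (diag v0)) (diag v0)"
    and B0: "diag v0 \<in> \<Omega>"
    and Z: "Z \<in> tangent" and Mt': "((\<lambda>s. balance_defect (s *\<^sub>R Z)) has_vector_derivative 0) (at 0)"
  shows "Z = 0"
proof -
  obtain L U V f g where chart: "slice_chart (isospectral m (diag v0)) (diag v0) L U V f g"
    and crit: "\<And>v. v \<in> L \<Longrightarrow> frechet_derivative (potential m G \<circ> g) (at (f (diag v0))) v = 0"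
    and nondeg: "\<And>v. v \<in> L \<Longrightarrow> (\<And>w. w \<in> L \<Longrightarrow> hessian (potential m G \<circ> g) (f (diag v0)) v w = 0) \<Longrightarrow> v = 0"
    using nd unfolding nondegenerate_critical_point_on_def by blast
  have L: "subspace L" and U: "open U" "diag v0 \<in> U" and V: "open V"
    and sm: "smooth_on U f" "smooth_on V g" and fU: "f ` U = V"
    and gf: "\<And>p. p \<in> U \<Longrightarrow> g (f p) = p" and fg: "\<And>q. q \<in> V \<Longrightarrow> f (g q) = q"
    using chart by (auto simp: slice_chart_def diffeomorphism_def)
  have fC: "Cinf U f" and gC: "Cinf V g"
    by (rule smooth_on_imp_Cinf[OF U(1) sm(1)], rule smooth_on_imp_Cinf[OF V sm(2)])
  define q0 where "q0 = f (diag v0)"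
  have q0: "q0 \<in> V" "g q0 = diag v0" using fU U(2) gf unfolding q0_def by auto
  define V' where "V' = V \<inter> g -` \<Omega>"
  have V': "open V'" unfolding V'_def
    by (rule continuous_open_preimage[OF Cinf_continuous_on[OF gC] V open_\<Omega>])
  define k where "k = potential m G \<circ> g"
  have kC: "Cinf V' k"
    unfolding k_def comp_def
    by (rule Cinf_compose[OF Cinf_subset[OF gC V'] Cinf_potential]) (auto simp: V'_def)
  have q0V': "q0 \<in> V'" using q0 B0 by (simp add: V'_def)
  define A where "A = frechet_derivative f (at (diag v0))"
  define C where "C = frechet_derivative g (at q0)"
  have A: "(f has_derivative A) (at (diag v0))" unfolding A_def by (rule Cinf_has_derivative[OF fC U(2)])
  have C: "(g has_derivative C) (at q0)" unfolding C_def by (rule Cinf_has_derivative[OF gC q0(1)])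
  have CA: "C (A z) = z" for z
  proof -
    have "((\<lambda>B. g (f B)) has_derivative (\<lambda>z. C (A z))) (at (diag v0))"
      using has_derivative_compose[OF A, of g C] C by (simp add: q0_def)
    moreover have "((\<lambda>B. g (f B)) has_derivative (\<lambda>z. z)) (at (diag v0))"
      by (rule has_derivative_transform_within_open[OF has_derivative_ident U]) (rule gf[symmetric])
    ultimately show ?thesis by (rule fun_cong[OF has_derivative_unique])
  qed
  have AC: "A (C z) = z" for z
  proof -
    have "((\<lambda>q. f (g q)) has_derivative (\<lambda>z. A (C z))) (at q0)"
      using has_derivative_compose[OF C, of f A] A by (simp add: q0)
    moreover have "((\<lambda>q. f (g q)) has_derivative (\<lambda>z. z)) (at q0)"
      by (rule has_derivative_transform_within_open[OF has_derivative_ident V q0(1)]) (rule fg[symmetric])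
    ultimately show ?thesis by (rule fun_cong[OF has_derivative_unique])
  qed
  have AT: "A y \<in> L" if "y \<in> tangent" for y
    using chart_derivative_tangent[OF chart fC _ _ that, of 0] U(2) subspace_0[OF subspace_tangent]
    by (simp add: spectral_chart_0 rot_0 rot_inv_0 A_def)
  have CT: "C v \<in> tangent" if "v \<in> L" for v
    unfolding C_def q0_def by (rule chart_inverse_derivative_tangent[OF chart gC that])
  have hess: "hessian k q0 (A Z) (A y) = 0" if y: "y \<in> tangent" for y
  proof -
    define B where "B s = spectral_chart (s *\<^sub>R Z)" for s
    define Vy where "Vy s = rot (s *\<^sub>R Z) ** y ** rot_inv (s *\<^sub>R Z)" for s
    define w where "w s = frechet_derivative f (at (B s)) (Vy s)" for s
    have B: "(B has_vector_derivative Z) (at 0)"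
      unfolding B_def[abs_def] by (rule spectral_chart_scaleR_has_vector_derivative)
    have B_0: "B 0 = diag v0" by (simp add: B_def spectral_chart_0)
    have sZ: "((\<lambda>s. s *\<^sub>R Z) has_vector_derivative Z) (at 0)"
      using has_vector_derivative_line[of 0 Z 0] by simp
    have VyC: "Cinf UNIV (\<lambda>H. rot H ** y ** rot_inv H)"
      by (rule Cinf_bilinear[OF bounded_bilinear_matrix_mult Cinf_bilinear[OF bounded_bilinear_matrix_mult
            Cinf_rot Cinf_const[OF open_UNIV]] Cinf_rot_inv])
    define Vy' where "Vy' = frechet_derivative (\<lambda>H. rot H ** y ** rot_inv H) (at 0) Z"
    have Vy: "(Vy has_vector_derivative Vy') (at 0)"
      using Cinf_comp_has_vector_derivative[OF VyC sZ UNIV_I] unfolding Vy_def[abs_def] Vy'_def by simp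
    have Vy_0: "Vy 0 = y" by (simp add: Vy_def rot_0 rot_inv_0)
    obtain w' where w: "(w has_vector_derivative w') (at 0)"
      using frechet_derivative_along_curve[OF fC B _ Vy] U(2) B_0 unfolding w_def[abs_def] by auto
    have w_0: "w 0 = A y" by (simp add: w_def B_0 Vy_0 A_def)
    have evU: "\<forall>\<^sub>F s in nhds 0. B s \<in> U \<inter> \<Omega>"
      by (rule isCont_eventually_in_open[OF has_vector_derivative_continuous[OF B] open_Int[OF U(1) open_\<Omega>]])
        (simp add: B_0 U B0)
    have wL: "w s \<in> L" if "B s \<in> U" for s
      unfolding w_def B_def Vy_def
      by (rule chart_derivative_tangent[OF chart fC subspace_scale[OF subspace_tangent Z] _ y])
        (use that in \<open>simp add: B_def\<close>)
    have w'L: "w' \<in> L"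
    proof (rule has_vector_derivative_subspace[OF L w])
      have "\<forall>\<^sub>F s in nhds 0. w s \<in> L"
        using evU by (rule eventually_mono) (simp add: wL)
      then show "\<forall>\<^sub>F s in at 0. w s \<in> L" "w 0 \<in> L"
        by (auto simp: eventually_nhds_conv_at)
    qed
    define q where "q s = f (B s)" for s
    have q: "(q has_vector_derivative A Z) (at 0)"
      using Cinf_comp_has_vector_derivative[OF fC B] U(2) unfolding q_def[abs_def] by (simp add: B_0 A_def)
    have q_0: "q 0 = q0" by (simp add: q_def B_0 q0_def)
    \<comment> \<open>The derivative of the same function of \<open>s\<close>, computed by the chain rule (\<open>D1\<close>) and by the trace
      formula (\<open>D2\<close>).\<close>
    have D1: "((\<lambda>s. frechet_derivative k (at (q s)) (w s)) has_vector_derivative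
        (frechet_derivative k (at q0) w' + hessian k q0 (A Z) (A y))) (at 0)"
      using frechet_derivative_along_curve[OF kC q _ w] by (simp add: q_0 q0V' w_0 hessian_def)
    have "frechet_derivative k (at q0) w' = 0" unfolding k_def q0_def by (rule crit[OF w'L])
    then have D1': "((\<lambda>s. frechet_derivative k (at (q s)) (w s)) has_vector_derivative
        hessian k q0 (A Z) (A y)) (at 0)" using D1 by simp
    have trace_linear: "bounded_linear (\<lambda>N. trace (N ** y))"
      by (rule bounded_linear_of_linear) (auto intro!: linearI simp: mm_simps trace_def sum.distrib sum_distrib_left)
    have D2: "((\<lambda>s. trace (balance_defect (s *\<^sub>R Z) ** y)) has_vector_derivative 0) (at 0)"
      using bounded_linear.has_vector_derivative[OF trace_linear Mt'] by (simp add: mm_simps trace_def)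
    from evU have "\<forall>\<^sub>F s in nhds 0. trace (balance_defect (s *\<^sub>R Z) ** y) = frechet_derivative k (at (q s)) (w s)"
    proof eventually_elim
      case (elim s)
      then have Bs: "B s \<in> U" "B s \<in> \<Omega>" by auto
      have qs: "q s \<in> V'" using Bs fU gf by (auto simp: q_def V'_def)
      have dk: "(k has_derivative frechet_derivative k (at (q s))) (at (f (B s)))"
        using Cinf_has_derivative[OF kC qs] by (simp add: q_def)
      have df: "(f has_derivative frechet_derivative f (at (B s))) (at (B s))"
        by (rule Cinf_has_derivative[OF fC Bs(1)])
      have "((\<lambda>x. k (f x)) has_derivative
          (\<lambda>z. frechet_derivative k (at (q s)) (frechet_derivative f (at (B s)) z))) (at (B s))"
        by (rule has_derivative_compose[OF df dk])
      moreover have "((\<lambda>x. k (f x)) has_derivative (\<lambda>z. trace (WC (B s) ** z))) (at (B s))"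
        by (rule has_derivative_transform_within_open[OF potential_has_derivative[OF Bs(2)] U(1) Bs(1)])
          (simp add: k_def gf)
      ultimately have "frechet_derivative k (at (q s)) (w s) = trace (WC (B s) ** Vy s)"
        unfolding w_def by (rule fun_cong[OF has_derivative_unique])
      also have "\<dots> = trace (WC (B s) ** rot (s *\<^sub>R Z) ** y ** rot_inv (s *\<^sub>R Z))"
        by (simp add: Vy_def matrix_mul_assoc)
      also have "\<dots> = trace (rot_inv (s *\<^sub>R Z) ** (WC (B s) ** rot (s *\<^sub>R Z) ** y))"
        by (rule trace_mul_sym)
      also have "\<dots> = trace (pulled_WC (s *\<^sub>R Z) ** y)"
        by (simp add: pulled_WC_def B_def matrix_mul_assoc)
      also have "\<dots> = trace (balance_defect (s *\<^sub>R Z) ** y) + trace (diag_part (pulled_WC (s *\<^sub>R Z)) ** y)"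
        by (simp add: balance_defect_def mm_simps flip: trace_add)
      also have "trace (diag_part (pulled_WC (s *\<^sub>R Z)) ** y) = 0"
        using y by (simp add: trace_diag_part tangent_def mm_simps) (simp add: trace_def)
      finally show ?case by simp
    qed
    from has_vector_derivative_cong_nhds[OF D2 this] D1'
    have "0 = hessian k q0 (A Z) (A y)" by (rule vector_derivative_unique_at)
    then show ?thesis by simp
  qed
  have "A Z = 0"
  proof (rule nondeg[OF AT[OF Z]])
    fix w assume w: "w \<in> L"
    show "hessian (potential m G \<circ> g) (f (diag v0)) (A Z) w = 0"
      using hess[OF CT[OF w]] unfolding AC k_def q0_def .
  qed
  then have "C (A Z) = C 0" by simp
  then show ?thesis using linear_0[OF has_derivative_linear[OF C]] by (simp add: CA)
qed

end

section \<open>Local structure of the balanced endomorphisms\<close>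

context nbody_frame
begin

text \<open>The balance defect completed by the spectral data; prescribing the value \<open>diag (v - v0)\<close> means prescribing
  the spectrum \<open>v\<close> and requiring balance.\<close>

definition balance_map :: "'n endo \<Rightarrow> 'n endo" where
  "balance_map H = balance_defect H + diag_part (sym_proj H) + (H - sym_proj H)"

lemma balance_map_eq: "H \<in> sym_endo m \<Longrightarrow> balance_map H = balance_defect H + diag_part H"
  by (simp add: balance_map_def sym_proj_eq)

lemma balance_map_sym_imp:
  assumes "balance_map H \<in> sym_endo m" shows "H \<in> sym_endo m"
proof -
  have "balance_defect H + diag_part (sym_proj H) \<in> sym_endo m"
    by (intro subspace_add[OF subspace_sym_endo] balance_defect_sym diag_part_sym sym_proj_sym)
  from subspace_diff[OF subspace_sym_endo assms this]
  have "H - sym_proj H \<in> sym_endo m" by (simp add: balance_map_def)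
  from subspace_add[OF subspace_sym_endo this sym_proj_sym[of H]] show ?thesis by simp
qed

lemma Cinf_balance_map: "Cinf (spectral_chart -` \<Omega>) balance_map"
proof -
  note sym_proj = Cinf_bounded_linear[OF open_spectral_chart_\<Omega> bounded_linear_sym_proj]
  from Cinf_add[OF Cinf_add[OF Cinf_balance_defect Cinf_linear_compose[OF bounded_linear_diag_part sym_proj]]
      Cinf_diff[OF Cinf_ident[OF open_spectral_chart_\<Omega>] sym_proj]]
  show ?thesis unfolding balance_map_def .
qed

lemma balance_map_derivative_injective:
  assumes nd: "nondegenerate_critical_point_on (potential m G) (isospectral m (diag v0)) (diag v0)"
    and B0: "diag v0 \<in> \<Omega>"
    and D: "(balance_map has_derivative D) (at 0)" and Z: "D Z = 0"
  shows "Z = 0"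
proof -
  have 0: "0 \<in> spectral_chart -` \<Omega>" using B0 by (simp add: spectral_chart_0)
  define Mt' where "Mt' = frechet_derivative balance_defect (at 0)"
  have Mt': "(balance_defect has_derivative Mt') (at 0)"
    unfolding Mt'_def by (rule Cinf_has_derivative[OF Cinf_balance_defect 0])
  note sym_proj = bounded_linear_imp_has_derivative[OF bounded_linear_sym_proj, of "at 0"]
  have "(balance_map has_derivative (\<lambda>Z. Mt' Z + diag_part (sym_proj Z) + (Z - sym_proj Z))) (at 0)"
    unfolding balance_map_def[abs_def]
    by (rule has_derivative_add[OF has_derivative_add[OF Mt' bounded_linear.has_derivative[OF bounded_linear_diag_part sym_proj]]
          has_derivative_diff[OF has_derivative_ident sym_proj]])
  from fun_cong[OF has_derivative_unique[OF this D], of Z] Z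
  have eq: "Mt' Z + diag_part (sym_proj Z) + (Z - sym_proj Z) = 0" by simp
  have "((\<lambda>H. sym_proj (balance_defect H)) has_derivative (\<lambda>Z. sym_proj (Mt' Z))) (at 0)"
    by (rule bounded_linear.has_derivative[OF bounded_linear_sym_proj Mt'])
  then have "(balance_defect has_derivative (\<lambda>Z. sym_proj (Mt' Z))) (at 0)" by (simp add: sym_proj_eq[OF balance_defect_sym])
  from fun_cong[OF has_derivative_unique[OF this Mt'], of Z] have prM: "sym_proj (Mt' Z) = Mt' Z" .
  have "((\<lambda>H. diag_part (balance_defect H)) has_derivative (\<lambda>Z. diag_part (Mt' Z))) (at 0)"
    by (rule bounded_linear.has_derivative[OF bounded_linear_diag_part Mt'])
  then have "((\<lambda>H. 0) has_derivative (\<lambda>Z. diag_part (Mt' Z))) (at 0)" by (simp add: diag_part_balance_defect)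
  from fun_cong[OF has_derivative_unique[OF this has_derivative_const], of Z] have dlM: "diag_part (Mt' Z) = 0" .
  have "sym_proj (Mt' Z + diag_part (sym_proj Z) + (Z - sym_proj Z)) = 0" by (simp add: eq linear_0[OF linear_sym_proj])
  then have 1: "Mt' Z + diag_part (sym_proj Z) = 0"
    by (simp add: linear_add[OF linear_sym_proj] linear_diff[OF linear_sym_proj] prM sym_proj_eq sym_proj_sym diag_part_sym)
  then have "sym_proj Z = Z" using eq by simp
  then have Zsym: "Z \<in> sym_endo m" using sym_proj_sym[of Z] by simp
  have "diag_part (Mt' Z + diag_part (sym_proj Z)) = 0" by (simp add: 1 linear_0[OF linear_diag_part])
  then have "diag_part Z = 0" by (simp add: linear_add[OF linear_diag_part] dlM diag_part_diag_part \<open>sym_proj Z = Z\<close>)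
  then have "Z \<in> tangent" "Mt' Z = 0"
    using 1 Zsym by (simp_all add: tangent_def \<open>sym_proj Z = Z\<close>)
  moreover have "((\<lambda>s. balance_defect (s *\<^sub>R Z)) has_vector_derivative Mt' Z) (at 0)"
    using Cinf_comp_has_vector_derivative[OF Cinf_balance_defect has_vector_derivative_line[of 0 Z 0]] 0
    by (simp add: Mt'_def)
  ultimately show ?thesis using balance_defect_derivative_nonzero[OF nd B0, of Z] by simp
qed

lemma conj_commutes_iff:
  assumes B: "B = rot H ** D ** rot_inv H"
  shows "A ** B = B ** A \<longleftrightarrow> (rot_inv H ** A ** rot H) ** D = D ** (rot_inv H ** A ** rot H)"
proof -
  have "rot H ** ((rot_inv H ** A ** rot H) ** D) ** rot_inv H = A ** B"
    by (simp add: B matrix_mul_assoc rot_rot_inv)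
  moreover have "rot H ** (D ** (rot_inv H ** A ** rot H)) ** rot_inv H = B ** A"
    by (simp add: B matrix_mul_assoc[symmetric] rot_rot_inv)
  ultimately show ?thesis by (metis conj_eq_iff)
qed

text \<open>Among the symmetric endomorphisms of rank \<open>CARD('d)\<close> in the neighbourhood \<open>W0\<close>, the balanced ones are the
  \<open>\<psi> v\<close>, one for each spectrum \<open>v\<close>. The map \<open>S\<close> inverts \<open>spectral_chart\<close>, and \<open>B \<mapsto> v0 + diag_entries (S B)\<close>
  reads off the spectrum.\<close>

theorem balanced_local_structure:
  assumes nd: "nondegenerate_critical_point_on (potential m G) (isospectral m (diag v0)) (diag v0)"
    and B0: "diag v0 \<in> \<Omega>" and comm: "WC (diag v0) ** diag v0 = diag v0 ** WC (diag v0)"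
  obtains V0 \<psi> W0 S where "v0 \<in> V0" "V0 \<subseteq> generic" "Cinf V0 \<psi>" "diag v0 \<in> W0" "W0 \<subseteq> \<Omega>" "Cinf W0 S"
    "S (diag v0) = 0" "\<psi> v0 = diag v0" "\<And>v. v \<in> V0 \<Longrightarrow> \<psi> v \<in> W0"
    "\<And>v. v \<in> V0 \<Longrightarrow> \<psi> v = rot (S (\<psi> v)) ** diag v ** rot_inv (S (\<psi> v))"
    "\<And>v. v \<in> V0 \<Longrightarrow> WC (\<psi> v) ** \<psi> v = \<psi> v ** WC (\<psi> v)"
    "\<And>v. v \<in> V0 \<Longrightarrow> v0 + diag_entries (S (\<psi> v)) = v"
    "\<And>B. \<lbrakk>B \<in> W0; B \<in> sym_endo m; dim (endo_image B) = CARD('d); WC B ** B = B ** WC B;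
       v0 + diag_entries (S B) \<in> V0\<rbrakk> \<Longrightarrow> \<psi> (v0 + diag_entries (S B)) = B"
proof -
  obtain U1 V1 S where S: "open U1" "0 \<in> U1" "Cinf V1 S" "spectral_chart ` U1 = V1" "S ` V1 = U1"
    "\<And>H. H \<in> U1 \<Longrightarrow> S (spectral_chart H) = H" "\<And>B. B \<in> V1 \<Longrightarrow> spectral_chart (S B) = B"
    "(S has_derivative (\<lambda>Z. Z)) (at (diag v0))" "diag v0 \<in> V1" "S (diag v0) = 0"
    by (rule spectral_chart_local_inverse) (rule that)
  have 0: "0 \<in> spectral_chart -` \<Omega>" using B0 by (simp add: spectral_chart_0)
  obtain U2 V2 T where T: "open U2" "U2 \<subseteq> spectral_chart -` \<Omega>" "0 \<in> U2" "Cinf V2 T" "balance_map ` U2 = V2" "T ` V2 = U2"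
    "\<And>H. H \<in> U2 \<Longrightarrow> T (balance_map H) = H" "\<And>K. K \<in> V2 \<Longrightarrow> balance_map (T K) = K"
  proof (rule smooth_inverse_function_theorem[OF Cinf_balance_map 0 Cinf_has_derivative[OF Cinf_balance_map 0]])
    show "v = 0" if "frechet_derivative balance_map (at 0) v = 0" for v
      by (rule balance_map_derivative_injective[OF nd B0 Cinf_has_derivative[OF Cinf_balance_map 0] that])
  qed (rule that)
  have dl0: "diag_part 0 = 0" and dg0: "diag 0 = 0" and beta0: "diag_entries 0 = 0"
    by (simp_all add: linear_0 linear_diag_part linear_diag linear_diag_entries)
  have "pulled_WC 0 = WC (diag v0)" by (simp add: pulled_WC_def rot_0 rot_inv_0 spectral_chart_0)
  then have "balance_defect 0 = 0" by (simp add: balance_defect_def diag_part_eq_of_commutes[OF separated_v0 comm])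
  then have Gm0: "balance_map 0 = 0" by (simp add: balance_map_eq subspace_0[OF subspace_sym_endo] dl0)
  have zV2: "0 \<in> V2" and T0: "T 0 = 0"
    using imageI[OF T(3), of balance_map] T(7)[OF T(3)] by (simp_all add: T(5) Gm0)
  define K where "K v = diag (v - v0)" for v
  have KC: "Cinf generic K"
    unfolding K_def
    by (rule Cinf_linear_compose[OF bounded_linear_diag Cinf_diff[OF Cinf_ident[OF open_generic] Cinf_const[OF open_generic]]])
  define V00 where "V00 = generic \<inter> K -` V2"
  have V00: "open V00" unfolding V00_def
    by (rule continuous_open_preimage[OF Cinf_continuous_on[OF KC] open_generic Cinf_open[OF T(4)]])
  have TKC: "Cinf V00 (\<lambda>v. T (K v))"
    by (rule Cinf_compose[OF Cinf_subset[OF KC V00] T(4)]) (auto simp: V00_def)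
  define V0 where "V0 = V00 \<inter> (\<lambda>v. T (K v)) -` U1"
  have V0: "open V0" unfolding V0_def
    by (rule continuous_open_preimage[OF Cinf_continuous_on[OF TKC] V00 S(1)])
  define \<psi> where "\<psi> v = spectral_chart (T (K v))" for v
  have \<psi>C: "Cinf V0 \<psi>"
    unfolding \<psi>_def
    by (rule Cinf_compose[OF Cinf_subset[OF TKC V0] Cinf_spectral_chart]) (auto simp: V0_def)
  define W1 where "W1 = V1 \<inter> S -` U2"
  have W1: "open W1" unfolding W1_def
    by (rule continuous_open_preimage[OF Cinf_continuous_on[OF S(3)] Cinf_open[OF S(3)] T(1)])
  define W0 where "W0 = W1 \<inter> \<Omega>"
  have W0: "open W0" unfolding W0_def by (rule open_Int[OF W1 open_\<Omega>])
  have K0: "K v0 = 0" by (simp add: K_def dg0)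
  have H: "T (K v) \<in> U1" "T (K v) \<in> U2" "balance_map (T (K v)) = K v" if "v \<in> V0" for v
    using that T(6) T(8) by (auto simp: V0_def V00_def)
  have Hsym: "T (K v) \<in> sym_endo m" if "v \<in> V0" for v
  proof (rule balance_map_sym_imp)
    have "K v \<in> sym_endo m" by (simp add: K_def diag_sym)
    then show "balance_map (T (K v)) \<in> sym_endo m" by (simp only: H(3)[OF that])
  qed
  have S\<psi>: "S (\<psi> v) = T (K v)" if "v \<in> V0" for v
    unfolding \<psi>_def by (rule S(6)[OF H(1)[OF that]])
  have dlH: "diag_part (T (K v)) = K v" if "v \<in> V0" for v
  proof -
    have "diag_part (balance_map (T (K v))) = diag_part (T (K v))"
      by (simp add: balance_map_eq[OF Hsym[OF that]] linear_add[OF linear_diag_part] diag_part_balance_defect diag_part_diag_part)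
    then show ?thesis by (simp add: H(3)[OF that]) (simp add: K_def diag_part_diag)
  qed
  have MtH: "balance_defect (T (K v)) = 0" if "v \<in> V0" for v
    using balance_map_eq[OF Hsym[OF that]] by (simp add: H(3)[OF that] dlH[OF that])
  have \<psi>_eq: "\<psi> v = rot (S (\<psi> v)) ** diag v ** rot_inv (S (\<psi> v))" if "v \<in> V0" for v
  proof -
    have "diag v0 + diag_part (T (K v)) = diag v"
      unfolding dlH[OF that] by (simp add: K_def linear_diff[OF linear_diag])
    then show ?thesis unfolding S\<psi>[OF that] by (simp add: \<psi>_def spectral_chart_eq[OF Hsym[OF that]])
  qed
  show ?thesis
  proof (rule that[of V0 \<psi> W0 S])
    show "v0 \<in> V0" by (simp add: V0_def V00_def v0_generic K0 zV2 T0 S)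
    show "V0 \<subseteq> generic" by (auto simp: V0_def V00_def)
    show "Cinf V0 \<psi>" by (rule \<psi>C)
    show "diag v0 \<in> W0" by (simp add: W0_def W1_def S B0 T)
    show "W0 \<subseteq> \<Omega>" by (simp add: W0_def)
    show "Cinf W0 S" by (rule Cinf_subset[OF S(3) W0]) (auto simp: W0_def W1_def)
    show "S (diag v0) = 0" by (rule S)
    show "\<psi> v0 = diag v0" by (simp add: \<psi>_def K0 T0 spectral_chart_0)
    fix v assume v: "v \<in> V0"
    have "\<psi> v \<in> V1" unfolding \<psi>_def using H(1)[OF v] S(4) by blast
    moreover have "\<psi> v \<in> \<Omega>" unfolding \<psi>_def using H(2)[OF v] T(2) by blast
    ultimately show "\<psi> v \<in> W0" by (simp add: W0_def W1_def S\<psi>[OF v] H(2)[OF v])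
    show "\<psi> v = rot (S (\<psi> v)) ** diag v ** rot_inv (S (\<psi> v))" by (rule \<psi>_eq[OF v])
    have "pulled_WC (T (K v)) = diag_part (pulled_WC (T (K v)))" using MtH[OF v] by (simp add: balance_defect_def)
    then have "pulled_WC (T (K v)) ** diag v = diag v ** pulled_WC (T (K v))" using diag_part_commutes by metis
    then show "WC (\<psi> v) ** \<psi> v = \<psi> v ** WC (\<psi> v)"
      unfolding conj_commutes_iff[OF \<psi>_eq[OF v]] S\<psi>[OF v] by (simp add: pulled_WC_def \<psi>_def)
    have "diag_entries (T (K v)) = v - v0"
      using diag_entries_diag_part[of "T (K v)"] by (simp add: dlH[OF v]) (simp add: K_def diag_entries_diag)
    then show "v0 + diag_entries (S (\<psi> v)) = v" by (simp add: S\<psi>[OF v])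
  next
    fix B assume B: "B \<in> W0" "B \<in> sym_endo m" "dim (endo_image B) = CARD('d)" "WC B ** B = B ** WC B"
      "v0 + diag_entries (S B) \<in> V0"
    define H where "H = S B"
    have SgH: "spectral_chart H = B" and HU2: "H \<in> U2" using B(1) S(7) by (auto simp: W0_def W1_def H_def)
    have Hs: "H \<in> sym_endo m" using B(2) spectral_chart_sym_iff[of H] by (simp add: SgH)
    have gen: "v0 + diag_entries H \<in> generic" using B(5) by (simp add: V0_def V00_def H_def)
    have B_eq: "B = rot H ** (diag v0 + diag_part H) ** rot_inv H" using spectral_chart_eq[OF Hs] by (simp add: SgH)
    have blk: "eproj None ** H ** eproj None = 0"
      by (rule rank_imp_block_0[OF Hs _ B(3)[unfolded B_eq]]) (use gen in \<open>simp add: generic_def\<close>)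
    have B_eq': "B = rot H ** diag (v0 + diag_entries H) ** rot_inv H" using B_eq by (simp add: diag_part_of_block_0[OF blk])
    have "pulled_WC H ** diag (v0 + diag_entries H) = diag (v0 + diag_entries H) ** pulled_WC H"
      using B(4) unfolding conj_commutes_iff[OF B_eq'] by (simp add: pulled_WC_def SgH)
    then have "balance_defect H = 0" by (simp add: balance_defect_def diag_part_eq_of_commutes[OF generic_separated[OF gen]])
    then have "balance_map H = K (v0 + diag_entries H)" by (simp add: balance_map_eq[OF Hs] K_def diag_part_eq_diag[OF blk])
    then have "T (K (v0 + diag_entries H)) = H" using T(7)[OF HU2] by simp
    then show "\<psi> (v0 + diag_entries (S B)) = B" by (simp add: \<psi>_def SgH flip: H_def)
  qed
qed

end

section \<open>Configurations and their inertia\<close>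

lemma dim_image_eq_of_same_kernel:
  fixes f :: "'a::euclidean_space \<Rightarrow> 'b::euclidean_space" and g :: "'a \<Rightarrow> 'c::euclidean_space"
  assumes f: "linear f" and g: "linear g" and W: "subspace W"
    and ker: "\<And>x. x \<in> W \<Longrightarrow> f x = 0 \<longleftrightarrow> g x = 0"
  shows "dim (f ` W) = dim (g ` W)"
proof -
  obtain h where h: "range h \<subseteq> W" "linear h" "\<forall>y\<in>f ` W. f (h y) = y"
    using linear_exists_right_inverse_on[OF f W] by auto
  have hW: "h y \<in> W" for y using h(1) by auto
  have gh: "g (h (f x)) = g x" if x: "x \<in> W" for x
  proof -
    have "f (h (f x) - x) = 0" using h(3) x by (simp add: linear_diff[OF f])
    then have "g (h (f x) - x) = 0" using ker[OF subspace_diff[OF W hW x]] by simp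
    then show ?thesis by (simp add: linear_diff[OF g])
  qed
  have "(g \<circ> h) ` (f ` W) = g ` W" by (auto simp: image_image gh)
  moreover have "inj_on (g \<circ> h) (span (f ` W))"
  proof -
    have sub: "span (f ` W) = f ` W" by (simp add: linear_subspace_image[OF f W] span_eq_iff)
    show ?thesis unfolding sub
    proof (rule inj_onI)
      fix y z assume y: "y \<in> f ` W" and z: "z \<in> f ` W" and e: "(g \<circ> h) y = (g \<circ> h) z"
      have "g (h y - h z) = 0" using e by (simp add: linear_diff[OF g])
      then have "f (h y - h z) = 0" using ker[OF subspace_diff[OF W hW hW]] by simp
      then show "y = z" using h(3) y z by (simp add: linear_diff[OF f])
    qed
  qed
  ultimately show ?thesis
    using dim_image_eq[OF linear_compose[OF h(2) g], of "f ` W"] by simp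
qed

lemma linear_config_map: "linear (config_map x)"
  by (rule linearI) (simp_all add: config_map_def scaleR_add_left sum.distrib scaleR_sum_right)

context masses
begin

lemma subset_Dstar_endo_image: "B \<in> sym_endo m \<Longrightarrow> endo_image B \<subseteq> Dstar"
  by (auto simp: endo_image_def sym_endo_Dstar)

lemma subspace_endo_image: "subspace (endo_image B)" for B :: "'n endo"
  unfolding endo_image_def by (rule linear_subspace_image[OF _ subspace_Dstar]) simp

lemma inertia_sym: "inertia m x \<in> sym_endo m"
  and inertia_inner: "\<xi> \<in> Dstar \<Longrightarrow> \<eta> \<in> Dstar \<Longrightarrow>
    mdot m (inertia m x *v \<xi>) \<eta> = config_map x \<xi> \<bullet> config_map x \<eta>"
  for x :: "'n \<Rightarrow> 'e::euclidean_space"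
  using theI'[OF inertia_unique_existence[of m x, OF m_pos]] by (simp_all add: inertia_def)

lemma inertia_eqI:
  fixes x :: "'n \<Rightarrow> 'e::euclidean_space"
  assumes "B \<in> sym_endo m"
    "\<And>\<xi> \<eta>. \<xi> \<in> Dstar \<Longrightarrow> \<eta> \<in> Dstar \<Longrightarrow> mdot m (B *v \<xi>) \<eta> = config_map x \<xi> \<bullet> config_map x \<eta>"
  shows "inertia m x = B"
  unfolding inertia_def
  by (rule the1_equality[OF inertia_unique_existence[of m x, OF m_pos]]) (use assms in simp)

lemma config_rank_eq: "config_rank x = dim (endo_image (inertia m x))"
  for x :: "'n \<Rightarrow> 'e::euclidean_space"
  unfolding config_rank_def endo_image_def
proof (rule dim_image_eq_of_same_kernel[OF linear_config_map _ subspace_Dstar])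
  fix \<xi> :: "'n disp" assume \<xi>: "\<xi> \<in> Dstar"
  show "config_map x \<xi> = 0 \<longleftrightarrow> inertia m x *v \<xi> = 0"
  proof
    assume "config_map x \<xi> = 0"
    then have "mdot m (inertia m x *v \<xi>) (inertia m x *v \<xi>) = 0"
      by (simp add: inertia_inner \<xi> sym_endo_Dstar[OF inertia_sym])
    then show "inertia m x *v \<xi> = 0" by (rule mdot_eq_0)
  next
    assume "inertia m x *v \<xi> = 0"
    then have "config_map x \<xi> \<bullet> config_map x \<xi> = 0"
      using inertia_inner[OF \<xi> \<xi>, of x] by (simp add: mdot_simps)
    then show "config_map x \<xi> = 0" by simp
  qed
qed simp

lemma noncollision_iff:
  "noncollision x \<longleftrightarrow> (\<forall>i j. i \<noteq> j \<longrightarrow> 0 < sqdist m (inertia m x) i j)"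
  for x :: "'n \<Rightarrow> 'e::euclidean_space"
  by (simp add: noncollision_def sqdist_inertia[OF m_pos])

lemma orthonormal_expansion:
  fixes w :: "'i::finite \<Rightarrow> 'n disp"
  assumes w: "\<And>i j. mdot m (w i) (w j) = (if i = j then 1 else 0)"
    and \<zeta>: "\<zeta> \<in> span (range w)"
  shows "\<zeta> = (\<Sum>i\<in>UNIV. mdot m \<zeta> (w i) *\<^sub>R w i)"
  using \<zeta>
proof (rule span_induct)
  show "subspace {\<zeta>. \<zeta> = (\<Sum>i\<in>UNIV. mdot m \<zeta> (w i) *\<^sub>R w i)}"
  proof (rule subspaceI, unfold mem_Collect_eq)
    fix c x assume x: "x = (\<Sum>i\<in>UNIV. mdot m x (w i) *\<^sub>R w i)"
    have "c *\<^sub>R x = c *\<^sub>R (\<Sum>i\<in>UNIV. mdot m x (w i) *\<^sub>R w i)" by (rule arg_cong[OF x])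
    also have "\<dots> = (\<Sum>i\<in>UNIV. mdot m (c *\<^sub>R x) (w i) *\<^sub>R w i)"
      by (simp add: mdot_simps scaleR_sum_right)
    finally show "c *\<^sub>R x = (\<Sum>i\<in>UNIV. mdot m (c *\<^sub>R x) (w i) *\<^sub>R w i)" .
  qed (simp_all add: mdot_simps scaleR_add_left sum.distrib)
qed (auto simp: w if_distrib[of "\<lambda>c. c *\<^sub>R _"] cong: if_cong)

lemma spectral_expansion:
  fixes w :: "'i::finite \<Rightarrow> 'n disp"
  assumes B: "B \<in> sym_endo m" and w: "orthonormal_basis_of m (endo_image B) w"
    and ev: "\<And>i. B *v w i = v i *\<^sub>R w i"
  shows "B *v \<xi> = (\<Sum>i\<in>UNIV. (v i * mdot m \<xi> (w i)) *\<^sub>R w i)"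
proof -
  obtain t where t: "\<xi> - t *\<^sub>R m \<in> Dstar" using decompose_Dstar by blast
  have "B *v \<xi> = B *v (\<xi> - t *\<^sub>R m)" using B by (simp add: mv_simps sym_endo_iff)
  also have "\<dots> \<in> endo_image B" unfolding endo_image_def using t by (rule imageI)
  also have "\<dots> = span (range w)" using w by (simp add: orthonormal_basis_of_def)
  finally have e: "B *v \<xi> = (\<Sum>i\<in>UNIV. mdot m (B *v \<xi>) (w i) *\<^sub>R w i)"
    by (intro orthonormal_expansion) (use w in \<open>simp_all add: orthonormal_basis_of_def\<close>)
  have c: "mdot m (B *v \<xi>) (w i) = v i * mdot m \<xi> (w i)" for i
    using B by (simp add: sym_endo_iff selfadjoint_def ev mdot_simps)
  show ?thesis by (subst e) (simp only: c)
qed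

text \<open>A positive endomorphism of rank at most the dimension of the ambient space is the inertia of a configuration:
  send the eigenvector \<open>w i\<close> to \<open>sqrt (v i)\<close> times the \<open>i\<close>-th vector of an orthonormal family.\<close>

lemma realization:
  fixes w :: "'i::finite \<Rightarrow> 'n disp"
  assumes B: "B \<in> sym_endo m" and w: "orthonormal_basis_of m (endo_image B) w"
    and ev: "\<And>i. B *v w i = v i *\<^sub>R w i" and pos: "\<And>i. 0 < v i"
    and card: "CARD('i) \<le> DIM('e::euclidean_space)"
  shows "\<exists>x :: 'n \<Rightarrow> 'e. inertia m x = B"
proof -
  obtain E :: "'i \<Rightarrow> 'e" where E: "range E \<subseteq> Basis" "inj E"
    using card_le_inj[of "UNIV :: 'i set" "Basis :: 'e set"] card by auto
  have EE: "E i \<bullet> E j = (if i = j then 1 else 0)" for i j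
    using E(1) by (simp add: inner_Basis range_subsetD inj_eq[OF E(2)])
  define x where "x k = (\<Sum>i\<in>UNIV. (sqrt (v i) * (w i $ k / m $ k)) *\<^sub>R E i)" for k
  have cm: "config_map x \<xi> = (\<Sum>i\<in>UNIV. (sqrt (v i) * mdot m \<xi> (w i)) *\<^sub>R E i)" for \<xi>
  proof -
    have "config_map x \<xi> = (\<Sum>k\<in>UNIV. \<Sum>i\<in>UNIV. (sqrt (v i) * (\<xi> $ k * w i $ k / m $ k)) *\<^sub>R E i)"
      by (simp add: config_map_def x_def scaleR_sum_right mult_ac)
    also have "\<dots> = (\<Sum>i\<in>UNIV. \<Sum>k\<in>UNIV. (sqrt (v i) * (\<xi> $ k * w i $ k / m $ k)) *\<^sub>R E i)"
      by (rule sum.swap)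
    also have "\<dots> = (\<Sum>i\<in>UNIV. (sqrt (v i) * mdot m \<xi> (w i)) *\<^sub>R E i)"
      by (simp add: mdot_def sum_distrib_left flip: scaleR_sum_left)
    finally show ?thesis .
  qed
  have "inertia m x = B"
  proof (rule inertia_eqI[OF B])
    fix \<xi> \<eta> :: "'n disp"
    have "config_map x \<xi> \<bullet> config_map x \<eta> =
        (\<Sum>i\<in>UNIV. (sqrt (v i) * mdot m \<xi> (w i)) * (sqrt (v i) * mdot m \<eta> (w i)))"
      by (simp add: cm inner_sum_left inner_sum_right EE if_distrib[of "\<lambda>c. _ * c"] mult_ac cong: if_cong)
    also have "\<dots> = (\<Sum>i\<in>UNIV. v i * mdot m \<xi> (w i) * mdot m (w i) \<eta>)"
    proof (rule sum.cong[OF refl])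
      fix i
      have "sqrt (v i) * sqrt (v i) = v i" using pos[of i] by simp
      then show "sqrt (v i) * mdot m \<xi> (w i) * (sqrt (v i) * mdot m \<eta> (w i)) =
          v i * mdot m \<xi> (w i) * mdot m (w i) \<eta>"
        using mdot_commute[of m \<eta> "w i"] by (metis (no_types, opaque_lifting) mult.assoc mult.left_commute)
    qed
    also have "\<dots> = mdot m (B *v \<xi>) \<eta>"
      by (simp add: spectral_expansion[OF B w ev] mdot_simps)
    finally show "mdot m (B *v \<xi>) \<eta> = config_map x \<xi> \<bullet> config_map x \<eta>" by simp
  qed
  then show ?thesis by blast
qed

lemma mdot_unit_le:
  assumes "mdot m w w = 1" shows "\<bar>mdot m \<eta> w\<bar> \<le> sqrt (mdot m \<eta> \<eta>)"
proof -
  have "0 \<le> mdot m (\<eta> - mdot m \<eta> w *\<^sub>R w) (\<eta> - mdot m \<eta> w *\<^sub>R w)" by (rule mdot_nonneg)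
  also have "\<dots> = mdot m \<eta> \<eta> - (mdot m \<eta> w)\<^sup>2"
    using mdot_commute[of m w \<eta>] by (simp add: mdot_simps assms power2_eq_square)
  finally show ?thesis by (intro real_le_rsqrt) simp
qed

text \<open>An endomorphism diagonal in an orthonormal basis of \<open>W\<close> and zero on the complement of \<open>W\<close>
  differs from a multiple of the orthogonal projection onto \<open>W\<close> by at most a constant times the
  deviation of its eigenvalues, whatever the basis.\<close>

lemma near_homothety_bound:
  fixes w :: "'i::finite \<Rightarrow> 'n disp" and u :: "'i \<Rightarrow> 'n disp"
  assumes w: "orthonormal_basis_of m W w" and u: "orthonormal_basis_of m W u"
    and F: "\<And>i. F *v w i = (v $ i) *\<^sub>R w i" "\<And>\<eta>. (\<And>\<zeta>. \<zeta> \<in> W \<Longrightarrow> mdot m \<eta> \<zeta> = 0) \<Longrightarrow> F *v \<eta> = 0"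
  shows "\<bar>mdot m (F *v \<eta>) \<zeta> - c * (\<Sum>i\<in>UNIV. mdot m \<eta> (u i) * mdot m (u i) \<zeta>)\<bar> \<le>
    CARD('i) * sqrt (mdot m \<eta> \<eta>) * sqrt (mdot m \<zeta> \<zeta>) * norm (v - (\<chi> i. c))"
proof -
  have ow: "mdot m (w i) (w j) = (if i = j then 1 else 0)" and Ww: "span (range w) = W"
    and ou: "mdot m (u i) (u j) = (if i = j then 1 else 0)" and Wu: "span (range u) = W" for i j
    using w u by (simp_all add: orthonormal_basis_of_def)
  define p where "p \<eta> = (\<Sum>i\<in>UNIV. mdot m \<eta> (w i) *\<^sub>R w i)" for \<eta>
  have pW: "p \<eta> \<in> W" for \<eta>
    unfolding p_def Ww[symmetric] by (intro span_sum span_scale span_base) auto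
  have perp_w: "mdot m (\<eta> - p \<eta>) (w j) = 0" for \<eta> j
    by (simp add: p_def mdot_simps ow if_distrib[of "\<lambda>c. _ * c"] cong: if_cong)
  have perp: "mdot m (\<eta> - p \<eta>) \<zeta> = 0" if "\<zeta> \<in> W" for \<eta> \<zeta>
    using that unfolding Ww[symmetric]
  proof (rule span_induct)
    show "subspace {\<zeta>. mdot m (\<eta> - p \<eta>) \<zeta> = 0}" by (auto simp: subspace_def mdot_simps)
  qed (use perp_w in auto)
  have F\<eta>: "F *v \<eta> = (\<Sum>i\<in>UNIV. (v $ i * mdot m \<eta> (w i)) *\<^sub>R w i)"
  proof -
    have "F *v (\<eta> - p \<eta>) = 0" by (rule F(2)) (rule perp)
    then have "F *v \<eta> = F *v p \<eta>" by (simp add: mv_simps)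
    then show ?thesis by (simp add: p_def mv_simps F(1) mult.commute)
  qed
  have "u i \<in> W" for i unfolding Wu[symmetric] by (simp add: span_base)
  then have up: "mdot m \<eta> (u i) = mdot m (p \<eta>) (u i)" for i
    using perp[of "u i" \<eta>] by (simp add: mdot_simps)
  have "p \<eta> = (\<Sum>i\<in>UNIV. mdot m (p \<eta>) (u i) *\<^sub>R u i)"
    by (rule orthonormal_expansion[OF ou]) (simp add: Wu pW)
  then have "mdot m (p \<eta>) \<zeta> = (\<Sum>i\<in>UNIV. mdot m \<eta> (u i) * mdot m (u i) \<zeta>)"
    by (subst (asm) up[symmetric]) (simp add: mdot_simps)
  then have "mdot m (F *v \<eta>) \<zeta> - c * (\<Sum>i\<in>UNIV. mdot m \<eta> (u i) * mdot m (u i) \<zeta>) =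
      mdot m (F *v \<eta>) \<zeta> - c * mdot m (p \<eta>) \<zeta>" by simp
  also have "\<dots> = (\<Sum>i\<in>UNIV. (v $ i - c) * (mdot m \<eta> (w i) * mdot m (w i) \<zeta>))"
    by (simp add: F\<eta> p_def mdot_simps sum_distrib_left sum_subtractf[symmetric] algebra_simps)
  also have "\<bar>\<dots>\<bar> \<le> (\<Sum>i\<in>(UNIV::'i set). norm (v - (\<chi> i. c)) * (sqrt (mdot m \<eta> \<eta>) * sqrt (mdot m \<zeta> \<zeta>)))"
  proof (rule order_trans[OF sum_abs sum_mono])
    fix i
    have "\<bar>v $ i - c\<bar> \<le> norm (v - (\<chi> i. c))"
      using component_le_norm_cart[of "v - (\<chi> i. c)" i] by simp
    moreover have "\<bar>mdot m \<eta> (w i)\<bar> \<le> sqrt (mdot m \<eta> \<eta>)" "\<bar>mdot m (w i) \<zeta>\<bar> \<le> sqrt (mdot m \<zeta> \<zeta>)"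
      using mdot_unit_le[of "w i"] mdot_commute[of m "w i" \<zeta>] by (simp_all add: ow)
    ultimately show "\<bar>(v $ i - c) * (mdot m \<eta> (w i) * mdot m (w i) \<zeta>)\<bar> \<le>
        norm (v - (\<chi> i. c)) * (sqrt (mdot m \<eta> \<eta>) * sqrt (mdot m \<zeta> \<zeta>))"
      unfolding abs_mult by (intro mult_mono) (auto simp: mdot_nonneg)
  qed
  finally show ?thesis by (simp add: mult_ac)
qed

lemma multiple_eigenvalue_iff:
  fixes w :: "'i::finite \<Rightarrow> 'n disp"
  assumes w: "orthonormal_basis_of m W w" and A: "\<And>i. A *v w i = v i *\<^sub>R w i"
  shows "multiple_eigenvalue_on W A \<longleftrightarrow> (\<exists>i j. i \<noteq> j \<and> v i = v j)"
proof
  have ow: "mdot m (w i) (w j) = (if i = j then 1 else 0)" and Ww: "span (range w) = W" for i j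
    using w by (simp_all add: orthonormal_basis_of_def)
  have wW: "w i \<in> W" for i unfolding Ww[symmetric] by (simp add: span_base)
  {
    assume "\<exists>i j. i \<noteq> j \<and> v i = v j"
    then obtain i j where ij: "i \<noteq> j" "v i = v j" by blast
    have "{w i, w j} \<subseteq> eigenspace_on W A (v i)"
      using ij A wW by (simp add: eigenspace_on_def)
    moreover have "independent {w i, w j}"
      by (rule independent_mono[OF orthonormal_independent[of w, OF ow]]) auto
    ultimately have "card {w i, w j} \<le> dim (eigenspace_on W A (v i))"
      by (rule independent_card_le_dim)
    moreover have "w i \<noteq> w j" using orthonormal_inj[of w, OF ow] ij(1) by (auto dest: injD)
    ultimately show "multiple_eigenvalue_on W A" unfolding multiple_eigenvalue_on_def
      by (intro exI[of _ "v i"]) simp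
  next
    assume "multiple_eigenvalue_on W A"
    then obtain c where c: "2 \<le> dim (eigenspace_on W A c)" by (auto simp: multiple_eigenvalue_on_def)
    show "\<exists>i j. i \<noteq> j \<and> v i = v j"
    proof (rule ccontr)
      assume "\<not> ?thesis"
      then have inj: "i = j" if "v i = v j" for i j using that by blast
      obtain k where k: "\<And>i. v i = c \<Longrightarrow> i = k"
      proof (cases "\<exists>k. v k = c")
        case True
        then obtain k where "v k = c" by blast
        then show ?thesis using inj that by metis
      next
        case False
        then show ?thesis using that by blast
      qed
      have "eigenspace_on W A c \<subseteq> span {w k}"
      proof
        fix \<xi> assume "\<xi> \<in> eigenspace_on W A c"
        then have \<xi>: "\<xi> \<in> W" "A *v \<xi> = c *\<^sub>R \<xi>" by (auto simp: eigenspace_on_def)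
        have e: "\<xi> = (\<Sum>i\<in>UNIV. mdot m \<xi> (w i) *\<^sub>R w i)"
          by (rule orthonormal_expansion[OF ow]) (simp add: Ww \<xi>)
        have "A *v \<xi> = (\<Sum>i\<in>UNIV. (mdot m \<xi> (w i) * v i) *\<^sub>R w i)"
          by (subst e) (simp add: mv_simps A)
        then have "mdot m (c *\<^sub>R \<xi>) (w i) = mdot m \<xi> (w i) * v i" for i
          unfolding \<xi>(2) by (simp add: mdot_simps ow if_distrib[of "\<lambda>c. _ * c"] cong: if_cong)
        then have z: "(c - v i) * mdot m \<xi> (w i) = 0" for i
          by (simp add: mdot_simps algebra_simps)
        have "mdot m \<xi> (w i) = 0" if "i \<noteq> k" for i
        proof -
          have "v i \<noteq> c" using k[of i] that by blast
          then show ?thesis using z[of i] by simp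
        qed
        then have "(\<Sum>i\<in>UNIV. mdot m \<xi> (w i) *\<^sub>R w i) = (\<Sum>i\<in>UNIV. if i = k then mdot m \<xi> (w k) *\<^sub>R w k else 0)"
          by (intro sum.cong refl) auto
        then have "\<xi> = mdot m \<xi> (w k) *\<^sub>R w k" using e by simp
        then show "\<xi> \<in> span {w k}" by (metis span_base span_scale singletonI)
      qed
      then have "dim (eigenspace_on W A c) \<le> card {w k}" by (rule dim_le_card) simp
      then show False using c by simp
    qed
  }
qed

end

lemma WC_config_eq:
  fixes m :: "'n::{finite,linorder} disp" and x :: "'n \<Rightarrow> 'e::euclidean_space"
  assumes "\<And>i. 0 < m $ i"
  shows "WC_config m G x = WC_inertia m G (inertia m x)"
proof -
  have "sqdist m (inertia m x) = (\<lambda>i j. (dist (x i) (x j))\<^sup>2)"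
    by (intro ext sqdist_inertia[OF assms])
  then show ?thesis unfolding WC_config_def WC_inertia_def by simp
qed

text \<open>A function whose increments are dominated by those of a function with derivative \<open>0\<close> has derivative \<open>0\<close>.\<close>

lemma derivative_0_by_comparison:
  fixes p :: "real \<Rightarrow> real" and l :: "real \<Rightarrow> 'a::real_normed_vector"
  assumes p: "(p has_vector_derivative p') (at 0)" and l: "(l has_vector_derivative 0) (at 0)"
    and le: "\<forall>\<^sub>F s in at 0. \<bar>p s - p 0\<bar> \<le> C * norm (l s - l 0)"
  shows "p' = 0"
proof -
  have l0: "((\<lambda>s. (1 / norm (s - 0)) *\<^sub>R (l s - l 0)) \<longlongrightarrow> 0) (at 0)"
    using l unfolding has_vector_derivative_def has_derivative_within by simp
  have "((\<lambda>s. (1 / norm (s - 0)) *\<^sub>R (p s - p 0)) \<longlongrightarrow> 0) (at 0)"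
  proof (rule Lim_null_comparison)
    show "\<forall>\<^sub>F s in at 0. norm ((1 / norm (s - 0)) *\<^sub>R (p s - p 0)) \<le>
        C * norm ((1 / norm (s - 0)) *\<^sub>R (l s - l 0))"
      using le
    proof eventually_elim
      case (elim s)
      from mult_left_mono[OF this, of "1 / \<bar>s\<bar>"] show ?case by (simp add: mult_ac)
    qed
    show "((\<lambda>s. C * norm ((1 / norm (s - 0)) *\<^sub>R (l s - l 0))) \<longlongrightarrow> 0) (at 0)"
      using tendsto_mult_left[OF tendsto_norm[OF l0], of C] by simp
  qed
  then have "(p has_vector_derivative 0) (at 0)"
    unfolding has_vector_derivative_def has_derivative_within by simp
  then show ?thesis by (rule vector_derivative_unique_at[OF p])
qed

section \<open>Balanced configurations near a central one\<close>

context nbody_frame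
begin

lemma conj_eigenvector:
  assumes "B = rot H ** diag v ** rot_inv H"
  shows "B *v (rot H *v u i) = v $ i *\<^sub>R (rot H *v u i)"
  by (simp add: assms mv_assoc diag_u mv_simps)

lemma endo_image_diag:
  assumes v: "\<And>i. v $ i \<noteq> 0" shows "endo_image (diag v) = span (range u)"
proof
  show "endo_image (diag v) \<subseteq> span (range u)"
    unfolding endo_image_def
    by (auto simp: diag_def mv_simps eproj_Some proj_mult_vec intro!: span_sum span_scale intro: span_base)
  show "span (range u) \<subseteq> endo_image (diag v)"
  proof (rule span_minimal[OF _ subspace_endo_image], clarify)
    fix i
    have "diag v *v ((1 / v $ i) *\<^sub>R u i) = u i" using v[of i] by (simp add: mv_simps diag_u)
    then show "u i \<in> endo_image (diag v)"
      unfolding endo_image_def by (rule rev_image_eqI[rotated, OF sym])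
        (rule subspace_scale[OF subspace_Dstar u_Dstar])
  qed
qed

lemma conj_orthonormal_basis:
  assumes B: "B = rot H ** diag v ** rot_inv H" and v: "\<And>i. v $ i \<noteq> 0"
  shows "orthonormal_basis_of m (endo_image B) (\<lambda>i. rot H *v u i)"
proof -
  have "span ((\<lambda>\<xi>. rot H *v \<xi>) ` range u) = (\<lambda>\<xi>. rot H *v \<xi>) ` span (range u)"
    by (rule linear_span_image) simp
  then have "span (range (\<lambda>i. rot H *v u i)) = endo_image B"
    by (simp add: B endo_image_conj endo_image_diag[OF v] image_image)
  then show ?thesis by (simp add: orthonormal_basis_of_def rot_isometry orthonormal)
qed

lemma diag_part_fixed_eigenvector: "diag_part N = N \<Longrightarrow> N *v u i = mdot m (N *v u i) (u i) *\<^sub>R u i"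
proof -
  assume "diag_part N = N"
  then have "N *v u i = diag_part N *v u i" by simp
  also have "\<dots> = eproj (Some i) *v (N *v u i)"
    by (simp add: diag_part_def mv_simps mv_assoc eproj_u if_distrib[of "\<lambda>x. _ *v x"] cong: if_cong)
  finally show ?thesis by (simp add: eproj_Some proj_mult_vec)
qed

text \<open>As \<open>A(B)\<close> commutes with \<open>B\<close>, whose non-zero eigenvalues are simple, it has the same eigenvectors in the
  image of \<open>B\<close>.\<close>

lemma conj_WC_eigenvector:
  assumes B: "B = rot H ** diag v ** rot_inv H" and v: "v \<in> generic" and c: "WC B ** B = B ** WC B"
  shows "WC B *v (rot H *v u i) = mdot m (WC B *v (rot H *v u i)) (rot H *v u i) *\<^sub>R (rot H *v u i)"
proof -
  define N where "N = rot_inv H ** WC B ** rot H"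
  have "N ** diag v = diag v ** N" using c unfolding conj_commutes_iff[OF B] N_def .
  then have "diag_part N = N" by (rule diag_part_eq_of_commutes[OF generic_separated[OF v]])
  then have "N *v u i = mdot m (N *v u i) (u i) *\<^sub>R u i" by (rule diag_part_fixed_eigenvector)
  then have "rot H *v (N *v u i) = rot H *v (mdot m (N *v u i) (u i) *\<^sub>R u i)" by simp
  then show ?thesis by (simp add: N_def mv_assoc mv_simps rot_inv_adjoint)
qed

lemma balanced_inertiasD:
  fixes x0 :: "'n \<Rightarrow> 'e::euclidean_space"
  assumes "B \<in> balanced_inertias m G x0"
  shows "B \<in> sym_endo m" "B \<in> \<Omega>" "WC B ** B = B ** WC B" "dim (endo_image B) = config_rank x0"
proof -
  obtain x :: "'n \<Rightarrow> 'e" where x: "B = inertia m x" "balanced m G x" "config_rank x = config_rank x0"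
    using assms unfolding balanced_inertias_def by blast
  show "B \<in> sym_endo m" unfolding x(1) by (rule inertia_sym)
  show "B \<in> \<Omega>" using x(2) unfolding x(1) balanced_def noncollision_iff \<Omega>_def by simp
  show "WC B ** B = B ** WC B"
    using x(2) unfolding x(1) balanced_def WC_config_eq[OF m_pos] by simp
  show "dim (endo_image B) = config_rank x0" unfolding x(1) config_rank_eq[symmetric] by (rule x(3))
qed

lemma balanced_inertiasI:
  fixes x0 :: "'n \<Rightarrow> 'e::euclidean_space"
  assumes B: "B = rot H ** diag v ** rot_inv H" and v: "v \<in> generic" "\<And>i. 0 < v $ i" and \<Omega>: "B \<in> \<Omega>"
    and c: "WC B ** B = B ** WC B" and rank: "config_rank x0 = CARD('d)"
  shows "B \<in> balanced_inertias m G x0"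
proof -
  have sym: "B \<in> sym_endo m" unfolding B by (rule conj_sym[OF diag_sym])
  have nz: "v $ i \<noteq> 0" for i using v(2)[of i] by simp
  note onb = conj_orthonormal_basis[OF B nz]
  have "CARD('d) \<le> DIM('e)"
    unfolding rank[symmetric] config_rank_def by (rule dim_subset_UNIV)
  then obtain x :: "'n \<Rightarrow> 'e" where x: "inertia m x = B"
    using realization[where v = "\<lambda>i. v $ i", OF sym onb conj_eigenvector[OF B] v(2)] by blast
  have "noncollision x" using \<Omega> by (simp add: noncollision_iff x \<Omega>_def)
  moreover have "WC_config m G x ** inertia m x = inertia m x ** WC_config m G x"
    using c by (simp add: WC_config_eq[OF m_pos] x)
  ultimately have "balanced m G x" by (simp add: balanced_def)
  moreover have "config_rank x = config_rank x0"
  proof -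
    have "dim (endo_image B) = CARD('d)"
      using onb orthonormal_dim_span[of "\<lambda>i. rot H *v u i"] by (auto simp: orthonormal_basis_of_def)
    then show ?thesis by (simp add: config_rank_eq[of x] x rank)
  qed
  ultimately show ?thesis unfolding balanced_inertias_def using x by blast
qed

text \<open>At a central configuration all the eigenvalues of the transported endomorphism coincide, so its
  first order variation along a curve only sees the variation of the eigenvalues, not that of the
  eigenvectors nor that of the isometries \<open>J\<close>.\<close>

lemma condition_H_injective:
  fixes x0 :: "'n \<Rightarrow> 'e::euclidean_space" and \<gamma> :: "real \<Rightarrow> 'n endo" and l :: "real \<Rightarrow> real^'d"
  assumes H: "condition_H m G x0" and x0: "inertia m x0 = diag v0"
    and \<gamma>: "(\<gamma> has_vector_derivative \<gamma>') (at 0)" "\<gamma> 0 = diag v0"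
    and bal: "\<forall>\<^sub>F s in nhds 0. \<gamma> s \<in> balanced_inertias m G x0"
    and onb: "\<forall>\<^sub>F s in nhds 0. orthonormal_basis_of m (endo_image (\<gamma> s)) (w s) \<and>
      (\<forall>i. WC (\<gamma> s) *v w s i = (l s $ i) *\<^sub>R w s i)"
    and l: "(l has_vector_derivative 0) (at 0)" "l 0 = (\<chi> i. c)"
  shows "\<gamma>' = 0"
proof -
  obtain W J F K where "open W \<and> diag v0 \<in> W \<and>
       (let N = W \<inter> balanced_inertias m G x0 in
         smooth_on N J \<and>
         (\<forall>\<xi>\<in>endo_image (diag v0). J (diag v0) *v \<xi> = \<xi>) \<and>
         (\<forall>B\<in>N. (\<lambda>\<xi>. J B *v \<xi>) ` endo_image B = endo_image (diag v0) \<and>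
           (\<forall>\<xi>\<in>endo_image B. \<forall>\<eta>\<in>endo_image B. mdot m (J B *v \<xi>) (J B *v \<eta>) = mdot m \<xi> \<eta>) \<and>
           (\<forall>\<xi>\<in>endo_image B. F B *v (J B *v \<xi>) = J B *v (WC B *v \<xi>)) \<and>
           (\<forall>\<eta>. (\<forall>\<zeta>\<in>endo_image (diag v0). mdot m \<eta> \<zeta> = 0) \<longrightarrow> F B *v \<eta> = 0)) \<and>
         diffeomorphism N (F ` N) F (K :: 'n endo \<Rightarrow> 'n endo))"
    using H unfolding condition_H_def Let_def x0 by (elim exE) (rule that[unfolded Let_def])
  note HH = this[unfolded Let_def]
  define N where "N = W \<inter> balanced_inertias m G x0"
  have W: "open W" "diag v0 \<in> W" using HH by simp_all
  have JF: "(\<lambda>\<xi>. J B *v \<xi>) ` endo_image B = endo_image (diag v0)"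
      "\<And>\<xi> \<eta>. \<xi> \<in> endo_image B \<Longrightarrow> \<eta> \<in> endo_image B \<Longrightarrow> mdot m (J B *v \<xi>) (J B *v \<eta>) = mdot m \<xi> \<eta>"
      "\<And>\<xi>. \<xi> \<in> endo_image B \<Longrightarrow> F B *v (J B *v \<xi>) = J B *v (WC B *v \<xi>)"
      "\<And>\<eta>. (\<And>\<zeta>. \<zeta> \<in> endo_image (diag v0) \<Longrightarrow> mdot m \<eta> \<zeta> = 0) \<Longrightarrow> F B *v \<eta> = 0"
    if "B \<in> N" for B
    using HH that unfolding N_def by blast+
  have smF: "smooth_on N F" and smK: "smooth_on (F ` N) K" and KF: "\<And>B. B \<in> N \<Longrightarrow> K (F B) = B"
    using HH unfolding N_def diffeomorphism_def by simp_all
  have evN: "\<forall>\<^sub>F s in nhds 0. \<gamma> s \<in> N"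
    using bal isCont_eventually_in_open[OF has_vector_derivative_continuous[OF \<gamma>(1)] W(1)]
    by (simp add: \<gamma>(2) W(2) N_def eventually_conj)
  have N0: "diag v0 \<in> N" using eventually_nhds_x_imp_x[OF evN] by (simp add: \<gamma>(2))
  obtain U1 F1 where F1: "diag v0 \<in> U1" "Cinf U1 F1" "\<And>B. B \<in> U1 \<Longrightarrow> B \<in> N \<Longrightarrow> F1 B = F B"
    by (rule smooth_on_obtain[OF smF N0]) (rule that)
  have "F (diag v0) \<in> F ` N" using N0 by (rule imageI)
  then obtain U2 K1 where K1: "F (diag v0) \<in> U2" "Cinf U2 K1"
      "\<And>T. T \<in> U2 \<Longrightarrow> T \<in> F ` N \<Longrightarrow> K1 T = K T"
    by (rule smooth_on_obtain[OF smK]) (rule that)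
  define \<phi> where "\<phi> s = F1 (\<gamma> s)" for s
  define \<phi>' where "\<phi>' = frechet_derivative F1 (at (diag v0)) \<gamma>'"
  have \<phi>: "(\<phi> has_vector_derivative \<phi>') (at 0)"
    using Cinf_comp_has_vector_derivative[OF F1(2) \<gamma>(1)] F1(1)
    unfolding \<phi>_def[abs_def] \<phi>'_def by (simp add: \<gamma>(2))
  have \<phi>0: "\<phi> 0 = F (diag v0)" by (simp add: \<phi>_def \<gamma>(2) F1(3)[OF F1(1) N0])
  have evU1: "\<forall>\<^sub>F s in nhds 0. \<gamma> s \<in> U1"
    by (rule isCont_eventually_in_open[OF has_vector_derivative_continuous[OF \<gamma>(1)] Cinf_open[OF F1(2)]])
      (simp add: \<gamma>(2) F1(1))
  have ev\<phi>: "\<forall>\<^sub>F s in nhds 0. \<phi> s = F (\<gamma> s)"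
    using evN evU1 by eventually_elim (simp add: \<phi>_def F1(3))
  have basis: "orthonormal_basis_of m (endo_image (diag v0)) (\<lambda>i. J B *v w i)"
      "F B *v (J B *v w i) = k i *\<^sub>R (J B *v w i)"
    if B: "B \<in> N" and w: "orthonormal_basis_of m (endo_image B) w" "\<And>i. WC B *v w i = k i *\<^sub>R w i"
    for B k i and w :: "'d \<Rightarrow> 'n disp"
  proof -
    have ow: "\<And>i j. mdot m (w i) (w j) = (if i = j then 1 else 0)" and sw: "span (range w) = endo_image B"
      using w(1) by (simp_all add: orthonormal_basis_of_def)
    have wB: "w i \<in> endo_image B" for i unfolding sw[symmetric] by (simp add: span_base)
    have "span ((\<lambda>\<xi>. J B *v \<xi>) ` range w) = (\<lambda>\<xi>. J B *v \<xi>) ` span (range w)"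
      by (rule linear_span_image) simp
    then have "span (range (\<lambda>i. J B *v w i)) = endo_image (diag v0)"
      by (simp add: sw JF(1)[OF B] image_image)
    then show "orthonormal_basis_of m (endo_image (diag v0)) (\<lambda>i. J B *v w i)"
      by (simp add: orthonormal_basis_of_def JF(2)[OF B wB wB] ow)
    show "F B *v (J B *v w i) = k i *\<^sub>R (J B *v w i)"
      by (simp add: JF(3)[OF B wB] w(2) mv_simps)
  qed
  have u0: "orthonormal_basis_of m (endo_image (diag v0)) u"
    by (simp add: orthonormal_basis_of_def orthonormal endo_image_diag v0_nonzero)
  define R where "R \<eta> \<zeta> = c * (\<Sum>i\<in>UNIV. mdot m \<eta> (u i) * mdot m (u i) \<zeta>)" for \<eta> \<zeta>
  define C where "C \<eta> \<zeta> = CARD('d) * sqrt (mdot m \<eta> \<eta>) * sqrt (mdot m \<zeta> \<zeta>)" for \<eta> \<zeta> :: "'n disp"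
  have bound: "\<bar>mdot m (F B *v \<eta>) \<zeta> - R \<eta> \<zeta>\<bar> \<le> C \<eta> \<zeta> * norm (k - (\<chi> i. c))"
    if "B \<in> N" "orthonormal_basis_of m (endo_image B) w" "\<And>i. WC B *v w i = k $ i *\<^sub>R w i"
    for B k \<eta> \<zeta> and w :: "'d \<Rightarrow> 'n disp"
    unfolding R_def C_def
    by (rule near_homothety_bound[OF basis(1)[OF that] u0 basis(2)[OF that] JF(4)[OF that(1)]])
  have ev_onb: "orthonormal_basis_of m (endo_image (diag v0)) (w 0)" "WC (diag v0) *v w 0 i = c *\<^sub>R w 0 i" for i
    using eventually_nhds_x_imp_x[OF onb] by (simp_all add: \<gamma>(2) l(2))
  have at0: "mdot m (\<phi> 0 *v \<eta>) \<zeta> = R \<eta> \<zeta>" for \<eta> \<zeta>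
    using bound[of "diag v0" "w 0" "\<chi> i. c" \<eta> \<zeta>] N0 ev_onb by (simp add: \<phi>0)
  have "\<phi>' = 0"
  proof (rule endo_eqI_mdot)
    fix \<eta> \<zeta> :: "'n disp"
    have bl: "bounded_linear (\<lambda>T. mdot m (T *v \<eta>) \<zeta>)"
      by (rule bounded_linear_of_linear) (auto intro!: linearI simp: mv_simps mdot_simps)
    have "mdot m (\<phi>' *v \<eta>) \<zeta> = 0"
    proof (rule derivative_0_by_comparison[OF bounded_linear.has_vector_derivative[OF bl \<phi>] l(1)])
      have "\<forall>\<^sub>F s in nhds 0. \<bar>mdot m (\<phi> s *v \<eta>) \<zeta> - mdot m (\<phi> 0 *v \<eta>) \<zeta>\<bar> \<le> C \<eta> \<zeta> * norm (l s - l 0)"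
        using evN ev\<phi> onb
      proof eventually_elim
        case (elim s)
        then show ?case unfolding at0 l(2) elim(2) by (intro bound) auto
      qed
      then show "\<forall>\<^sub>F s in at 0. \<bar>mdot m (\<phi> s *v \<eta>) \<zeta> - mdot m (\<phi> 0 *v \<eta>) \<zeta>\<bar> \<le> C \<eta> \<zeta> * norm (l s - l 0)"
        by (simp add: eventually_nhds_conv_at)
    qed
    then show "mdot m (\<phi>' *v \<eta>) \<zeta> = mdot m (0 *v \<eta>) \<zeta>" by (simp add: mdot_simps)
  qed
  have "\<forall>\<^sub>F s in nhds 0. \<phi> s \<in> U2"
    by (rule isCont_eventually_in_open[OF has_vector_derivative_continuous[OF \<phi>] Cinf_open[OF K1(2)]])
      (simp add: \<phi>0 K1(1))
  with evN ev\<phi> have ev: "\<forall>\<^sub>F s in nhds 0. K1 (\<phi> s) = \<gamma> s"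
  proof eventually_elim
    case (elim s)
    have "F (\<gamma> s) \<in> F ` N" using elim(1) by (rule imageI)
    then have "K1 (F (\<gamma> s)) = K (F (\<gamma> s))" using elim by (intro K1(3)) simp_all
    then show ?case by (simp add: elim KF)
  qed
  have "((\<lambda>s. K1 (\<phi> s)) has_vector_derivative frechet_derivative K1 (at (\<phi> 0)) \<phi>') (at 0)"
    by (rule Cinf_comp_has_vector_derivative[OF K1(2) \<phi>]) (simp add: \<phi>0 K1(1))
  from has_vector_derivative_cong_nhds[OF this ev]
  have "(\<gamma> has_vector_derivative 0) (at 0)"
    using linear_0[OF Cinf_linear_derivative[OF K1(2) K1(1)]] by (simp add: \<open>\<phi>' = 0\<close> \<phi>0)
  from vector_derivative_unique_at[OF \<gamma>(1) this] show ?thesis .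
qed

text \<open>The statement for a frame that is already diagonalized. The parametrizing maps are \<open>b = r\<close>, the
  spectrum, and \<open>lam\<close>; both are defined and smooth on a neighbourhood in the ambient space.\<close>

theorem balanced_inertias_near_central:
  fixes x0 :: "'n \<Rightarrow> 'e::euclidean_space"
  assumes x0: "inertia m x0 = diag v0" and rank: "config_rank x0 = CARD('d)"
    and nd: "nondegenerate_critical_point_on (potential m G) (isospectral m (diag v0)) (diag v0)"
    and bal: "balanced m G x0"
    and central: "\<And>\<xi>. \<xi> \<in> endo_image (diag v0) \<Longrightarrow> WC (diag v0) *v \<xi> = c *\<^sub>R \<xi>"
    and v0_pos: "\<And>i. 0 < v0 $ i" and H: "condition_H m G x0"
  shows "\<exists>W (b :: 'n endo \<Rightarrow> real^'d) (lam :: 'n endo \<Rightarrow> real^'d) (w :: 'n endo \<Rightarrow> 'd \<Rightarrow> 'n disp).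
    open W \<and> diag v0 \<in> W \<and>
    (let N = W \<inter> balanced_inertias m G x0 in
      w (diag v0) = u \<and> (\<forall>i. continuous_on N (\<lambda>B. w B i)) \<and>
      (\<forall>B\<in>N. orthonormal_basis_of m (endo_image B) (w B) \<and>
        (\<forall>i. B *v w B i = (b B $ i) *\<^sub>R w B i \<and>
             WC_inertia m G B *v w B i = (- (1 / 2) * lam B $ i) *\<^sub>R w B i)) \<and>
      submanifold CARD('d) N \<and>
      (\<exists>V h. open V \<and> diffeomorphism N V b h) \<and>
      (\<exists>V h. open V \<and> diffeomorphism N V lam h) \<and>
      {B\<in>N. multiple_eigenvalue_on (endo_image B) (WC_inertia m G B)} =
        (\<Union>i. \<Union>j\<in>- {i}. {B\<in>N. lam B $ i = lam B $ j}) \<and>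
      (\<forall>i j. i \<noteq> j \<longrightarrow>
        diag v0 \<in> {B\<in>N. lam B $ i = lam B $ j} \<and>
        submanifold (CARD('d) - 1) {B\<in>N. lam B $ i = lam B $ j}))"
proof -
  let ?Bal = "balanced_inertias m G x0"
  have "diag v0 \<in> ?Bal"
    using bal unfolding balanced_inertias_def x0[symmetric] by blast
  note Bal0 = balanced_inertiasD[OF this]
  obtain V0 \<psi> W0 S where V0: "v0 \<in> V0" "V0 \<subseteq> generic" "Cinf V0 \<psi>" and W0: "diag v0 \<in> W0" "W0 \<subseteq> \<Omega>" "Cinf W0 S"
    and S0: "S (diag v0) = 0" and \<psi>0: "\<psi> v0 = diag v0" and \<psi>W0: "\<And>v. v \<in> V0 \<Longrightarrow> \<psi> v \<in> W0"
    and \<psi>_eq: "\<And>v. v \<in> V0 \<Longrightarrow> \<psi> v = rot (S (\<psi> v)) ** diag v ** rot_inv (S (\<psi> v))"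
    and \<psi>_comm: "\<And>v. v \<in> V0 \<Longrightarrow> WC (\<psi> v) ** \<psi> v = \<psi> v ** WC (\<psi> v)"
    and r\<psi>: "\<And>v. v \<in> V0 \<Longrightarrow> v0 + diag_entries (S (\<psi> v)) = v"
    and \<psi>r: "\<And>B. \<lbrakk>B \<in> W0; B \<in> sym_endo m; dim (endo_image B) = CARD('d); WC B ** B = B ** WC B;
       v0 + diag_entries (S B) \<in> V0\<rbrakk> \<Longrightarrow> \<psi> (v0 + diag_entries (S B)) = B"
    by (rule balanced_local_structure[OF nd Bal0(2,3)]) (rule that)
  define r where "r B = v0 + diag_entries (S B)" for B
  define w where "w B i = rot (S B) *v u i" for B i
  define lam :: "'n endo \<Rightarrow> real^'d" where "lam B = (\<chi> i. - 2 * mdot m (WC B *v w B i) (w B i))" for B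
  have oW0: "open W0" by (rule Cinf_open[OF W0(3)])
  have rC: "Cinf W0 r"
    unfolding r_def by (rule Cinf_add[OF Cinf_const[OF oW0] Cinf_linear_compose[OF bounded_linear_diag_entries W0(3)]])
  have wC: "Cinf W0 (\<lambda>B. w B i)" for i
    unfolding w_def
    by (rule Cinf_bilinear[OF bounded_bilinear_matrix_vector_mult Cinf_compose[OF W0(3) Cinf_rot subset_UNIV]
          Cinf_const[OF oW0]])
  have lamC: "Cinf W0 lam"
  proof -
    have "Cinf W0 (\<lambda>B. mdot m (WC B *v w B i) (w B i))" for i
      by (rule Cinf_bilinear[OF bounded_bilinear_mdot Cinf_bilinear[OF bounded_bilinear_matrix_vector_mult
              Cinf_subset[OF Cinf_WC oW0 W0(2)] wC] wC])
    from Cinf_vec_lambda[OF oW0 Cinf_linear_compose[OF bounded_linear_mult_right this]]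
    show ?thesis unfolding lam_def .
  qed
  have nz: "v $ i \<noteq> 0" if "v \<in> V0" for v i using V0(2) that by (auto simp: generic_def)
  have onb: "orthonormal_basis_of m (endo_image (\<psi> v)) (w (\<psi> v))" if "v \<in> V0" for v
    unfolding w_def[abs_def] by (rule conj_orthonormal_basis[OF \<psi>_eq[OF that] nz[OF that]])
  have eig: "\<psi> v *v w (\<psi> v) i = v $ i *\<^sub>R w (\<psi> v) i" if "v \<in> V0" for v i
    unfolding w_def by (rule conj_eigenvector[OF \<psi>_eq[OF that]])
  have WCeig: "WC (\<psi> v) *v w (\<psi> v) i = (- (1 / 2) * lam (\<psi> v) $ i) *\<^sub>R w (\<psi> v) i" if "v \<in> V0" for v i
  proof -
    have "v \<in> generic" using V0(2) that by blast
    from conj_WC_eigenvector[OF \<psi>_eq[OF that] this \<psi>_comm[OF that], of i]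
    show ?thesis by (simp add: lam_def w_def)
  qed
  \<comment> \<open>Positivity of the spectrum is what makes \<open>\<psi> v\<close> the inertia of a configuration.\<close>
  define V1 where "V1 = V0 \<inter> (\<Inter>i. {v. 0 < v $ i})"
  have oV1: "open V1"
    unfolding V1_def by (intro open_Int[OF Cinf_open[OF V0(3)]] open_INT ballI open_Collect_less continuous_intros) auto
  have v0V1: "v0 \<in> V1" using V0(1) v0_pos by (simp add: V1_def)
  have \<psi>Bal: "\<psi> v \<in> ?Bal" if "v \<in> V1" for v
  proof (rule balanced_inertiasI[OF \<psi>_eq])
    show "v \<in> V0" "0 < v $ i" for i using that by (auto simp: V1_def)
    then show "v \<in> generic" "\<psi> v \<in> \<Omega>" "WC (\<psi> v) ** \<psi> v = \<psi> v ** WC (\<psi> v)"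
      using V0(2) W0(2) \<psi>W0 \<psi>_comm by blast+
  qed (rule rank)
  define \<Lambda> where "\<Lambda> v = lam (\<psi> v)" for v
  have \<psi>C1: "Cinf V1 \<psi>" by (rule Cinf_subset[OF V0(3) oV1]) (simp add: V1_def)
  have \<Lambda>C: "Cinf V1 \<Lambda>"
    unfolding \<Lambda>_def by (rule Cinf_compose[OF \<psi>C1 lamC]) (auto simp: V1_def \<psi>W0)
  have lam0: "lam (diag v0) $ i = - 2 * c" for i
  proof -
    have w0: "w (diag v0) i = u i" by (simp add: w_def S0 rot_0)
    have "u i \<in> endo_image (diag v0)" by (simp add: endo_image_diag v0_nonzero span_base)
    then show ?thesis by (simp add: lam_def w0 central mdot_simps orthonormal)
  qed
  have \<Lambda>inj: "h = 0" if h: "frechet_derivative \<Lambda> (at v0) h = 0" for h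
  proof -
    define \<gamma> where "\<gamma> s = \<psi> (v0 + s *\<^sub>R h)" for s :: real
    define \<gamma>' where "\<gamma>' = frechet_derivative \<psi> (at v0) h"
    define l where "l s = (- (1/2)) *\<^sub>R \<Lambda> (v0 + s *\<^sub>R h)" for s :: real
    have line: "((\<lambda>s. v0 + s *\<^sub>R h) has_vector_derivative h) (at 0)"
      by (rule has_vector_derivative_line)
    have \<gamma>: "(\<gamma> has_vector_derivative \<gamma>') (at 0)"
      using Cinf_comp_has_vector_derivative[OF V0(3) line] V0(1)
      unfolding \<gamma>_def[abs_def] \<gamma>'_def by simp
    have \<gamma>0: "\<gamma> 0 = diag v0" by (simp add: \<gamma>_def \<psi>0)
    have "((\<lambda>s. \<Lambda> (v0 + s *\<^sub>R h)) has_vector_derivative 0) (at 0)"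
      using Cinf_comp_has_vector_derivative[OF \<Lambda>C line] v0V1 h by simp
    from bounded_linear.has_vector_derivative[OF bounded_linear_scaleR_right[of "- (1/2)"] this]
    have l: "(l has_vector_derivative 0) (at 0)" unfolding l_def[abs_def] scaleR_zero_right .
    have evV1: "\<forall>\<^sub>F s in nhds 0. v0 + s *\<^sub>R h \<in> V1"
      by (rule eventually_at_0_scaleR_in_open[OF oV1 v0V1])
    have "\<gamma>' = 0"
    proof (rule condition_H_injective[OF H x0 \<gamma> \<gamma>0 _ _ l])
      show "\<forall>\<^sub>F s in nhds 0. \<gamma> s \<in> ?Bal"
        using evV1 by (rule eventually_mono) (simp add: \<gamma>_def \<psi>Bal)
      show "\<forall>\<^sub>F s in nhds 0. orthonormal_basis_of m (endo_image (\<gamma> s)) (w (\<gamma> s)) \<and>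
          (\<forall>i. WC (\<gamma> s) *v w (\<gamma> s) i = (l s $ i) *\<^sub>R w (\<gamma> s) i)"
        using evV1
      proof (rule eventually_mono)
        fix s assume "v0 + s *\<^sub>R h \<in> V1"
        then have "v0 + s *\<^sub>R h \<in> V0" by (simp add: V1_def)
        from onb[OF this] WCeig[OF this]
        show "orthonormal_basis_of m (endo_image (\<gamma> s)) (w (\<gamma> s)) \<and>
          (\<forall>i. WC (\<gamma> s) *v w (\<gamma> s) i = (l s $ i) *\<^sub>R w (\<gamma> s) i)"
          by (simp add: \<gamma>_def l_def \<Lambda>_def)
      qed
      show "l 0 = (\<chi> i. c)" by (simp add: vec_eq_iff l_def \<Lambda>_def \<psi>0 lam0)
    qed
    have "((\<lambda>s. r (\<gamma> s)) has_vector_derivative frechet_derivative r (at (\<gamma> 0)) \<gamma>') (at 0)"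
      by (rule Cinf_comp_has_vector_derivative[OF rC \<gamma>]) (simp add: \<gamma>0 W0)
    moreover have "\<forall>\<^sub>F s in nhds 0. r (\<gamma> s) = v0 + s *\<^sub>R h"
      using evV1 by (rule eventually_mono) (simp add: \<gamma>_def r_def r\<psi> V1_def)
    ultimately have "((\<lambda>s. v0 + s *\<^sub>R h) has_vector_derivative frechet_derivative r (at (\<gamma> 0)) \<gamma>') (at 0)"
      by (rule has_vector_derivative_cong_nhds)
    from vector_derivative_unique_at[OF line this]
    show "h = 0" using linear_0[OF Cinf_linear_derivative[OF rC W0(1)]] by (simp add: \<open>\<gamma>' = 0\<close> \<gamma>0)
  qed
  obtain V3 V4 \<theta> where V3: "open V3" "V3 \<subseteq> V1" "v0 \<in> V3" and \<theta>: "Cinf V4 \<theta>" "\<Lambda> ` V3 = V4" "\<theta> ` V4 = V3"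
    "\<And>v. v \<in> V3 \<Longrightarrow> \<theta> (\<Lambda> v) = v" "\<And>y. y \<in> V4 \<Longrightarrow> \<Lambda> (\<theta> y) = y"
    by (rule smooth_inverse_function_theorem[OF \<Lambda>C v0V1 Cinf_has_derivative[OF \<Lambda>C v0V1] \<Lambda>inj]) (assumption, rule that)
  have V30: "v \<in> V0" if "v \<in> V3" for v using V3(2) that by (auto simp: V1_def)
  define W where "W = W0 \<inter> r -` V3"
  have oW: "open W" unfolding W_def
    by (rule continuous_open_preimage[OF Cinf_continuous_on[OF rC] oW0 V3(1)])
  have WW0: "W \<subseteq> W0" by (simp add: W_def)
  define N where "N = W \<inter> ?Bal"
  have \<psi>N: "\<psi> v \<in> N" if "v \<in> V3" for v
    using \<psi>W0[OF V30[OF that]] r\<psi>[OF V30[OF that]] \<psi>Bal[of v] that V3(2)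
    by (auto simp: N_def W_def r_def)
  have rN: "r B \<in> V3" and \<psi>rN: "\<psi> (r B) = B" if "B \<in> N" for B
  proof -
    show 1: "r B \<in> V3" using that by (simp add: N_def W_def)
    have "B \<in> ?Bal" "B \<in> W0" using that by (simp_all add: N_def W_def)
    note B = balanced_inertiasD[OF this(1)] this(2)
    show "\<psi> (r B) = B"
      unfolding r_def by (rule \<psi>r) (use B V30[OF 1] rank in \<open>simp_all add: r_def\<close>)
  qed
  have r\<psi>3: "r (\<psi> v) = v" if "v \<in> V3" for v using r\<psi>[OF V30[OF that]] by (simp add: r_def)
  have rCW: "Cinf W r" and lamCW: "Cinf W lam" by (rule Cinf_subset[OF rC oW WW0], rule Cinf_subset[OF lamC oW WW0])
  have \<psi>C3: "Cinf V3 \<psi>" by (rule Cinf_subset[OF \<psi>C1 V3(1,2)])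
  have \<psi>\<theta>C: "Cinf V4 (\<lambda>y. \<psi> (\<theta> y))" by (rule Cinf_compose[OF \<theta>(1) \<psi>C3]) (simp add: \<theta>(3))
  have \<theta>V3: "\<theta> y \<in> V3" if "y \<in> V4" for y using \<theta>(3) that by blast
  have lamN: "lam B \<in> V4" "\<psi> (\<theta> (lam B)) = B" if "B \<in> N" for B
  proof -
    have "lam B = \<Lambda> (r B)" by (simp add: \<Lambda>_def \<psi>rN[OF that])
    then show "lam B \<in> V4" "\<psi> (\<theta> (lam B)) = B"
      using \<theta>(2) rN[OF that] by (auto simp: \<theta>(4) \<psi>rN[OF that])
  qed
  have lam\<psi>: "lam (\<psi> (\<theta> y)) = y" if "y \<in> V4" for y using \<theta>(5)[OF that] by (simp add: \<Lambda>_def)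
  have N0: "diag v0 \<in> N" using \<psi>N[OF V3(3)] by (simp add: \<psi>0)
  have NW: "N \<subseteq> W" by (simp add: N_def)
  have sub1: "submanifold CARD('d) N"
    unfolding submanifold_def
  proof
    fix B assume B: "B \<in> N"
    have "B \<in> W" using B NW by blast
    have "\<exists>L U V f g. slice_chart N B L U V f g \<and> dim L = dim (UNIV :: (real^'d) set)"
      by (rule slice_chart_of_parametrization[OF rCW \<psi>C3 subspace_UNIV B \<open>B \<in> W\<close>])
        (simp_all add: rN \<psi>rN \<psi>N r\<psi>3)
    then show "\<exists>L U V f g. slice_chart N B L U V f g \<and> dim L = CARD('d)" by simp
  qed
  have sub2: "submanifold (CARD('d) - 1) {B\<in>N. lam B $ i = lam B $ j}" if ij: "i \<noteq> j" for i j
    unfolding submanifold_def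
  proof
    fix B assume B: "B \<in> {B\<in>N. lam B $ i = lam B $ j}"
    then have "B \<in> W" using NW by blast
    define T where "T = {y :: real^'d. y $ i = y $ j}"
    have T_eq: "T = {y. (axis i 1 - axis j 1) \<bullet> y = 0}"
      by (simp add: T_def inner_diff_left inner_axis')
    have "(axis i 1 - axis j 1 :: real^'d) \<noteq> 0" using ij by (auto simp: vec_eq_iff axis_def)
    then have dT: "dim T = CARD('d) - 1" unfolding T_eq by (simp add: dim_hyperplane)
    have sT: "subspace T" unfolding T_eq by (rule subspace_hyperplane)
    have "\<exists>L U V f g. slice_chart {B\<in>N. lam B $ i = lam B $ j} B L U V f g \<and> dim L = dim T"
      by (rule slice_chart_of_parametrization[OF lamCW \<psi>\<theta>C sT B \<open>B \<in> W\<close>])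
        (simp_all add: T_def lamN lam\<psi> \<psi>N \<theta>V3)
    then show "\<exists>L U V f g. slice_chart {B\<in>N. lam B $ i = lam B $ j} B L U V f g \<and> dim L = CARD('d) - 1"
      by (simp add: dT)
  qed
  have diff1: "diffeomorphism N V3 r \<psi>"
    by (rule diffeomorphismI[OF rCW NW _ \<psi>C3 subset_refl]) (auto simp: rN \<psi>rN \<psi>N r\<psi>3)
  have diff2: "diffeomorphism N V4 lam (\<lambda>y. \<psi> (\<theta> y))"
    by (rule diffeomorphismI[OF lamCW NW _ \<psi>\<theta>C subset_refl]) (auto simp: lamN lam\<psi> \<psi>N \<theta>V3)
  have frame: "orthonormal_basis_of m (endo_image B) (w B)" "B *v w B i = (r B $ i) *\<^sub>R w B i"
    "WC B *v w B i = (- (1 / 2) * lam B $ i) *\<^sub>R w B i" if "B \<in> N" for B i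
    using onb[OF V30[OF rN[OF that]]] eig[OF V30[OF rN[OF that]]] WCeig[OF V30[OF rN[OF that]]]
    unfolding \<psi>rN[OF that] by blast+
  have mult: "multiple_eigenvalue_on (endo_image B) (WC B) \<longleftrightarrow> (\<exists>i j. i \<noteq> j \<and> lam B $ i = lam B $ j)"
    if "B \<in> N" for B
    using multiple_eigenvalue_iff[where v = "\<lambda>i. - (1 / 2) * lam B $ i", OF frame(1,3)[OF that]] by simp
  have w0: "w (diag v0) = u" by (simp add: w_def[abs_def] S0 rot_0)
  have wcont: "continuous_on N (\<lambda>B. w B i)" for i
    by (rule continuous_on_subset[OF Cinf_continuous_on[OF wC]]) (use NW WW0 in blast)
  have W_0: "diag v0 \<in> W" using N0 NW by blast
  have deg: "{B\<in>N. multiple_eigenvalue_on (endo_image B) (WC B)} =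
        (\<Union>i. \<Union>j\<in>- {i}. {B\<in>N. lam B $ i = lam B $ j})"
    using mult by fastforce
  show ?thesis
    unfolding Let_def
    apply (rule exI[of _ W], rule exI[of _ r], rule exI[of _ lam], rule exI[of _ w])
    unfolding N_def[symmetric]
    by (intro conjI oW W_0 w0 allI impI wcont ballI sub1 sub2 deg exI[of _ V3] exI[of _ V4] exI[of _ \<psi>]
        exI[of _ "\<lambda>y. \<psi> (\<theta> y)"] diff1 diff2 V3(1) Cinf_open[OF \<theta>(1)] frame)
      (simp_all add: N0 lam0)
qed

end

theorem proposition6:
  fixes m :: "'n::{finite,linorder} disp" and G :: real
    and x0 :: "'n \<Rightarrow> 'e::euclidean_space"
    and B0 :: "'n endo" and u0 :: "'d::finite \<Rightarrow> 'n disp"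
  assumes "\<And>i. 0 < m $ i" and "0 < G"
    and "central m G x0" and "general_type m G x0"
    and "config_rank x0 = CARD('d)"
    and "condition_H m G x0"
    and "B0 = inertia m x0"
    and "orthonormal_basis_of m (endo_image B0) u0"
    and "\<And>i. \<exists>c. B0 *v u0 i = c *\<^sub>R u0 i"
  shows "\<exists>W (b :: 'n endo \<Rightarrow> real^'d) (lam :: 'n endo \<Rightarrow> real^'d) (u :: 'n endo \<Rightarrow> 'd \<Rightarrow> 'n disp).
    open W \<and> B0 \<in> W \<and>
    (let N = W \<inter> balanced_inertias m G x0 in
      u B0 = u0 \<and> (\<forall>i. continuous_on N (\<lambda>B. u B i)) \<and>
      (\<forall>B\<in>N. orthonormal_basis_of m (endo_image B) (u B) \<and>
        (\<forall>i. B *v u B i = (b B $ i) *\<^sub>R u B i \<and>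
             WC_inertia m G B *v u B i = (- (1 / 2) * lam B $ i) *\<^sub>R u B i)) \<and>
      submanifold CARD('d) N \<and>
      (\<exists>V h. open V \<and> diffeomorphism N V b h) \<and>
      (\<exists>V h. open V \<and> diffeomorphism N V lam h) \<and>
      {B\<in>N. multiple_eigenvalue_on (endo_image B) (WC_inertia m G B)} =
        (\<Union>i. \<Union>j\<in>- {i}. {B\<in>N. lam B $ i = lam B $ j}) \<and>
      (\<forall>i j. i \<noteq> j \<longrightarrow>
        B0 \<in> {B\<in>N. lam B $ i = lam B $ j} \<and>
        submanifold (CARD('d) - 1) {B\<in>N. lam B $ i = lam B $ j}))"
proof -
  interpret masses m by unfold_locales (rule assms(1))
  have ou: "mdot m (u0 i) (u0 j) = (if i = j then 1 else 0)" and su: "span (range u0) = endo_image B0" for i j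
    using assms(8) by (simp_all add: orthonormal_basis_of_def)
  have uB: "u0 i \<in> endo_image B0" for i unfolding su[symmetric] by (simp add: span_base)
  have sym: "B0 \<in> sym_endo m" unfolding assms(7) by (rule inertia_sym)
  have uD: "u0 i \<in> Dstar" for i using uB subset_Dstar_endo_image[OF sym] by blast
  obtain c0 where c0: "\<And>i. B0 *v u0 i = c0 i *\<^sub>R u0 i" using assms(9) by metis
  define v0 :: "real^'d" where "v0 = (\<chi> i. c0 i)"
  have ev: "B0 *v u0 i = v0 $ i *\<^sub>R u0 i" for i by (simp add: v0_def c0)
  have pos: "0 < v0 $ i" for i
  proof -
    have "v0 $ i = mdot m (B0 *v u0 i) (u0 i)" by (simp add: ev mdot_simps ou)
    also have "\<dots> = config_map x0 (u0 i) \<bullet> config_map x0 (u0 i)"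
      unfolding assms(7) by (rule inertia_inner[OF uD uD])
    finally have "0 \<le> v0 $ i" by simp
    moreover have "v0 $ i \<noteq> 0"
    proof
      assume "v0 $ i = 0"
      then have B0u: "B0 *v u0 i = 0" by (simp add: ev)
      obtain \<xi> where "u0 i = B0 *v \<xi>" using uB[of i] by (auto simp: endo_image_def)
      then have "mdot m (u0 i) (u0 i) = mdot m \<xi> (B0 *v u0 i)"
        using sym by (simp add: sym_endo_iff selfadjoint_def)
      then show False by (simp add: ou B0u mdot_simps)
    qed
    ultimately show ?thesis by simp
  qed
  have inj: "i = j" if e: "v0 $ i = v0 $ j" for i j
  proof (rule ccontr)
    assume ij: "i \<noteq> j"
    have "{u0 i, u0 j} \<subseteq> eigenspace_on Dstar B0 (v0 $ i)"
      using ev uD by (simp add: eigenspace_on_def e)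
    moreover have "independent {u0 i, u0 j}"
      by (rule independent_mono[OF orthonormal_independent[of u0, OF ou]]) auto
    ultimately have "card {u0 i, u0 j} \<le> dim (eigenspace_on Dstar B0 (v0 $ i))"
      by (rule independent_card_le_dim)
    also have "\<dots> \<le> 1"
      using assms(4) pos[of i] unfolding general_type_def assms(7)[symmetric] by simp
    finally have "card {u0 i, u0 j} \<le> 1" .
    moreover have "u0 i \<noteq> u0 j" using orthonormal_inj[of u0, OF ou] ij by (auto dest: injD)
    ultimately show False by simp
  qed
  interpret nbody_frame m u0 v0 G
    by unfold_locales (use ou uD inj pos in \<open>auto simp: less_imp_neq[symmetric]\<close>)
  have B0: "diag v0 = B0"
    unfolding matrix_eq
    by (simp add: spectral_expansion[OF sym assms(8) ev] diag_def mv_simps eproj_Some proj_mult_vec)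
  obtain c where c: "\<And>\<xi>. \<xi> \<in> endo_image B0 \<Longrightarrow> WC_inertia m G B0 *v \<xi> = c *\<^sub>R \<xi>"
    using assms(3) unfolding central_def WC_config_eq[OF assms(1)] assms(7)[symmetric] by blast
  have nd: "nondegenerate_critical_point_on (potential m G) (isospectral m B0) B0"
    and bal: "balanced m G x0"
    using assms(4) unfolding general_type_def assms(7) by blast+
  from balanced_inertias_near_central[unfolded B0, OF assms(7)[symmetric] assms(5) nd bal c pos assms(6)]
  show ?thesis .
qed

end
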